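(* Let $d\ge 1$ be an integer, let $N,\sigma,r,\delta>0$ and $\nu\ge 1$ be real with $\delta<N$, let $v:\mathbb{R}^d\to\mathbb{C}$ be integrable and satisfy $$Q_v(\lambda)\le N\exp(\sigma\lambda^{\nu})\quad\text{for all }\lambda\ge 0,$$ and let $w$ be a function on $B_r$ with $\|w-\mathcal{F}v\|_{L^\infty(B_r)}\le\delta$. Assume also that $v\in\mathcal{H}^m(\mathbb{R}^d)$ for some real $m\ge-\frac d2$ and that $\|v\|_{\mathcal{H}^m(\mathbb{R}^d)}\le\gamma_2$. Then, for any $\alpha\in[0,1]$ and any real $s<m$, with $\tau=1-\sqrt{1-(1-\alpha)\nu^{-1}}$, $$\left\|v-\mathcal{F}^{-1}\mathcal{C}^*_{\tau,\delta}w\right\|_{\mathcal{H}^s(\mathbb{R}^d)}\le 8(2\pi)^{d/2}N^{1-\alpha}\left(c(d)\int_0^{rL_\tau(\delta)}(1+t^2)^s\,t^{d-1}\,dt\right)^{1/2}L_\tau(\delta)\,\delta^{\alpha}+\gamma_2\,r^{-m+s}\,(L_\tau(\delta))^{-m+s}.$$ In particular, for any $\beta_2$ such that $0<\frac{\beta_2}{m-s}<1-\sqrt{1-\nu^{-1}}$, one has, with $\tau=\frac{\beta_2}{m-s}$, $$\left\|v-\mathcal{F}^{-1}\mathcal{C}^*_{\tau,\delta}w\right\|_{\mathcal{H}^s(\mathbb{R}^d)}\le c_2\left(\ln(3+\delta^{-1})\right)^{-\beta_2},$$ where $c_2=c_2(N,\sigma,\nu,r,m,s,\gamma_2,d,\beta_2)$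 is a positive constant (depending only on the listed parameters).
   Context: Fourier transforms: $\mathcal{F}v(\xi)=\frac{1}{(2\pi)^d}\int_{\mathbb{R}^d}e^{i\xi x}v(x)\,dx$ and $\mathcal{F}^{-1}[u](x)=\int_{\mathbb{R}^d}u(\xi)e^{-i\xi x}\,d\xi$ (extended to $L^2$ as usual). $B_\rho=\{\xi\in\mathbb{R}^d:|\xi|<\rho\}$. For integrable $v$ and $\lambda\ge0$, $Q_v(\lambda)=\frac{1}{(2\pi)^d}\int_{\mathbb{R}^d}e^{\lambda|x|}|v(x)|\,dx$. Chebyshev polynomials: $T_k$, $k\in\mathbb{N}=\{0,1,\dots\}$, is the polynomial with $T_k(t)=\cos(k\arccos t)$ for $t\in[-1,1]$, extended as a polynomial to $|t|>1$. Extrapolation operator: for $r>0$, $R\ge r$, $n\in\mathbb{N}$ and $w\in L^\infty(B_r)$, $$[\mathcal{C}_{R,n}w](\xi)=\begin{cases}w(\xi),&\xi\in B_r,\\ \sum_{k=0}^{n-1}a_k\left(\frac{\xi}{|\xi|}\right)T_k\left(\frac{|\xi|}{r}\right),&\xi\in B_R\setminus B_r,\\ 0,&\xi\in\mathbb{R}^d\setminus B_R,\end{cases}$$ where the sum is $0$ for $n=0$ and, for (almost every) $\theta\in S^{d-1}$, $a_0(\theta)=\frac1\pi\int_{-r}^r\frac{w(t\theta)}{\sqrt{r^2-t^2}}\,dt$ and $a_k(\theta)=\frac2\pi\int_{-r}^r\frac{w(t\theta)T_k(t/r)}{\sqrt{r^2-t^2}}\,dt$ for $k\ge1$. Choice of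 parameters: for $\tau\in[0,1]$ and $0<\delta<N$, $$L_\tau(\delta)=\max\left\{1,\ \frac12\left(\frac{(1-\tau)\ln\frac N\delta}{\sigma r^\nu}\right)^{\tau}\right\},\qquad R_\tau(\delta)=rL_\tau(\delta),$$ $n_\tau(\delta)=\left\lceil\frac{(2-\tau)\ln\frac N\delta}{\ln2+\frac{1}{\tau\nu}\ln(2L_\tau(\delta))}\right\rceil$ if $\tau>0$, $n_0(\delta)=0$, and $\mathcal{C}^*_{\tau,\delta}=\mathcal{C}_{R_\tau(\delta),n_\tau(\delta)}$. $c(d)=\int_{\partial B_1}1\,dx=\frac{d\pi^{d/2}}{\Gamma(\frac d2+1)}$. For $s\in\mathbb{R}$, $\mathcal{H}^s(\mathbb{R}^d)=\{u\in L^2(\mathbb{R}^d):\mathcal{F}^{-1}(1+|\xi|^2)^{s/2}\mathcal{F}u\in L^2(\mathbb{R}^d)\}$ with norm $\|u\|_{\mathcal{H}^s(\mathbb{R}^d)}=\|\mathcal{F}^{-1}(1+|\xi|^2)^{s/2}\mathcal{F}u\|_{L^2(\mathbb{R}^d)}$. *)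

theory Defs
  imports
    "HOL-Analysis.Analysis"
    "HOL-Computational_Algebra.Polynomial"
    "HOL-Probability.Essential_Supremum"
begin

section \<open>The Hilbert space of square-integrable functions\<close>

definition L2 :: "('a::euclidean_space \<Rightarrow> complex) set" where
  "L2 = {f \<in> borel_measurable lebesgue. integrable lebesgue (\<lambda>x. (norm (f x))\<^sup>2)}"

definition L2_norm :: "('a::euclidean_space \<Rightarrow> complex) \<Rightarrow> real" where
  "L2_norm f = sqrt (\<integral>x. (norm (f x))\<^sup>2 \<partial>lebesgue)"

definition L2_tendsto :: "(nat \<Rightarrow> 'a::euclidean_space \<Rightarrow> complex) \<Rightarrow> ('a \<Rightarrow> complex) \<Rightarrow> bool" where
  "L2_tendsto f g \<longleftrightarrow>
     (\<forall>n. f n \<in> L2) \<and> g \<in> L2 \<and> (\<lambda>n. L2_norm (\<lambda>x. f n x - g x)) \<longlonglongrightarrow> 0"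

section \<open>Fourier transforms\<close>

definition fourier_L1 :: "('a::euclidean_space \<Rightarrow> complex) \<Rightarrow> 'a \<Rightarrow> complex" where
  "fourier_L1 v \<xi> =
     of_real (1 / (2 * pi) ^ DIM('a)) * (\<integral>x. exp (\<i> * of_real (\<xi> \<bullet> x)) * v x \<partial>lebesgue)"

definition inv_fourier_L1 :: "('a::euclidean_space \<Rightarrow> complex) \<Rightarrow> 'a \<Rightarrow> complex" where
  "inv_fourier_L1 u x = (\<integral>\<xi>. u \<xi> * exp (- \<i> * of_real (\<xi> \<bullet> x)) \<partial>lebesgue)"

text \<open>The extension by continuity to \<open>L\<^sup>2\<close> of an operator \<open>T\<close> given on \<open>L\<^sup>1\<close>: the value at \<open>u\<close> is
  the common \<open>L\<^sup>2\<close> limit of \<open>T (f n)\<close> for all sequences \<open>f\<close> in \<open>L\<^sup>1 \<inter> L\<^sup>2\<close> that converge to \<open>u\<close>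
  in \<open>L\<^sup>2\<close>.  As functions are not identified almost everywhere, a representative is chosen.\<close>

definition L2_extension ::
  "(('a::euclidean_space \<Rightarrow> complex) \<Rightarrow> 'a \<Rightarrow> complex) \<Rightarrow> ('a \<Rightarrow> complex) \<Rightarrow> 'a \<Rightarrow> complex" where
  "L2_extension T u =
     (SOME g. \<forall>f. (\<forall>n. integrable lebesgue (f n)) \<and> L2_tendsto f u \<longrightarrow> L2_tendsto (\<lambda>n. T (f n)) g)"

definition fourier :: "('a::euclidean_space \<Rightarrow> complex) \<Rightarrow> 'a \<Rightarrow> complex" where
  "fourier v = (if integrable lebesgue v then fourier_L1 v else L2_extension fourier_L1 v)"

definition inv_fourier :: "('a::euclidean_space \<Rightarrow> complex) \<Rightarrow> 'a \<Rightarrow> complex" where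
  "inv_fourier u = (if integrable lebesgue u then inv_fourier_L1 u else L2_extension inv_fourier_L1 u)"

section \<open>Sobolev spaces\<close>

definition sobolev_multiplier :: "real \<Rightarrow> ('a::euclidean_space \<Rightarrow> complex) \<Rightarrow> 'a \<Rightarrow> complex" where
  "sobolev_multiplier s u \<xi> = of_real ((1 + (norm \<xi>)\<^sup>2) powr (s / 2)) * fourier u \<xi>"

text \<open>The condition \<open>sobolev_multiplier s u \<in> L2\<close> says that the function lies in the domain of the
  inverse Fourier transform on \<open>L\<^sup>2\<close>; outside this domain \<open>inv_fourier\<close> has no meaning here.\<close>

definition sobolev_space :: "real \<Rightarrow> ('a::euclidean_space \<Rightarrow> complex) set" where
  "sobolev_space s =
     {u \<in> L2. sobolev_multiplier s u \<in> L2 \<and> inv_fourier (sobolev_multiplier s u) \<in> L2}"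

definition sobolev_norm :: "real \<Rightarrow> ('a::euclidean_space \<Rightarrow> complex) \<Rightarrow> real" where
  "sobolev_norm s u = L2_norm (inv_fourier (sobolev_multiplier s u))"

section \<open>The exponentially weighted norm\<close>

text \<open>The value is infinite when the weighted function is not integrable.\<close>

definition Q :: "('a::euclidean_space \<Rightarrow> complex) \<Rightarrow> real \<Rightarrow> ennreal" where
  "Q v l = ennreal (1 / (2 * pi) ^ DIM('a)) *
     (\<integral>\<^sup>+x. ennreal (exp (l * norm x) * norm (v x)) \<partial>lebesgue)"

section \<open>Chebyshev polynomials\<close>

definition cheb :: "nat \<Rightarrow> real poly" where
  "cheb k = (THE p. \<forall>t\<in>{-1..1}. poly p t = cos (real k * arccos t))"

lemma ex1_cheb: "\<exists>!p::real poly. \<forall>t\<in>{-1..1}. poly p t = cos (real k * arccos t)"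
proof (rule ex_ex1I)
  have "(\<exists>p::real poly. \<forall>t\<in>{-1..1}. poly p t = cos (real k * arccos t)) \<and>
        (\<exists>p::real poly. \<forall>t\<in>{-1..1}. poly p t = cos (real (Suc k) * arccos t))"
  proof (induction k)
    case 0
    show ?case
      by (rule conjI, rule exI[of _ 1], simp, rule exI[of _ "[:0, 1:]"], simp)
  next
    case (Suc k)
    then obtain p q :: "real poly"
      where p: "\<forall>t\<in>{-1..1}. poly p t = cos (real k * arccos t)"
        and q: "\<forall>t\<in>{-1..1}. poly q t = cos (real (Suc k) * arccos t)"
      by blast
    have "poly ([:0, 2:] * q - p) t = cos (real (Suc (Suc k)) * arccos t)" if t: "t \<in> {-1..1}" for t
    proof -
      define a where "a = arccos t"
      have "cos a = t"
        using t by (simp add: a_def)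
      moreover have "cos (real (Suc k) * a + a) + cos (real (Suc k) * a - a) =
          2 * cos (real (Suc k) * a) * cos a"
        by (simp add: cos_add cos_diff del: of_nat_Suc)
      moreover have "real (Suc k) * a + a = real (Suc (Suc k)) * a" "real (Suc k) * a - a = real k * a"
        by (simp_all add: algebra_simps)
      moreover have "poly p t = cos (real k * a)" "poly q t = cos (real (Suc k) * a)"
        using p q t unfolding a_def by blast+
      ultimately have "poly ([:0, 2:] * q - p) t = cos (real (Suc (Suc k)) * a)"
        by (simp add: mult_ac del: of_nat_Suc)
      then show ?thesis
        by (simp only: a_def)
    qed
    with q show ?case
      by blast
  qed
  then show "\<exists>p::real poly. \<forall>t\<in>{-1..1}. poly p t = cos (real k * arccos t)" ..
next
  fix p q :: "real poly"
  assume "\<forall>t\<in>{-1..1}. poly p t = cos (real k * arccos t)"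
    and "\<forall>t\<in>{-1..1}. poly q t = cos (real k * arccos t)"
  then have "{-1..1} \<subseteq> {t. poly (p - q) t = 0}"
    by auto
  moreover have "infinite {-1..1::real}"
    by (simp add: infinite_Icc)
  ultimately have "p - q = 0"
    using poly_roots_finite finite_subset by blast
  then show "p = q"
    by simp
qed

lemma poly_cheb: "t \<in> {-1..1} \<Longrightarrow> poly (cheb k) t = cos (real k * arccos t)"
  using theI'[OF ex1_cheb[of k]] unfolding cheb_def by blast

section \<open>The extrapolation operator\<close>

definition cheb_coeff :: "real \<Rightarrow> ('a::euclidean_space \<Rightarrow> complex) \<Rightarrow> nat \<Rightarrow> 'a \<Rightarrow> complex" where
  "cheb_coeff r w k \<theta> =
     of_real ((if k = 0 then 1 else 2) / pi) *
     (LINT t:{-r<..<r}|lebesgue. w (t *\<^sub>R \<theta>) * of_real (poly (cheb k) (t / r)) / of_real (sqrt (r\<^sup>2 - t\<^sup>2)))"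

definition extrapolate ::
  "real \<Rightarrow> real \<Rightarrow> nat \<Rightarrow> ('a::euclidean_space \<Rightarrow> complex) \<Rightarrow> 'a \<Rightarrow> complex" where
  "extrapolate r R n w \<xi> =
     (if \<xi> \<in> ball 0 r then w \<xi>
      else if \<xi> \<in> ball 0 R then
        (\<Sum>k<n. cheb_coeff r w k (\<xi> /\<^sub>R norm \<xi>) * of_real (poly (cheb k) (norm \<xi> / r)))
      else 0)"

definition Lpar :: "real \<Rightarrow> real \<Rightarrow> real \<Rightarrow> real \<Rightarrow> real \<Rightarrow> real \<Rightarrow> real" where
  "Lpar N \<sigma> \<nu> r \<tau> \<delta> = max 1 (1/2 * (((1 - \<tau>) * ln (N / \<delta>)) / (\<sigma> * r powr \<nu>)) powr \<tau>)"

definition npar :: "real \<Rightarrow> real \<Rightarrow> real \<Rightarrow> real \<Rightarrow> real \<Rightarrow> real \<Rightarrow> nat" where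
  "npar N \<sigma> \<nu> r \<tau> \<delta> =
     (if \<tau> > 0 then
        nat \<lceil>((2 - \<tau>) * ln (N / \<delta>)) / (ln 2 + 1 / (\<tau> * \<nu>) * ln (2 * Lpar N \<sigma> \<nu> r \<tau> \<delta>))\<rceil>
      else 0)"

definition extrapolate_star ::
  "real \<Rightarrow> real \<Rightarrow> real \<Rightarrow> real \<Rightarrow> real \<Rightarrow> real \<Rightarrow> ('a::euclidean_space \<Rightarrow> complex) \<Rightarrow> 'a \<Rightarrow> complex" where
  "extrapolate_star N \<sigma> \<nu> r \<tau> \<delta> w =
     extrapolate r (r * Lpar N \<sigma> \<nu> r \<tau> \<delta>) (npar N \<sigma> \<nu> r \<tau> \<delta>) w"

text \<open>The surface area of the unit sphere in dimension \<open>d\<close>.\<close>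

definition sphere_area :: "nat \<Rightarrow> real" where
  "sphere_area d = real d * pi powr (real d / 2) / Gamma (real d / 2 + 1)"

section \<open>Data and reconstruction error\<close>

text \<open>The values of \<open>w\<close> outside \<open>ball 0 r\<close> are irrelevant.\<close>

definition admissible_data ::
  "real \<Rightarrow> real \<Rightarrow> real \<Rightarrow> real \<Rightarrow> real \<Rightarrow> ('a::euclidean_space \<Rightarrow> complex) \<Rightarrow> ('a \<Rightarrow> complex) \<Rightarrow> bool" where
  "admissible_data N \<sigma> \<nu> r \<delta> v w \<longleftrightarrow>
     integrable lebesgue v \<and>
     (\<forall>l\<ge>0. Q v l \<le> ennreal (N * exp (\<sigma> * l powr \<nu>))) \<and>
     w \<in> borel_measurable (lebesgue_on (ball 0 r)) \<and>
     esssup (lebesgue_on (ball 0 r)) (\<lambda>\<xi>. ereal (norm (w \<xi> - fourier v \<xi>))) \<le> ereal \<delta>"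

definition reconstruction_error ::
  "real \<Rightarrow> real \<Rightarrow> real \<Rightarrow> real \<Rightarrow> real \<Rightarrow> real \<Rightarrow> ('a::euclidean_space \<Rightarrow> complex) \<Rightarrow> ('a \<Rightarrow> complex) \<Rightarrow> 'a \<Rightarrow> complex" where
  "reconstruction_error N \<sigma> \<nu> r \<tau> \<delta> v w x = v x - inv_fourier (extrapolate_star N \<sigma> \<nu> r \<tau> \<delta> w) x"

end

theory Submission
  imports
    Defs
    "HOL-Complex_Analysis.Cauchy_Integral_Formula"
    "HOL-Probability.Characteristic_Functions"
begin

text \<open>
  Restricted to a line through the origin, the transform \<open>f t = fourier v (t *\<^sub>R \<theta>)\<close> extends to an entire
  function of \<open>t\<close>, and \<open>Q v\<close> bounds it by \<open>N * exp (\<sigma> * \<bar>Im t\<bar> powr \<nu>)\<close>.  The Chebyshev expansion of \<open>f\<close> on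
  \<open>[-r, r]\<close> therefore converges on all of \<open>\<real>\<close>.  If \<open>f\<close> is bounded by \<open>M\<close> on the Bernstein ellipse of
  parameter \<open>\<rho> \<ge> 4 * L\<close>, the remainder after \<open>n\<close> terms is at most \<open>2 * M * (2 * L / \<rho>) ^ n\<close> at the points
  with \<open>r \<le> \<bar>t\<bar> \<le> r * L\<close>; this is \<open>cheb_expansion_remainder\<close>, which is applied to each exponential
  \<open>exp (\<i> * (\<xi> \<bullet> x))\<close> and integrated against \<open>v\<close> in \<open>fourier_ray_remainder\<close>.  An error \<open>\<delta>\<close> in the data
  changes the coefficient of order \<open>k\<close> by at most \<open>2 * \<delta>\<close>, and by at most \<open>\<delta>\<close> for \<open>k = 0\<close>.  As
  \<open>2 * T\<^sub>k(t) \<le> (2 * t) ^ k\<close> for \<open>t \<ge> 1\<close> and \<open>k \<ge> 1\<close>, the data error grows to at most \<open>\<delta> * (2 * L) ^ n\<close>.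

  If \<open>L > 1\<close> and \<open>n\<close> are as prescribed, the radius \<open>\<rho> = 2 * (2 * L) powr (1 / (\<tau> * \<nu>))\<close> makes the bound on the
  ellipse equal to \<open>N * (N / \<delta>) powr (1 - \<tau>)\<close> and \<open>\<rho> ^ n\<close> at least \<open>(N / \<delta>) powr (2 - \<tau>)\<close>, whence the
  remainder is at most \<open>2 * \<delta> * (2 * L) ^ n\<close> as well.  Since \<open>(2 - \<tau>) * \<tau> * \<nu> = 1 - \<alpha>\<close>, the power
  \<open>(2 * L) ^ n\<close> is at most \<open>2 * L * (N / \<delta>) powr (1 - \<alpha>)\<close>.  This gives a uniform bound on the ball of
  radius \<open>r * L\<close> (\<open>parameter_choice\<close>, \<open>extrapolate_star_error\<close>).

  By Plancherel's identity the norm of order \<open>s\<close> of the reconstruction error is \<open>(2 * pi) powr (d / 2)\<close> times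
  the weighted \<open>L\<^sup>2\<close> norm of the difference between \<open>fourier v\<close> and the extrapolated data.  On the ball of
  radius \<open>r * L\<close> the uniform bound is integrated against the weight, in polar coordinates; outside this ball
  only \<open>fourier v\<close> is left, and the passage from order \<open>m\<close> to order \<open>s\<close> gains the factor
  \<open>(r * L) powr (s - m)\<close> (\<open>Sobolev_estimate\<close>).  The error is in general not integrable, and its transform
  is a limit in \<open>L\<^sup>2\<close>; \<open>fourier_diff_inv_fourier\<close> identifies it.  Plancherel's identity itself is
  obtained by Gaussian regularisation: \<open>\<bar>fourier h\<bar>\<^sup>2\<close> is, up to a constant, the transform of the
  autocorrelation of \<open>h\<close>, which is continuous at the origin.

  For the logarithmic rate, \<open>L\<close> is bounded below by a multiple of \<open>ln (3 + 1 / \<delta>) powr \<tau>\<close>, which turns the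
  second term of the estimate into the required power, while the first term is a power of the logarithm
  times \<open>\<delta> powr \<alpha>\<close> and hence smaller.
\<close>

section \<open>Borel representatives and integrals over Euclidean space\<close>

lemma integrable_pair_dominated:
  fixes f :: "'a::euclidean_space \<Rightarrow> 'b::euclidean_space \<Rightarrow> complex"
  assumes f: "(\<lambda>(x, y). f x y) \<in> borel_measurable (lborel \<Otimes>\<^sub>M lborel)"
    and a: "integrable lborel a" and b: "integrable lborel b"
    and le: "\<And>x y. cmod (f x y) \<le> a x * b y"
  shows "integrable (lborel \<Otimes>\<^sub>M lborel) (\<lambda>(x, y). f x y)"
proof -
  note [measurable] = borel_measurable_integrable[OF a] borel_measurable_integrable[OF b]
  have "integrable (lborel \<Otimes>\<^sub>M lborel) (\<lambda>(x, y). a x * b y)"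
  proof (rule lborel_pair.Fubini_integrable)
    show "integrable lborel (\<lambda>x. \<integral>y. norm (case (x, y) of (x, y) \<Rightarrow> a x * b y) \<partial>lborel)"
      using a by (simp add: abs_mult)
    show "AE x in lborel. integrable lborel (\<lambda>y. case (x, y) of (x, y) \<Rightarrow> a x * b y)"
      using b by simp
  qed measurable
  then show ?thesis
    by (rule Bochner_Integration.integrable_bound[OF _ f]) (auto intro!: AE_I2 order.trans[OF le abs_ge_self])
qed

text \<open>The kernels below are bounded oscillating factors times a product of two integrable functions, so that
  domination by a product is the form in which Fubini's theorem is needed throughout.\<close>

lemma fubini_dominated:
  fixes f :: "'a::euclidean_space \<Rightarrow> 'b::euclidean_space \<Rightarrow> complex"
  assumes f: "(\<lambda>(x, y). f x y) \<in> borel_measurable (lborel \<Otimes>\<^sub>M lborel)"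
    and a: "integrable lborel a" and b: "integrable lborel b"
    and le: "\<And>x y. cmod (f x y) \<le> a x * b y"
  shows "(\<integral>y. (\<integral>x. f x y \<partial>lborel) \<partial>lborel) = (\<integral>x. (\<integral>y. f x y \<partial>lborel) \<partial>lborel)"
  by (rule lborel_pair.Fubini_integral[OF integrable_pair_dominated[OF assms]])

text \<open>Compositions such as \<open>h (u + y)\<close> or \<open>w (t *\<^sub>R \<theta>)\<close> of a Lebesgue measurable function need not be measurable for
  a product \<open>\<sigma>\<close>-algebra.  All arguments with several variables are therefore made for Borel representatives.\<close>

lemma lebesgue_AE_borel_complex:
  fixes f :: "'a::euclidean_space \<Rightarrow> complex"
  assumes "f \<in> borel_measurable lebesgue"
  obtains g where "g \<in> borel_measurable borel" "AE x in lborel. f x = g x"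
proof -
  have "(\<lambda>x. Re (f x)) \<in> borel_measurable lebesgue" "(\<lambda>x. Im (f x)) \<in> borel_measurable lebesgue"
    using assms by measurable
  then obtain a b where "a \<in> borel_measurable lborel" "AE x in lborel. Re (f x) = a x"
      "b \<in> borel_measurable lborel" "AE x in lborel. Im (f x) = b x"
    using completion_ex_borel_measurable_real by metis
  then have "(\<lambda>x. Complex (a x) (b x)) \<in> borel_measurable borel" "AE x in lborel. f x = Complex (a x) (b x)"
    by (auto simp: borel_measurable_complex_iff complex_eq_iff elim!: eventually_elim2)
  then show ?thesis by (rule that)
qed

lemma AE_lebesgue_iff: "(AE x in lebesgue. P x) \<longleftrightarrow> (AE x in lborel. P x)"
  by (rule AE_completion_iff)

text \<open>Lebesgue measure is complete.\<close>

lemma borel_measurable_lebesgue_AE: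
  fixes f g :: "'a::euclidean_space \<Rightarrow> 'b::topological_space"
  assumes g: "g \<in> borel_measurable lebesgue" and ae: "AE x in lborel. f x = g x"
  shows "f \<in> borel_measurable lebesgue"
proof (rule measurableI)
  fix A :: "'b set" assume A: "A \<in> sets borel"
  have "AE x in lebesgue. x \<in> g -` A \<inter> space lebesgue \<longleftrightarrow> x \<in> f -` A \<inter> space lebesgue"
    unfolding AE_lebesgue_iff using ae by eventually_elim auto
  then show "f -` A \<inter> space lebesgue \<in> sets lebesgue"
    by (rule completion.in_sets_AE) (use measurable_sets[OF g A] in auto)
qed simp

lemma fourier_L1_cong_AE:
  fixes v v' :: "'a::euclidean_space \<Rightarrow> complex"
  assumes "AE x in lborel. v x = v' x" "v \<in> borel_measurable lebesgue" "v' \<in> borel_measurable lebesgue"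
  shows "fourier_L1 v = fourier_L1 v'"
proof
  fix \<xi>
  have e: "(\<lambda>x::'a. exp (\<i> * of_real (\<xi> \<bullet> x))) \<in> borel_measurable lebesgue"
    by (intro measurable_completion) auto
  show "fourier_L1 v \<xi> = fourier_L1 v' \<xi>"
    unfolding fourier_L1_def using assms e
    by (intro arg_cong2[where f="(*)"] refl integral_cong_AE borel_measurable_times)
       (auto simp: AE_lebesgue_iff elim!: eventually_mono)
qed

lemma fourier_L1_lborel:
  fixes v :: "'a::euclidean_space \<Rightarrow> complex"
  assumes [measurable]: "v \<in> borel_measurable borel"
  shows "fourier_L1 v \<xi> = of_real (1 / (2 * pi) ^ DIM('a)) * (\<integral>x. exp (\<i> * of_real (\<xi> \<bullet> x)) * v x \<partial>lborel)"
  unfolding fourier_L1_def by (subst integral_completion) auto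

lemma integrable_exp_mult:
  fixes v :: "'a::euclidean_space \<Rightarrow> complex"
  assumes v: "integrable lborel v"
  shows "integrable lborel (\<lambda>x. exp (\<i> * of_real (\<xi> \<bullet> x)) * v x)"
proof -
  note [measurable] = borel_measurable_integrable[OF v]
  show ?thesis
    by (rule Bochner_Integration.integrable_bound[OF v]) (auto simp: norm_mult norm_exp_i_times)
qed

lemma fourier_L1_measurable:
  fixes v :: "'a::euclidean_space \<Rightarrow> complex"
  assumes v: "integrable lborel v"
  shows "fourier_L1 v \<in> borel_measurable borel"
proof -
  note [measurable] = borel_measurable_integrable[OF v]
  have "(\<lambda>\<xi>. \<integral>x. exp (\<i> * of_real (\<xi> \<bullet> x)) * v x \<partial>lborel) \<in> borel_measurable borel"
    by measurable
  then have "(\<lambda>\<xi>. of_real (1 / (2 * pi) ^ DIM('a)) * (\<integral>x. exp (\<i> * of_real (\<xi> \<bullet> x)) * v x \<partial>lborel)) \<in> borel_measurable borel"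
    by measurable
  then show ?thesis
    using fourier_L1_lborel[of v] borel_measurable_integrable[OF v] by (simp cong: measurable_cong)
qed

lemma norm_fourier_L1_le:
  fixes v :: "'a::euclidean_space \<Rightarrow> complex"
  assumes v: "integrable lborel v"
  shows "cmod (fourier_L1 v \<xi>) \<le> (1 / (2 * pi) ^ DIM('a)) * (\<integral>x. cmod (v x) \<partial>lborel)"
proof -
  have "v \<in> borel_measurable borel" using borel_measurable_integrable[OF v] by simp
  moreover have "cmod (\<integral>x. exp (\<i> * of_real (\<xi> \<bullet> x)) * v x \<partial>lborel) \<le> (\<integral>x. cmod (exp (\<i> * of_real (\<xi> \<bullet> x)) * v x) \<partial>lborel)"
    by (rule integral_norm_bound)
  ultimately show ?thesis
    by (simp add: fourier_L1_lborel norm_mult norm_exp_i_times norm_divide norm_power divide_right_mono)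
qed

lemma lborel_integral_affine:
  fixes f :: "'a::euclidean_space \<Rightarrow> 'b::{banach, second_countable_topology}"
  assumes [measurable]: "f \<in> borel_measurable borel" and c: "c \<noteq> 0"
  shows "(\<integral>x. f x \<partial>lborel) = \<bar>c\<bar> ^ DIM('a) *\<^sub>R (\<integral>x. f (t + c *\<^sub>R x) \<partial>lborel)"
  using c by (subst lborel_affine[OF c, of t]) (simp add: integral_density integral_distr)

lemma lborel_integrable_affine:
  fixes f :: "'a::euclidean_space \<Rightarrow> 'b::{banach, second_countable_topology}"
  assumes f: "integrable lborel f" and c: "c \<noteq> 0"
  shows "integrable lborel (\<lambda>x. f (t + c *\<^sub>R x))"
proof -
  note [measurable] = borel_measurable_integrable[OF f]
  have "integrable (density (distr lborel borel (\<lambda>x. t + c *\<^sub>R x)) (\<lambda>_. ennreal (\<bar>c\<bar> ^ DIM('a)))) f"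
    using f lborel_affine[OF c, of t] by simp
  then have "integrable lborel (\<lambda>x. \<bar>c\<bar> ^ DIM('a) *\<^sub>R f (t + c *\<^sub>R x))"
    by (simp add: integrable_density integrable_distr_eq)
  then have "integrable lborel (\<lambda>x. (1 / \<bar>c\<bar> ^ DIM('a)) *\<^sub>R \<bar>c\<bar> ^ DIM('a) *\<^sub>R f (t + c *\<^sub>R x))"
    by (rule integrable_scaleR_right)
  then show ?thesis using c by simp
qed

lemma lborel_integral_translation:
  fixes f :: "'a::euclidean_space \<Rightarrow> 'b::{banach, second_countable_topology}"
  assumes "f \<in> borel_measurable borel"
  shows "(\<integral>x. f (t + x) \<partial>lborel) = (\<integral>x. f x \<partial>lborel)"
  using lborel_integral_affine[OF assms, of 1 t] by simp

lemma lborel_integrable_translation: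
  fixes f :: "'a::euclidean_space \<Rightarrow> 'b::{banach, second_countable_topology}"
  assumes "integrable lborel f"
  shows "integrable lborel (\<lambda>x. f (t + x))"
  using lborel_integrable_affine[OF assms, of 1 t] by simp

text \<open>The predicate need not be measurable: it is first weakened to the complement of a Borel null set.\<close>

lemma AE_lborel_scaleR:
  fixes P :: "'a::euclidean_space \<Rightarrow> bool"
  assumes c: "c \<noteq> 0" and P: "AE x in lborel. P x"
  shows "AE x in lborel. P (c *\<^sub>R x)"
proof -
  obtain Z where Z: "Z \<in> null_sets lborel" "{x. \<not> P x} \<subseteq> Z"
    using P by (auto simp: eventually_ae_filter)
  have [measurable]: "Z \<in> sets borel" using Z(1) by auto
  have "AE x in lborel. x \<notin> Z" using Z(1) by (rule AE_not_in)
  then have "AE x in lborel. c *\<^sub>R x \<notin> Z"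
    using c by (subst lborel_affine[of "1/c" "0::'a"]) (simp_all add: AE_density AE_distr_iff)
  then show ?thesis by eventually_elim (use Z(2) in auto)
qed

section \<open>Chebyshev polynomials outside the unit interval\<close>

lemma cheb_eqI:
  assumes "\<And>t. t \<in> {-1..1} \<Longrightarrow> poly p t = cos (real k * arccos t)"
  shows "cheb k = p"
  using ex1_cheb[of k] poly_cheb[of _ k] assms by blast

lemma cheb_0: "cheb 0 = 1"
  by (rule cheb_eqI) simp

lemma cheb_1: "cheb (Suc 0) = [:0, 1:]"
  by (rule cheb_eqI) simp

lemma cheb_rec: "cheb (Suc (Suc k)) = [:0, 2:] * cheb (Suc k) - cheb k"
proof (rule cheb_eqI)
  fix t :: real assume t: "t \<in> {-1..1}"
  define a where "a = arccos t"
  have a: "cos a = t" using t by (simp add: a_def)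
  have "cos (real (Suc k) * a + a) + cos (real (Suc k) * a - a) = 2 * cos (real (Suc k) * a) * cos a"
    by (simp add: cos_add cos_diff del: of_nat_Suc)
  moreover have "real (Suc k) * a + a = real (Suc (Suc k)) * a" "real (Suc k) * a - a = real k * a"
    by (simp_all add: algebra_simps)
  ultimately show "poly ([:0, 2:] * cheb (Suc k) - cheb k) t = cos (real (Suc (Suc k)) * arccos t)"
    using t by (simp add: poly_cheb a a_def[symmetric] mult_ac del: of_nat_Suc)
qed

text \<open>This is \<open>T\<^sub>k(cos \<phi>) = cos (k * \<phi>)\<close> with \<open>z\<close> in place of \<open>exp (\<i> * \<phi>)\<close>.  It describes the polynomial outside
  \<open>[-1, 1]\<close>, where its defining formula says nothing.\<close>

lemma poly_cheb_joukowski: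
  fixes z :: real
  assumes "z \<noteq> 0"
  shows "2 * poly (cheb k) ((z + 1/z) / 2) = z ^ k + (1/z) ^ k"
proof (induction k rule: induct_nat_012)
  case 0 show ?case by (simp add: cheb_0)
next
  case 1 show ?case by (simp add: cheb_1)
next
  case (ge2 n)
  have "2 * poly (cheb (Suc (Suc n))) ((z + 1/z) / 2)
      = (z + 1/z) * (2 * poly (cheb (Suc n)) ((z + 1/z) / 2)) - 2 * poly (cheb n) ((z + 1/z) / 2)"
    by (simp add: cheb_rec algebra_simps)
  also have "\<dots> = (z + 1/z) * (z ^ Suc n + (1/z) ^ Suc n) - (z ^ n + (1/z) ^ n)"
    by (simp only: ge2)
  also have "\<dots> = z ^ Suc (Suc n) + (1/z) ^ Suc (Suc n)"
    using assms by (simp add: field_simps)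
  finally show ?case .
qed

lemma joukowski_real:
  fixes t :: real
  assumes "t \<ge> 1"
  obtains z where "z \<ge> 1" "t = (z + 1/z) / 2" "z \<le> 2 * t"
proof
  have s: "0 \<le> t\<^sup>2 - 1" using assms by (simp add: one_le_power)
  define z where "z = t + sqrt (t\<^sup>2 - 1)"
  have z: "z \<ge> 1" using assms real_sqrt_ge_zero[OF s] unfolding z_def by linarith
  have "z * (t - sqrt (t\<^sup>2 - 1)) = 1"
    using s by (simp add: z_def algebra_simps power2_eq_square[symmetric])
  then have i: "1 / z = t - sqrt (t\<^sup>2 - 1)" using z by (simp add: field_simps)
  show "z \<ge> 1" by fact
  show "t = (z + 1/z) / 2" unfolding i by (simp add: z_def)
  show "z \<le> 2 * t" using i z by (simp add: z_def) (smt (verit) divide_nonneg_nonneg)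
qed

text \<open>All terms of the binomial expansion of the right-hand side are nonnegative.\<close>

lemma power_add_inverse_power_le:
  fixes z :: real
  assumes "z > 0" "k \<ge> 1"
  shows "z ^ k + (1/z) ^ k \<le> (z + 1/z) ^ k"
  using assms(2)
proof (induction k rule: nat_induct_at_least)
  case base show ?case by simp
next
  case (Suc n)
  have "z ^ Suc n + (1/z) ^ Suc n \<le> (z + 1/z) * (z ^ n + (1/z) ^ n)"
    using assms(1) by (simp add: algebra_simps)
  also have "\<dots> \<le> (z + 1/z) * (z + 1/z) ^ n"
    using assms(1) Suc by (intro mult_left_mono) auto
  finally show ?case by simp
qed

lemma abs_poly_cheb_le_1: "t \<in> {-1..1} \<Longrightarrow> \<bar>poly (cheb k) t\<bar> \<le> 1"
  by (simp add: poly_cheb)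

text \<open>Chebyshev coefficients of order \<open>k \<ge> 1\<close> carry a factor \<open>2\<close>, which is absorbed here; outside \<open>[-1, 1]\<close> this
  bound governs the amplification of errors in the coefficients.\<close>

lemma poly_cheb_bounds:
  assumes "t \<ge> 1" "k \<ge> 1"
  shows "0 \<le> poly (cheb k) t" "2 * poly (cheb k) t \<le> (2 * t) ^ k"
proof -
  obtain z where z: "z \<ge> 1" "t = (z + 1/z) / 2" using joukowski_real[OF assms(1)] by metis
  have e: "2 * poly (cheb k) t = z ^ k + (1/z) ^ k"
    using poly_cheb_joukowski[of z k] z(1) unfolding z(2)[symmetric] by simp
  have "0 \<le> z ^ k + (1/z) ^ k" using z by simp
  then show "0 \<le> poly (cheb k) t" using e by linarith
  show "2 * poly (cheb k) t \<le> (2 * t) ^ k"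
  proof -
    have "2 * t = z + 1/z" using z(2) by simp
    then show ?thesis using power_add_inverse_power_le[of z k] z(1) assms e by simp
  qed
qed

section \<open>Chebyshev expansions of entire functions\<close>

text \<open>Cauchy's formula on an ellipse, pulled back by the Joukowski map \<open>u(\<zeta>) = (\<zeta> + 1/\<zeta>) / 2\<close>.  With
  \<open>t = u(z) = u(1/z)\<close> the kernel is \<open>u'(\<zeta>) / (u(\<zeta>) - t)\<close> decomposed into partial fractions.  The quotient
  \<open>(g \<zeta> - g t) / (\<zeta> - t)\<close> is entire and has a primitive, and pulled back it integrates to zero over a
  closed path; the constant \<open>g t\<close> contributes the three winding numbers \<open>1 + 1 - 1\<close>.\<close>

lemma joukowski_cauchy_formula:
  assumes g: "g holomorphic_on UNIV" and z: "z \<noteq> 0" "cmod z < \<rho>" "cmod (1/z) < \<rho>"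
  shows "((\<lambda>\<zeta>. g ((\<zeta> + 1/\<zeta>) / 2) * (1 / (\<zeta> - z) + 1 / (\<zeta> - 1/z) - 1 / \<zeta>))
           has_contour_integral 2 * pi * \<i> * g ((z + 1/z) / 2)) (circlepath 0 \<rho>)"
proof -
  define t where "t = (z + 1/z) / 2"
  define u where "u = (\<lambda>\<zeta>::complex. (\<zeta> + 1/\<zeta>) / 2)"
  define b where "b = (\<lambda>\<zeta>::complex. 1 / (\<zeta> - z) + 1 / (\<zeta> - 1/z) - 1 / \<zeta>)"
  define k where "k = (\<lambda>\<zeta>. if \<zeta> = t then deriv g t else (g \<zeta> - g t) / (\<zeta> - t))"
  have \<rho>: "\<rho> > 0" using z(2) norm_ge_zero[of z] by linarith
  have "k holomorphic_on UNIV"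
    unfolding k_def by (rule pole_lemma_open[OF g]) simp
  then obtain K where K: "\<And>x. (K has_field_derivative k x) (at x)"
    using holomorphic_convex_primitive'[of UNIV k] by auto
  have "((\<lambda>x. K (u x)) has_field_derivative k (u x) * ((1 - 1/x^2) / 2)) (at x within - {0})" if "x \<in> - {0}" for x
  proof -
    have "(u has_field_derivative (1 - 1/x^2) / 2) (at x within -{0})"
      unfolding u_def using that
      by (auto intro!: derivative_eq_intros simp: power2_eq_square field_simps)
    then show ?thesis using DERIV_chain2[OF K] by blast
  qed
  then have "((\<lambda>x. k (u x) * ((1 - 1/x^2) / 2)) has_contour_integral
      (K (u (pathfinish (circlepath 0 \<rho>))) - K (u (pathstart (circlepath 0 \<rho>))))) (circlepath 0 \<rho>)"
    using contour_integral_primitive[of "-{0}" "\<lambda>x. K (u x)" "\<lambda>x. k (u x) * ((1 - 1/x^2) / 2)" "circlepath 0 \<rho>"] \<rho>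
    by auto
  then have 1: "((\<lambda>x. k (u x) * ((1 - 1/x^2) / 2)) has_contour_integral 0) (circlepath 0 \<rho>)" by simp
  have circ: "((\<lambda>x. 1 / (x - a)) has_contour_integral 2 * pi * \<i>) (circlepath 0 \<rho>)" if "cmod a < \<rho>" for a
    using Cauchy_integral_circlepath_simple[of "\<lambda>_. 1" 0 \<rho> a] that by (simp add: mult_ac)
  have "((\<lambda>x. g t * b x) has_contour_integral g t * (2*pi*\<i> + 2*pi*\<i> - 2*pi*\<i>)) (circlepath 0 \<rho>)"
    unfolding b_def using circ[OF z(2)] circ[OF z(3)] circ[of 0] \<rho>
    by (intro has_contour_integral_lmul has_contour_integral_add has_contour_integral_diff) auto
  from has_contour_integral_add[OF 1 this]
  have "((\<lambda>x. k (u x) * ((1 - 1/x^2) / 2) + g t * b x) has_contour_integral 2*pi*\<i> * g t) (circlepath 0 \<rho>)"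
    by (simp add: algebra_simps)
  then have "((\<lambda>x. g (u x) * b x) has_contour_integral 2*pi*\<i> * g t) (circlepath 0 \<rho>)"
  proof (rule has_contour_integral_eq)
    fix x assume "x \<in> path_image (circlepath 0 \<rho>)"
    then have x: "cmod x = \<rho>" using \<rho> by auto
    then have nz: "x \<noteq> 0" "x - z \<noteq> 0" "x - 1/z \<noteq> 0" using z \<rho> by auto
    have zx: "z * x \<noteq> 1" using nz(3) z(1) by (auto simp: field_simps)
    have ut: "u x - t = (x - z) * (x - 1/z) / (2 * x)"
      unfolding u_def t_def using nz z(1) by (simp add: field_simps)
    \<comment> \<open>The derivative of the Joukowski map, so that the kernel is its logarithmic derivative at the value \<open>t\<close>.\<close>
    have "(1 - 1/x^2) / 2 = (u x - t) * b x"
      unfolding ut b_def using nz z(1) zx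
      by (simp add: divide_simps power2_eq_square) (simp add: algebra_simps)
    moreover have "u x \<noteq> t" using ut nz by auto
    ultimately have "k (u x) * ((1 - 1/x^2) / 2) = (g (u x) - g t) * b x"
      by (simp add: k_def)
    then show "k (u x) * ((1 - 1/x^2) / 2) + g t * b x = g (u x) * b x"
      by (simp add: algebra_simps)
  qed
  then show ?thesis unfolding u_def b_def t_def .
qed

text \<open>The coefficient of \<open>\<zeta> ^ k\<close> in the Laurent expansion of \<open>g\<close> composed with the Joukowski map.  It is the
  Chebyshev coefficient of \<open>g\<close> on \<open>[-1, 1]\<close> for \<open>k = 0\<close>, and half of it for \<open>k \<ge> 1\<close>.\<close>

definition cheb_contour_coeff :: "(complex \<Rightarrow> complex) \<Rightarrow> nat \<Rightarrow> complex" where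
  "cheb_contour_coeff g k =
     contour_integral (circlepath 0 1) (\<lambda>\<zeta>. g ((\<zeta> + 1/\<zeta>) / 2) / \<zeta> ^ Suc k) / (2 * pi * \<i>)"

text \<open>The integrand is holomorphic on the punctured plane, in which concentric circles are homotopic.  Large circles
  give the decay of the remainder, the unit circle gives the link with integrals over \<open>[-1, 1]\<close>.\<close>

lemma cheb_contour_coeff_circle:
  assumes g: "g holomorphic_on UNIV" and \<rho>: "\<rho> > 0"
  shows "((\<lambda>\<zeta>. g ((\<zeta> + 1/\<zeta>) / 2) / \<zeta> ^ Suc k) has_contour_integral
           2 * pi * \<i> * cheb_contour_coeff g k) (circlepath 0 \<rho>)"
proof -
  let ?h = "\<lambda>\<zeta>. g ((\<zeta> + 1/\<zeta>) / 2) / \<zeta> ^ Suc k"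
  have "(g \<circ> (\<lambda>\<zeta>. (\<zeta> + 1/\<zeta>) / 2)) holomorphic_on -{0}"
    by (rule holomorphic_on_compose_gen[OF _ g]) (auto intro!: holomorphic_intros)
  then have h: "?h holomorphic_on -{0}"
    by (auto intro!: holomorphic_intros simp: o_def)
  have hom: "homotopic_loops (-{0}) (circlepath 0 \<rho>) (circlepath 0 1)"
  proof (rule homotopic_loops_linear)
    fix t :: real assume "t \<in> {0..1}"
    show "closed_segment (circlepath 0 \<rho> t) (circlepath 0 1 t) \<subseteq> -{0}"
    proof
      fix x assume "x \<in> closed_segment (circlepath 0 \<rho> t) (circlepath 0 1 t)"
      then obtain a where a: "0 \<le> a" "a \<le> 1"
        "x = (1 - a) *\<^sub>R circlepath 0 \<rho> t + a *\<^sub>R circlepath 0 1 t"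
        unfolding closed_segment_def by auto
      then have "x = of_real ((1 - a) * \<rho> + a) * exp (2 * of_real pi * \<i> * of_real t)"
        by (simp add: circlepath scaleR_conv_of_real algebra_simps)
      moreover have "(1 - a) * \<rho> + a > 0"
        using \<rho> a by (cases "a = 1") (auto intro!: add_pos_nonneg mult_pos_pos)
      ultimately show "x \<in> -{0}" by (metis ComplI exp_not_eq_zero mult_eq_0_iff of_real_eq_0_iff order_less_irrefl singletonD)
    qed
  qed auto
  have "contour_integral (circlepath 0 \<rho>) ?h = contour_integral (circlepath 0 1) ?h"
    by (rule Cauchy_theorem_homotopic_loops[OF hom _ h]) auto
  moreover have "?h contour_integrable_on circlepath 0 \<rho>"
    using h \<rho> by (intro contour_integrable_holomorphic_simple[of _ "-{0}"]) auto
  ultimately show ?thesis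
    using has_contour_integral_integral by (fastforce simp: cheb_contour_coeff_def)
qed

lemma inverse_diff_geometric:
  fixes x z :: complex
  assumes "x \<noteq> 0" "x \<noteq> z"
  shows "1 / (x - z) = (\<Sum>k<n. z ^ k / x ^ Suc k) + (z / x) ^ n / (x - z)"
proof (induction n)
  case (Suc n)
  have "(z / x) ^ n / (x - z) = z ^ n / x ^ Suc n + (z / x) ^ Suc n / (x - z)"
  proof -
    have "x - z \<noteq> 0" using assms by simp
    then have "1 / (x - z) = 1 / x + (z / x) / (x - z)"
      using assms(1) by (simp add: field_simps)
    then have "(z / x) ^ n * (1 / (x - z)) = (z / x) ^ n * (1 / x + (z / x) / (x - z))" by simp
    then show ?thesis by (simp add: algebra_simps power_divide)
  qed
  with Suc show ?case by simp
qed simp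

text \<open>In the pulled-back Cauchy formula on the circle of radius \<open>\<rho>\<close> the two poles \<open>z\<close> and \<open>1/z\<close> over \<open>t\<close> lie inside.
  Expanding both fractions into geometric series produces \<open>z ^ k + (1/z) ^ k = 2 * T\<^sub>k(t)\<close>, and the tails of
  the two series form the remainder.  The assumption \<open>\<rho> \<ge> 4 * t\<close> keeps the poles at distance at least \<open>\<rho> / 2\<close>
  from the circle.\<close>

lemma cheb_expansion_remainder:
  assumes g: "g holomorphic_on UNIV"
    and M: "\<And>\<zeta>. cmod \<zeta> = \<rho> \<Longrightarrow> cmod (g ((\<zeta> + 1/\<zeta>) / 2)) \<le> M"
    and t: "t \<ge> 1" and \<rho>: "\<rho> \<ge> 4 * t" and n: "n \<ge> 1"
  shows "cmod (g (of_real t) - (\<Sum>k<n. (if k = 0 then 1 else 2) * cheb_contour_coeff g k * of_real (poly (cheb k) t)))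
           \<le> 2 * M * (2 * t / \<rho>) ^ n"
proof -
  obtain z where z: "z \<ge> 1" "t = (z + 1/z) / 2" "z \<le> 2 * t" using joukowski_real[OF t] by metis
  define Z where "Z = complex_of_real z"
  have \<rho>0: "\<rho> > 0" using t \<rho> by linarith
  have inv: "1/z \<le> 1" using z by simp
  have nZ: "cmod Z = z" "cmod (1/Z) = 1/z" using z by (auto simp: Z_def norm_divide)
  have lt: "cmod Z < \<rho>" "cmod (1/Z) < \<rho>" unfolding nZ using z(3) \<rho> t inv by linarith+
  have gt: "g ((Z + 1/Z) / 2) = g (of_real t)" by (simp add: Z_def z(2))
  have Z0: "Z \<noteq> 0" using z by (simp add: Z_def)
  define G where "G = (\<lambda>\<zeta>. g ((\<zeta> + 1/\<zeta>) / 2))"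
  define e where "e = (\<lambda>k::nat. if k = 0 then 1 else 2 :: complex)"
  have T: "of_real (poly (cheb k) t) = (Z ^ k + (1/Z) ^ k) / 2" for k
    using arg_cong[OF poly_cheb_joukowski[of z k], of complex_of_real] z(1) unfolding z(2)[symmetric] by (simp add: Z_def mult.commute)
  have S: "((\<lambda>\<zeta>. \<Sum>k<n. e k * of_real (poly (cheb k) t) * (G \<zeta> / \<zeta> ^ Suc k)) has_contour_integral
           (\<Sum>k<n. e k * of_real (poly (cheb k) t) * (2 * pi * \<i> * cheb_contour_coeff g k))) (circlepath 0 \<rho>)"
    unfolding G_def by (intro has_contour_integral_sum has_contour_integral_lmul cheb_contour_coeff_circle g \<rho>0) auto
  have "((\<lambda>\<zeta>. G \<zeta> * (1 / (\<zeta> - Z) + 1 / (\<zeta> - 1/Z) - 1 / \<zeta>) - (\<Sum>k<n. e k * of_real (poly (cheb k) t) * (G \<zeta> / \<zeta> ^ Suc k)))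
     has_contour_integral (2 * pi * \<i> * g (of_real t) - (\<Sum>k<n. e k * of_real (poly (cheb k) t) * (2 * pi * \<i> * cheb_contour_coeff g k)))) (circlepath 0 \<rho>)"
    using has_contour_integral_diff[OF joukowski_cauchy_formula[OF g Z0 lt] S] unfolding gt G_def .
  then have R: "((\<lambda>\<zeta>. G \<zeta> * ((Z/\<zeta>) ^ n / (\<zeta> - Z) + ((1/Z)/\<zeta>) ^ n / (\<zeta> - 1/Z)))
     has_contour_integral (2 * pi * \<i> * g (of_real t) - (\<Sum>k<n. e k * of_real (poly (cheb k) t) * (2 * pi * \<i> * cheb_contour_coeff g k)))) (circlepath 0 \<rho>)"
  proof (rule has_contour_integral_eq)
    fix x assume "x \<in> path_image (circlepath 0 \<rho>)"
    then have x: "cmod x = \<rho>" using \<rho>0 by auto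
    then have nz: "x \<noteq> 0" "x \<noteq> Z" "x \<noteq> 1/Z" using lt \<rho>0 by auto
    have "(\<Sum>k<n. e k * of_real (poly (cheb k) t) * (G x / x ^ Suc k))
        = G x * (\<Sum>k<n. e k * ((Z ^ k + (1/Z) ^ k) / 2) / x ^ Suc k)"
      unfolding T sum_distrib_left by (intro sum.cong) (auto simp: field_simps)
    also have "(\<Sum>k<n. e k * ((Z ^ k + (1/Z) ^ k) / 2) / x ^ Suc k)
       = (\<Sum>k<n. Z ^ k / x ^ Suc k + (1/Z) ^ k / x ^ Suc k - (if k = 0 then 1 / x else 0))"
      by (intro sum.cong) (auto simp: e_def add_divide_distrib)
    also have "\<dots> = (\<Sum>k<n. Z ^ k / x ^ Suc k) + (\<Sum>k<n. (1/Z) ^ k / x ^ Suc k) - 1/x"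
      using n by (simp add: sum.distrib sum_subtractf sum.delta)
    finally show "G x * (1 / (x - Z) + 1 / (x - 1/Z) - 1 / x) - (\<Sum>k<n. e k * of_real (poly (cheb k) t) * (G x / x ^ Suc k)) = G x * ((Z/x) ^ n / (x - Z) + ((1/Z)/x) ^ n / (x - 1/Z))"
      using inverse_diff_geometric[OF nz(1,2), of n] inverse_diff_geometric[OF nz(1,3), of n]
      by (simp add: algebra_simps)
  qed
  have M0: "M \<ge> 0" using M[of "of_real \<rho>"] \<rho>0 by (smt (verit) norm_ge_zero norm_of_real)
  define B where "B = M * (2 * (2 * t / \<rho>) ^ n / \<rho>)"
  have "cmod (2 * pi * \<i> * g (of_real t) - (\<Sum>k<n. e k * of_real (poly (cheb k) t) * (2 * pi * \<i> * cheb_contour_coeff g k)))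
     \<le> B * (2 * pi * \<rho>)"
  proof (rule has_contour_integral_bound_circlepath[OF R])
    show "0 \<le> B" using M0 \<rho>0 t by (simp add: B_def)
    fix x assume x: "cmod (x - 0) = \<rho>"
    have one: "cmod ((a/x) ^ n / (x - a)) \<le> (cmod a) ^ n / \<rho> ^ n * (2 / \<rho>)" if a: "cmod a \<le> 2 * t" for a
    proof -
      have "\<rho> / 2 \<le> cmod (x - a)" using norm_triangle_ineq2[of x a] x a \<rho> t by simp
      moreover from this have "cmod (x - a) > 0" using \<rho>0 by linarith
      ultimately have "1 / cmod (x - a) \<le> 1 / (\<rho> / 2)" using \<rho>0 by (intro divide_left_mono mult_pos_pos) auto
      then have i: "1 / cmod (x - a) \<le> 2 / \<rho>" by simp
      have "cmod ((a/x) ^ n / (x - a)) = (cmod a) ^ n / \<rho> ^ n * (1 / cmod (x - a))"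
        using x by (simp only: norm_divide norm_power power_divide diff_zero) simp
      also have "\<dots> \<le> (cmod a) ^ n / \<rho> ^ n * (2 / \<rho>)"
        using \<rho>0 by (intro mult_left_mono i) auto
      finally show ?thesis .
    qed
    have zt: "z + 1/z = 2 * t" using z(2) by simp
    have "cmod ((Z/x) ^ n / (x - Z) + ((1/Z)/x) ^ n / (x - 1/Z))
       \<le> (cmod Z) ^ n / \<rho> ^ n * (2 / \<rho>) + (cmod (1/Z)) ^ n / \<rho> ^ n * (2 / \<rho>)"
      using inv z t by (intro order.trans[OF norm_triangle_ineq] add_mono one) (auto simp: nZ)
    also have "\<dots> = (z ^ n + (1/z) ^ n) / \<rho> ^ n * (2 / \<rho>)"
      unfolding nZ by (simp add: add_divide_distrib distrib_right)
    also have "(z ^ n + (1/z) ^ n) / \<rho> ^ n * (2 / \<rho>) \<le> (2 * t) ^ n / \<rho> ^ n * (2 / \<rho>)"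
      using power_add_inverse_power_le[of z n] z(1) zt n \<rho>0 by (intro mult_right_mono divide_right_mono) auto
    finally have "cmod ((Z/x) ^ n / (x - Z) + ((1/Z)/x) ^ n / (x - 1/Z)) \<le> 2 * (2 * t / \<rho>) ^ n / \<rho>"
      by (simp add: power_divide mult_ac)
    then show "cmod (G x * ((Z/x) ^ n / (x - Z) + ((1/Z)/x) ^ n / (x - 1/Z))) \<le> B"
      unfolding B_def norm_mult G_def using M[of x] x M0 by (intro mult_mono) auto
  qed (use \<rho>0 in auto)
  also have "2 * pi * \<i> * g (of_real t) - (\<Sum>k<n. e k * of_real (poly (cheb k) t) * (2 * pi * \<i> * cheb_contour_coeff g k))
     = 2 * pi * \<i> * (g (of_real t) - (\<Sum>k<n. e k * cheb_contour_coeff g k * of_real (poly (cheb k) t)))"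
    by (simp add: algebra_simps sum_distrib_left)
  also have "cmod \<dots> = 2 * pi * cmod (g (of_real t) - (\<Sum>k<n. e k * cheb_contour_coeff g k * of_real (poly (cheb k) t)))"
    by (simp add: norm_mult)
  also have "B * (2 * pi * \<rho>) = 2 * pi * (2 * M * (2 * t / \<rho>) ^ n)"
    using \<rho>0 by (simp add: B_def)
  finally show ?thesis by (simp add: e_def)
qed

text \<open>The substitution is made with \<open>arccos\<close> rather than \<open>cos\<close> because then the transformed function is continuous
  on a closed interval and the singular weight appears as a derivative, which may fail to exist at the end points.\<close>

lemma has_integral_arccos_substitution:
  fixes H :: "real \<Rightarrow> complex"
  assumes r: "r > 0" and H: "continuous_on {0..pi} H"
  shows "((\<lambda>t. H (arccos (t / r)) / of_real (sqrt (r\<^sup>2 - t\<^sup>2))) has_integral integral {0..pi} H) {-r..r}"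
proof -
  have "((\<lambda>t. (- 1 / sqrt (r\<^sup>2 - t\<^sup>2)) *\<^sub>R H (arccos (t / r))) has_integral
     (integral {arccos (-r/r)..arccos (r/r)} H - integral {arccos (r/r)..arccos (-r/r)} H)) {-r..r}"
  proof (rule has_integral_substitution_general[where s="{-r,r}" and c=0 and d=pi])
    show "(\<lambda>t. arccos (t / r)) ` {-r..r} \<subseteq> {0..pi}"
      using r by (auto intro!: arccos_lbound arccos_ubound simp: field_simps)
    show "continuous_on {-r..r} (\<lambda>t. arccos (t / r))"
      using r by (intro continuous_intros) (auto simp: field_simps)
    fix t assume "t \<in> {-r..r} - {-r,r}"
    then have t: "-1 < t/r" "t/r < 1" "t < r" "-r < t" using r by (auto simp: field_simps)
    have "((\<lambda>t. arccos (t / r)) has_real_derivative inverse (- sqrt (1 - (t/r)\<^sup>2)) * (1 / r)) (at t)"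
      using r t by (auto intro!: derivative_eq_intros simp: field_simps)
    moreover have "sqrt (r\<^sup>2 - t\<^sup>2) = r * sqrt (1 - (t/r)\<^sup>2)"
    proof -
      have "r\<^sup>2 - t\<^sup>2 = r\<^sup>2 * (1 - (t/r)\<^sup>2)" using r by (simp add: field_simps)
      then show ?thesis using r by (simp add: real_sqrt_mult)
    qed
    ultimately have "((\<lambda>t. arccos (t / r)) has_real_derivative - 1 / sqrt (r\<^sup>2 - t\<^sup>2)) (at t)"
      by (simp add: divide_inverse mult.commute)
    then show "((\<lambda>t. arccos (t / r)) has_real_derivative - 1 / sqrt (r\<^sup>2 - t\<^sup>2)) (at t within {-r..r})"
      by (rule has_field_derivative_at_within)
  qed (use r H in auto)
  then have "((\<lambda>t. - ((- 1 / sqrt (r\<^sup>2 - t\<^sup>2)) *\<^sub>R H (arccos (t / r)))) has_integral - (- integral {0..pi} H)) {-r..r}"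
    using r by (intro has_integral_neg) simp
  then show ?thesis by (simp add: scaleR_conv_of_real)
qed

lemma cheb_weight:
  assumes r: "r > 0"
  shows "set_integrable lborel {-r<..<r} (\<lambda>t. 1 / sqrt (r\<^sup>2 - t\<^sup>2))"
    and "(LINT t:{-r<..<r}|lborel. 1 / sqrt (r\<^sup>2 - t\<^sup>2)) = pi"
proof -
  have "((\<lambda>t. 1 / complex_of_real (sqrt (r\<^sup>2 - t\<^sup>2))) has_integral integral {0..pi} (\<lambda>_. 1)) {-r..r}"
    using has_integral_arccos_substitution[OF r, of "\<lambda>_. 1"] by simp
  then have "((\<lambda>t. Re (1 / complex_of_real (sqrt (r\<^sup>2 - t\<^sup>2)))) has_integral Re (integral {0..pi} (\<lambda>_. 1))) {-r..r}"
    by (rule has_integral_Re)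
  moreover have "Re (1 / complex_of_real x) = 1 / x" for x
    by (metis Re_complex_of_real of_real_1 of_real_divide)
  ultimately have "((\<lambda>t. 1 / sqrt (r\<^sup>2 - t\<^sup>2)) has_integral pi) {-r..r}"
    by simp
  then have hi: "((\<lambda>t. 1 / sqrt (r\<^sup>2 - t\<^sup>2)) has_integral pi) {-r<..<r}"
    using has_integral_Icc_iff_Ioo by blast
  have nn: "0 \<le> 1 / sqrt (r\<^sup>2 - t\<^sup>2)" if "t \<in> {-r<..<r}" for t
    using that r abs_le_square_iff[of t r] by auto
  have m: "(\<lambda>t. indicator {-r<..<r} t *\<^sub>R (1 / sqrt (r\<^sup>2 - t\<^sup>2))) \<in> borel_measurable borel"
    by measurable
  have ai: "(\<lambda>t. 1 / sqrt (r\<^sup>2 - t\<^sup>2)) absolutely_integrable_on {-r<..<r}"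
    using nonnegative_absolutely_integrable_1[of "\<lambda>t. 1 / sqrt (r\<^sup>2 - t\<^sup>2)" "{-r<..<r}"] hi nn by (auto simp: has_integral_integrable)
  then show "set_integrable lborel {-r<..<r} (\<lambda>t. 1 / sqrt (r\<^sup>2 - t\<^sup>2))"
    unfolding set_integrable_def using m by (subst (asm) integrable_completion) auto
  have "(LINT t:{-r<..<r}|lebesgue. 1 / sqrt (r\<^sup>2 - t\<^sup>2)) = pi"
    using set_lebesgue_integral_eq_integral(2)[OF ai] hi by (simp add: integral_unique)
  then show "(LINT t:{-r<..<r}|lborel. 1 / sqrt (r\<^sup>2 - t\<^sup>2)) = pi"
    unfolding set_lebesgue_integral_def using m by (subst (asm) integral_completion) auto
qed

lemma cheb_weighted_integrable:
  fixes f :: "real \<Rightarrow> complex"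
  assumes r: "r > 0" and f: "f \<in> borel_measurable borel"
    and B: "AE t in lborel. t \<in> {-r<..<r} \<longrightarrow> cmod (f t) \<le> B"
  shows "set_integrable lborel {-r<..<r} (\<lambda>t. f t * of_real (poly (cheb k) (t / r)) / of_real (sqrt (r\<^sup>2 - t\<^sup>2)))"
    and "cmod (LINT t:{-r<..<r}|lborel. f t * of_real (poly (cheb k) (t / r)) / of_real (sqrt (r\<^sup>2 - t\<^sup>2))) \<le> B * pi"
proof -
  let ?g = "\<lambda>t. f t * of_real (poly (cheb k) (t / r)) / of_real (sqrt (r\<^sup>2 - t\<^sup>2))"
  let ?w = "\<lambda>t. B * (indicator {-r<..<r} t *\<^sub>R (1 / sqrt (r\<^sup>2 - t\<^sup>2)))"
  have [measurable]: "poly (cheb k) \<in> borel_measurable borel"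
    by (intro borel_measurable_continuous_onI continuous_intros)
  note [measurable] = f
  have wi: "integrable lborel ?w"
    using cheb_weight(1)[OF r] unfolding set_integrable_def by (rule integrable_mult_right)
  have b: "AE t in lborel. norm (indicator {-r<..<r} t *\<^sub>R ?g t) \<le> ?w t"
    using B
  proof eventually_elim
    case (elim t)
    show ?case
    proof (cases "t \<in> {-r<..<r}")
      case True
      then have "t / r \<in> {-1..1}" using r by (auto simp: field_simps)
      then have "\<bar>poly (cheb k) (t/r)\<bar> \<le> 1" by (rule abs_poly_cheb_le_1)
      then have "cmod (f t) * \<bar>poly (cheb k) (t/r)\<bar> \<le> B * 1"
        using elim True by (intro mult_mono) (auto intro: order.trans[OF norm_ge_zero])
      moreover have "0 \<le> sqrt (r\<^sup>2 - t\<^sup>2)" using True r abs_le_square_iff[of t r] by auto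
      ultimately show ?thesis using True by (simp add: norm_mult norm_divide divide_right_mono)
    qed simp
  qed
  show i: "set_integrable lborel {-r<..<r} ?g"
    unfolding set_integrable_def
  proof (rule Bochner_Integration.integrable_bound[OF wi])
    show "AE t in lborel. norm (indicator {-r<..<r} t *\<^sub>R ?g t) \<le> norm (?w t)"
      using b by eventually_elim (simp only: real_norm_def order.trans[OF _ abs_ge_self])
  qed simp
  have "cmod (LINT t:{-r<..<r}|lborel. ?g t) \<le> (\<integral>t. norm (indicator {-r<..<r} t *\<^sub>R ?g t) \<partial>lborel)"
    unfolding set_lebesgue_integral_def by (rule integral_norm_bound)
  also have "\<dots> \<le> (\<integral>t. ?w t \<partial>lborel)"
    using i b by (intro integral_mono_AE wi integrable_norm) (auto simp: set_integrable_def)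
  also have "\<dots> = B * pi"
    using cheb_weight(2)[OF r] unfolding set_lebesgue_integral_def by (simp only: integral_mult_right_zero)
  finally show "cmod (LINT t:{-r<..<r}|lborel. ?g t) \<le> B * pi" .
qed

text \<open>On the unit circle the Joukowski map is \<open>cos \<phi>\<close>; the halves of the circle are exchanged by
  \<open>\<phi> \<mapsto> 2 * pi - \<phi>\<close>, which turns \<open>exp (- \<i> * k * \<phi>)\<close> into \<open>cos (k * \<phi>)\<close>.\<close>

lemma cheb_contour_coeff_cos:
  assumes g: "g holomorphic_on UNIV"
  shows "pi * cheb_contour_coeff g k = integral {0..pi} (\<lambda>\<phi>. g (of_real (cos \<phi>)) * of_real (cos (real k * \<phi>)))"
proof -
  have gc: "continuous_on A (\<lambda>\<phi>. g (of_real (cos \<phi>)))" for A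
    by (rule continuous_on_compose2[OF holomorphic_on_imp_continuous_on[OF g]]) (auto intro!: continuous_intros)
  define F where "F = (\<lambda>\<phi>. g (of_real (cos \<phi>)) * cis (- real k * \<phi>))"
  have Fc: "continuous_on A F" for A
    unfolding F_def by (intro continuous_intros gc)
  have "2 * pi * \<i> * cheb_contour_coeff g k = contour_integral (part_circlepath 0 1 0 (2*pi)) (\<lambda>\<zeta>. g ((\<zeta> + 1/\<zeta>) / 2) / \<zeta> ^ Suc k)"
    by (simp add: cheb_contour_coeff_def circlepath_def)
  also have "\<dots> = integral {0..2*pi} (\<lambda>\<phi>. \<i> * F \<phi>)"
  proof (subst contour_integral_part_circlepath_eq, simp, rule integral_cong)
    fix \<phi> :: real
    have "1 / cis \<phi> = cis (- \<phi>)" by (simp add: cis_inverse divide_inverse)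
    then have "(cis \<phi> + 1 / cis \<phi>) / 2 = of_real (cos \<phi>)"
      by (simp only:) (simp add: complex_eq_iff)
    moreover have "cis \<phi> / cis \<phi> ^ Suc k = cis (- real k * \<phi>)"
    proof -
      have "cis \<phi> / cis \<phi> ^ Suc k = cis (\<phi> - real (Suc k) * \<phi>)"
        by (simp only: Complex.DeMoivre cis_divide)
      also have "\<phi> - real (Suc k) * \<phi> = - real k * \<phi>" by (simp add: algebra_simps)
      finally show ?thesis .
    qed
    moreover have "a / b * 1 * \<i> * c = \<i> * (a * (c / b))" for a b c :: complex
      by (simp only: mult_1_left mult_1_right times_divide_eq_left times_divide_eq_right mult_ac)
    ultimately show "g ((0 + complex_of_real 1 * cis \<phi> + 1 / (0 + complex_of_real 1 * cis \<phi>)) / 2) / (0 + complex_of_real 1 * cis \<phi>) ^ Suc k * complex_of_real 1 * \<i> * cis \<phi> = \<i> * F \<phi>"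
      unfolding F_def by (simp only: of_real_1 mult_1 add_0)
  qed
  also have "\<dots> = \<i> * integral {0..2*pi} F" by simp
  finally have "\<i> * (2 * pi * cheb_contour_coeff g k) = \<i> * integral {0..2*pi} F"
    by (simp only: mult_ac)
  then have 1: "2 * pi * cheb_contour_coeff g k = integral {0..2*pi} F" by simp
  have "((\<lambda>x. (-1) *\<^sub>R F (2 * pi - x)) has_integral (integral {2*pi - 0..2*pi - pi} F - integral {2*pi - pi..2*pi - 0} F)) {0..pi}"
    by (rule has_integral_substitution_general[where s="{}" and c=0 and d="2*pi"])
       (auto intro!: Fc continuous_intros derivative_eq_intros)
  then have "((\<lambda>x. - F (2 * pi - x)) has_integral (- integral {pi..2*pi} F)) {0..pi}" by simp
  from has_integral_neg[OF this] have 2: "integral {pi..2*pi} F = integral {0..pi} (\<lambda>x. F (2 * pi - x))"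
    by (simp add: integral_unique)
  have "integral {0..2*pi} F = integral {0..pi} F + integral {pi..2*pi} F"
    by (rule Henstock_Kurzweil_Integration.integral_combine[symmetric]) (auto intro!: integrable_continuous_real Fc)
  also have "\<dots> = integral {0..pi} (\<lambda>x. F x + F (2 * pi - x))"
    unfolding 2 by (rule Henstock_Kurzweil_Integration.integral_add[symmetric])
       (auto intro!: integrable_continuous_real Fc continuous_on_compose2[OF Fc[of UNIV]] continuous_intros)
  also have "\<dots> = integral {0..pi} (\<lambda>\<phi>. 2 * (g (of_real (cos \<phi>)) * of_real (cos (real k * \<phi>))))"
  proof (rule integral_cong)
    fix x
    have "cis (- real k * (2 * pi - x)) = cis (real k * x) * cis (2 * pi * of_int (- int k))"
      by (simp add: cis_mult algebra_simps)
    also have "cis (2 * pi * of_int (- int k)) = 1" by (rule cis_multiple_2pi) simp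
    finally have "cis (- real k * x) + cis (- real k * (2 * pi - x)) = 2 * of_real (cos (real k * x))"
      by (simp add: complex_eq_iff)
    moreover have "cos (2 * pi - x) = cos x" by (simp add: cos_diff)
    ultimately show "F x + F (2 * pi - x) = 2 * (g (of_real (cos x)) * of_real (cos (real k * x)))"
      unfolding F_def \<open>cos (2 * pi - x) = cos x\<close> by (simp only: distrib_left[symmetric] mult.left_commute)
  qed
  also have "\<dots> = 2 * integral {0..pi} (\<lambda>\<phi>. g (of_real (cos \<phi>)) * of_real (cos (real k * \<phi>)))" by simp
  finally show ?thesis using 1 by simp
qed

lemma cheb_contour_coeff_real:
  assumes g: "g holomorphic_on UNIV" and r: "r > 0"
  shows "(LINT t:{-r<..<r}|lborel. g (of_real (t / r)) * of_real (poly (cheb k) (t / r)) / of_real (sqrt (r\<^sup>2 - t\<^sup>2)))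
         = pi * cheb_contour_coeff g k"
proof -
  have gc: "continuous_on A (\<lambda>\<phi>. g (of_real (cos \<phi>)))" for A
    by (rule continuous_on_compose2[OF holomorphic_on_imp_continuous_on[OF g]]) (auto intro!: continuous_intros)
  have gc': "continuous_on A (\<lambda>t. g (of_real (t / r)))" for A
    by (rule continuous_on_compose2[OF holomorphic_on_imp_continuous_on[OF g]]) (use r in \<open>auto intro!: continuous_intros\<close>)
  define h where "h = (\<lambda>t. g (of_real (t / r)) * of_real (poly (cheb k) (t / r)) / of_real (sqrt (r\<^sup>2 - t\<^sup>2)))"
  have "((\<lambda>t. (g (of_real (cos (arccos (t/r)))) * of_real (cos (real k * arccos (t/r)))) / of_real (sqrt (r\<^sup>2 - t\<^sup>2)))
      has_integral pi * cheb_contour_coeff g k) {-r..r}"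
    unfolding cheb_contour_coeff_cos[OF g]
    by (rule has_integral_arccos_substitution[OF r, of "\<lambda>\<phi>. g (of_real (cos \<phi>)) * of_real (cos (real k * \<phi>))"])
       (intro continuous_intros gc)
  then have "(h has_integral pi * cheb_contour_coeff g k) {-r..r}"
    by (rule has_integral_eq[rotated]) (use r in \<open>auto simp: h_def poly_cheb field_simps\<close>)
  then have hi: "(h has_integral pi * cheb_contour_coeff g k) {-r<..<r}"
    using has_integral_Icc_iff_Ioo by blast
  have "bounded ((\<lambda>t. g (of_real (t / r))) ` {-r..r})"
    by (intro compact_imp_bounded compact_continuous_image gc') auto
  then obtain B where B: "\<And>t. t \<in> {-r..r} \<Longrightarrow> cmod (g (of_real (t / r))) \<le> B"
    unfolding bounded_iff by blast
  have [measurable]: "(\<lambda>t. g (of_real (t / r))) \<in> borel_measurable borel"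
    by (intro borel_measurable_continuous_onI gc')
  have [measurable]: "poly (cheb k) \<in> borel_measurable borel"
    by (intro borel_measurable_continuous_onI continuous_intros)
  have m: "(\<lambda>t. indicator {-r<..<r} t *\<^sub>R h t) \<in> borel_measurable borel"
    unfolding h_def by measurable
  have "set_integrable lborel {-r<..<r} h"
    unfolding h_def
  proof (rule cheb_weighted_integrable(1)[OF r, of _ B])
    show "AE t in lborel. t \<in> {-r<..<r} \<longrightarrow> cmod (g (of_real (t / r))) \<le> B"
      using B by (intro AE_I2 impI) auto
  qed fact
  then have ai: "h absolutely_integrable_on {-r<..<r}"
    unfolding set_integrable_def using m by (subst integrable_completion) auto
  have "(LINT t:{-r<..<r}|lebesgue. h t) = pi * cheb_contour_coeff g k"
    using set_lebesgue_integral_eq_integral(2)[OF ai] hi by (simp add: integral_unique)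
  then show ?thesis unfolding h_def[symmetric] unfolding set_lebesgue_integral_def
    using m by (subst (asm) integral_completion) auto
qed

section \<open>Extrapolation of the Fourier transform along rays\<close>

text \<open>On the circle of radius \<open>\<rho>\<close> the Joukowski map has imaginary part at most \<open>(\<rho> - 1/\<rho>) / 2\<close> in absolute value.  It
  is essential that only the imaginary part enters: the modulus \<open>(\<rho> + 1/\<rho>) / 2\<close> exceeds \<open>\<rho> / 2\<close>.\<close>

lemma norm_exp_joukowski_le:
  assumes "cmod \<zeta> = \<rho>" "\<rho> \<ge> 1"
  shows "cmod (exp (\<i> * of_real a * ((\<zeta> + 1/\<zeta>) / 2))) \<le> exp (\<bar>a\<bar> * \<rho> / 2)"
proof -
  have e: "Im (1/\<zeta>) = - (Im \<zeta> / \<rho>\<^sup>2)"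
    using assms(1) by (auto simp: Im_divide cmod_power2[symmetric])
  have "Im ((\<zeta> + 1/\<zeta>) / 2) = Im \<zeta> * (1 - 1/\<rho>\<^sup>2) / 2"
    by (simp add: e algebra_simps)
  moreover have "\<bar>Im \<zeta> * (1 - 1/\<rho>\<^sup>2)\<bar> \<le> \<rho> * 1"
    unfolding abs_mult using assms abs_Im_le_cmod[of \<zeta>]
    by (intro mult_mono) (auto simp: field_simps one_le_power)
  ultimately have i: "\<bar>Im ((\<zeta> + 1/\<zeta>) / 2)\<bar> \<le> \<rho> / 2"
    by (simp only: abs_divide) simp
  have "- (a * Im ((\<zeta> + 1/\<zeta>) / 2)) \<le> \<bar>a\<bar> * \<bar>Im ((\<zeta> + 1/\<zeta>) / 2)\<bar>"
    using abs_ge_minus_self by (simp only: abs_mult[symmetric])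
  also have "\<dots> \<le> \<bar>a\<bar> * (\<rho> / 2)" by (rule mult_left_mono[OF i]) simp
  finally have le: "- (a * Im ((\<zeta> + 1/\<zeta>) / 2)) \<le> \<bar>a\<bar> * \<rho> / 2" by simp
  have "Re (\<i> * of_real a * z) = - (a * Im z)" for z by simp
  then show ?thesis using le by (simp only: norm_exp_eq_Re exp_le_cancel_iff)
qed

text \<open>The expansion of each exponential \<open>exp (\<i> * (\<xi> \<bullet> x))\<close> in the variable along the ray is integrated against \<open>v x\<close>.
  Only finitely many terms and one remainder occur, so that no series has to be interchanged with the integral,
  and the coefficients of the transform are the integrals of the coefficients of the exponentials.\<close>

lemma fourier_ray_remainder:
  fixes v :: "'a::euclidean_space \<Rightarrow> complex"
  assumes v: "integrable lborel v" and r: "r > 0" and \<theta>: "norm \<theta> = 1"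
    and t: "t \<ge> 1" and \<rho>: "\<rho> \<ge> 4 * t" and n: "n \<ge> 1"
    and w: "integrable lborel (\<lambda>x. exp (r * \<rho> / 2 * norm x) * norm (v x))"
  shows "cmod (fourier_L1 v ((r * t) *\<^sub>R \<theta>) - (\<Sum>k<n. cheb_coeff r (fourier_L1 v) k \<theta> * of_real (poly (cheb k) t)))
      \<le> 2 * (1 / (2 * pi) ^ DIM('a) * (\<integral>x. exp (r * \<rho> / 2 * norm x) * norm (v x) \<partial>lborel)) * (2 * t / \<rho>) ^ n"
proof -
  have vm[measurable]: "v \<in> borel_measurable borel" using borel_measurable_integrable[OF v] by simp
  have [measurable]: "poly (cheb k) \<in> borel_measurable borel" for k
    by (intro borel_measurable_continuous_onI continuous_intros)
  define C where "C = complex_of_real (1 / (2 * pi) ^ DIM('a))"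
  define e where "e = (\<lambda>k::nat. if k = 0 then 1 else 2 :: complex)"
  define g where "g = (\<lambda>x u. exp (\<i> * of_real (r * (\<theta> \<bullet> x)) * u))"
  have gh: "g x holomorphic_on UNIV" for x unfolding g_def by (intro holomorphic_intros)
  have g_eq: "g x (of_real (s / r)) = exp (\<i> * of_real ((s *\<^sub>R \<theta>) \<bullet> x))" for x s
    using r by (simp add: g_def mult_ac)
  define w' where "w' = (\<lambda>s. indicator {-r<..<r} s *\<^sub>R (1 / sqrt (r\<^sup>2 - s\<^sup>2)) :: real)"
  have w'i: "integrable lborel w'" using cheb_weight(1)[OF r] by (simp add: set_integrable_def w'_def)
  define f where "f = (\<lambda>k x s. indicator {-r<..<r} s *\<^sub>R (exp (\<i> * of_real ((s *\<^sub>R \<theta>) \<bullet> x)) * v x * of_real (poly (cheb k) (s / r)) / of_real (sqrt (r\<^sup>2 - s\<^sup>2))))"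
  have ibs: "(\<integral>s. f k x s \<partial>lborel) = v x * (pi * cheb_contour_coeff (g x) k)" for k x
  proof -
    have "(\<integral>s. f k x s \<partial>lborel) = v x * (LINT s:{-r<..<r}|lborel. g x (of_real (s / r)) * of_real (poly (cheb k) (s / r)) / of_real (sqrt (r\<^sup>2 - s\<^sup>2)))"
      unfolding set_lebesgue_integral_def g_eq f_def
      by (subst integral_mult_right_zero[symmetric]) (simp add: mult_ac scaleR_conv_of_real)
    then show ?thesis by (simp only: cheb_contour_coeff_real[OF gh r])
  qed
  have fub: "(\<integral>s. (\<integral>x. f k x s \<partial>lborel) \<partial>lborel) = (\<integral>x. (\<integral>s. f k x s \<partial>lborel) \<partial>lborel)"
    and fint: "integrable (lborel \<Otimes>\<^sub>M lborel) (\<lambda>(x, s). f k x s)" for k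
  proof -
    have m: "(\<lambda>(x, s). f k x s) \<in> borel_measurable (lborel \<Otimes>\<^sub>M lborel)"
      unfolding f_def by measurable
    have le: "cmod (f k x s) \<le> cmod (v x) * w' s" for x s
    proof (cases "s \<in> {-r<..<r}")
      case True
      then have "s / r \<in> {-1..1}" using r by (auto simp: field_simps)
      then have "\<bar>poly (cheb k) (s/r)\<bar> \<le> 1" by (rule abs_poly_cheb_le_1)
      then have "cmod (v x) * \<bar>poly (cheb k) (s/r)\<bar> \<le> cmod (v x) * 1"
        by (intro mult_left_mono) auto
      moreover have "0 \<le> sqrt (r\<^sup>2 - s\<^sup>2)" using True r abs_le_square_iff[of s r] by auto
      moreover have "cmod (exp (\<i> * of_real ((s *\<^sub>R \<theta>) \<bullet> x))) = 1" by (rule norm_exp_i_times)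
      ultimately show ?thesis
        using True by (simp add: f_def w'_def norm_mult norm_divide divide_right_mono)
    qed (simp add: f_def w'_def)
    show "(\<integral>s. (\<integral>x. f k x s \<partial>lborel) \<partial>lborel) = (\<integral>x. (\<integral>s. f k x s \<partial>lborel) \<partial>lborel)"
      by (rule fubini_dominated[OF m integrable_norm[OF v] w'i le])
    show "integrable (lborel \<Otimes>\<^sub>M lborel) (\<lambda>(x, s). f k x s)"
      by (rule integrable_pair_dominated[OF m integrable_norm[OF v] w'i le])
  qed
  have coeff: "cheb_coeff r (fourier_L1 v) k \<theta> = C * (\<integral>x. e k * cheb_contour_coeff (g x) k * v x \<partial>lborel)" for k
  proof -
    have "(LINT s:{-r<..<r}|lebesgue. fourier_L1 v (s *\<^sub>R \<theta>) * of_real (poly (cheb k) (s / r)) / of_real (sqrt (r\<^sup>2 - s\<^sup>2)))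
        = (LINT s:{-r<..<r}|lborel. fourier_L1 v (s *\<^sub>R \<theta>) * of_real (poly (cheb k) (s / r)) / of_real (sqrt (r\<^sup>2 - s\<^sup>2)))"
      unfolding set_lebesgue_integral_def
      by (subst integral_completion) (use fourier_L1_measurable[OF v] in measurable)
    also have "\<dots> = (\<integral>s. C * (\<integral>x. f k x s \<partial>lborel) \<partial>lborel)"
      unfolding set_lebesgue_integral_def
    proof (rule Bochner_Integration.integral_cong[OF refl])
      fix s
      have "(\<integral>x. f k x s \<partial>lborel) = (indicator {-r<..<r} s *\<^sub>R (of_real (poly (cheb k) (s / r)) / of_real (sqrt (r\<^sup>2 - s\<^sup>2)))) * (\<integral>x. exp (\<i> * of_real ((s *\<^sub>R \<theta>) \<bullet> x)) * v x \<partial>lborel)"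
        unfolding f_def by (subst integral_mult_right_zero[symmetric]) (simp add: mult_ac scaleR_conv_of_real)
      then show "indicator {-r<..<r} s *\<^sub>R (fourier_L1 v (s *\<^sub>R \<theta>) * of_real (poly (cheb k) (s / r)) / of_real (sqrt (r\<^sup>2 - s\<^sup>2))) = C * (\<integral>x. f k x s \<partial>lborel)"
        by (simp add: fourier_L1_lborel[OF vm] C_def scaleR_conv_of_real)
    qed
    also have "\<dots> = C * (\<integral>x. v x * (pi * cheb_contour_coeff (g x) k) \<partial>lborel)"
      unfolding integral_mult_right_zero fub ibs ..
    also have "\<dots> = C * (pi * (\<integral>x. cheb_contour_coeff (g x) k * v x \<partial>lborel))"
      by (subst integral_mult_right_zero[symmetric]) (simp add: mult_ac)
    finally have 1: "(LINT s:{-r<..<r}|lebesgue. fourier_L1 v (s *\<^sub>R \<theta>) * of_real (poly (cheb k) (s / r)) / of_real (sqrt (r\<^sup>2 - s\<^sup>2)))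
       = C * (pi * (\<integral>x. cheb_contour_coeff (g x) k * v x \<partial>lborel))" .
    have "(\<integral>x. e k * cheb_contour_coeff (g x) k * v x \<partial>lborel) = e k * (\<integral>x. cheb_contour_coeff (g x) k * v x \<partial>lborel)"
      unfolding mult.assoc by simp
    then show ?thesis unfolding cheb_coeff_def 1 by (simp add: e_def)
  qed
  have cint: "integrable lborel (\<lambda>x. e k * cheb_contour_coeff (g x) k * v x)" for k
  proof -
    have "integrable lborel (\<lambda>x. \<integral>s. f k x s \<partial>lborel)"
      using lborel_pair.integrable_fst[OF fint] .
    then have "integrable lborel (\<lambda>x. (e k / pi) * (v x * (pi * cheb_contour_coeff (g x) k)))"
      unfolding ibs by (rule integrable_mult_right)
    then show ?thesis by (simp add: mult_ac)
  qed
  define E where "E = (\<lambda>x. (g x (of_real t) - (\<Sum>k<n. e k * cheb_contour_coeff (g x) k * of_real (poly (cheb k) t))) * v x)"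
  have gt: "g x (of_real t) * v x = exp (\<i> * of_real (((r * t) *\<^sub>R \<theta>) \<bullet> x)) * v x" for x
    by (simp add: g_def mult_ac)
  have E_eq: "E x = exp (\<i> * of_real (((r * t) *\<^sub>R \<theta>) \<bullet> x)) * v x - (\<Sum>k<n. of_real (poly (cheb k) t) * (e k * cheb_contour_coeff (g x) k * v x))" for x
    unfolding E_def left_diff_distrib gt sum_distrib_right by (simp add: mult_ac)
  have Eint: "integrable lborel E"
    unfolding E_eq[abs_def]
    by (intro Bochner_Integration.integrable_diff Bochner_Integration.integrable_sum integrable_mult_right
         integrable_exp_mult[OF v] cint)
  have "fourier_L1 v ((r * t) *\<^sub>R \<theta>) - (\<Sum>k<n. cheb_coeff r (fourier_L1 v) k \<theta> * of_real (poly (cheb k) t))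
      = C * ((\<integral>x. exp (\<i> * of_real (((r * t) *\<^sub>R \<theta>) \<bullet> x)) * v x \<partial>lborel) - (\<Sum>k<n. of_real (poly (cheb k) t) * (\<integral>x. e k * cheb_contour_coeff (g x) k * v x \<partial>lborel)))"
    unfolding coeff fourier_L1_lborel[OF vm] C_def[symmetric] right_diff_distrib sum_distrib_left by (simp add: mult_ac)
  also have "\<dots> = C * (\<integral>x. E x \<partial>lborel)"
    unfolding E_eq
    by (subst Bochner_Integration.integral_diff,
        rule integrable_exp_mult[OF v],
        intro Bochner_Integration.integrable_sum integrable_mult_right cint,
        subst Bochner_Integration.integral_sum, intro integrable_mult_right cint,
        simp only: integral_mult_right_zero)
  finally have 2: "fourier_L1 v ((r * t) *\<^sub>R \<theta>) - (\<Sum>k<n. cheb_coeff r (fourier_L1 v) k \<theta> * of_real (poly (cheb k) t)) = C * (\<integral>x. E x \<partial>lborel)" .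
  have E_le: "cmod (E x) \<le> 2 * (2 * t / \<rho>) ^ n * (exp (r * \<rho> / 2 * norm x) * norm (v x))" for x
  proof -
    have "cmod (g x ((\<zeta> + 1/\<zeta>) / 2)) \<le> exp (r * \<rho> / 2 * norm x)" if "cmod \<zeta> = \<rho>" for \<zeta>
    proof -
      have "\<bar>\<theta> \<bullet> x\<bar> \<le> norm x" using Cauchy_Schwarz_ineq2[of \<theta> x] \<theta> by simp
      then have "\<bar>r * (\<theta> \<bullet> x)\<bar> * \<rho> / 2 \<le> r * \<rho> / 2 * norm x"
        using r \<rho> t by (simp add: abs_mult mult_left_mono mult_right_mono)
      then show ?thesis
        using norm_exp_joukowski_le[OF that, of "r * (\<theta> \<bullet> x)"] \<rho> t unfolding g_def
        by (smt (verit) exp_le_cancel_iff)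
    qed
    from cheb_expansion_remainder[OF gh this t \<rho> n]
    have "cmod (g x (of_real t) - (\<Sum>k<n. e k * cheb_contour_coeff (g x) k * of_real (poly (cheb k) t))) \<le> 2 * exp (r * \<rho> / 2 * norm x) * (2 * t / \<rho>) ^ n"
      unfolding e_def by simp
    from mult_right_mono[OF this norm_ge_zero[of "v x"]] show ?thesis
      unfolding E_def norm_mult by (simp add: mult_ac)
  qed
  have "cmod (\<integral>x. E x \<partial>lborel) \<le> (\<integral>x. cmod (E x) \<partial>lborel)" by (rule integral_norm_bound)
  also have "\<dots> \<le> (\<integral>x. 2 * (2 * t / \<rho>) ^ n * (exp (r * \<rho> / 2 * norm x) * norm (v x)) \<partial>lborel)"
    by (intro integral_mono E_le integrable_norm Eint integrable_mult_right w)
  also have "\<dots> = 2 * (2 * t / \<rho>) ^ n * (\<integral>x. exp (r * \<rho> / 2 * norm x) * norm (v x) \<partial>lborel)" by simp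
  finally have "cmod C * cmod (\<integral>x. E x \<partial>lborel) \<le> cmod C * (2 * (2 * t / \<rho>) ^ n * (\<integral>x. exp (r * \<rho> / 2 * norm x) * norm (v x) \<partial>lborel))"
    by (intro mult_left_mono) auto
  moreover have "cmod C = 1 / (2 * pi) ^ DIM('a)" unfolding C_def norm_of_real by simp
  ultimately show ?thesis unfolding 2 norm_mult by (simp add: mult_ac)
qed

text \<open>For fixed \<open>s \<noteq> 0\<close> the set of \<open>x\<close> with \<open>s *\<^sub>R x\<close> in a null set is null; Fubini exchanges \<open>s\<close> and \<open>x\<close>, and a
  dilation of the line by \<open>norm x\<close> normalises the direction.  This replaces an integration over the sphere.\<close>

lemma AE_lborel_rays:
  fixes P :: "'a::euclidean_space \<Rightarrow> bool"
  assumes P: "AE x in lborel. P x"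
  shows "AE x in lborel. AE t in lborel. P (t *\<^sub>R (x /\<^sub>R norm x))"
proof -
  obtain Z where Z: "Z \<in> null_sets lborel" "{x. \<not> P x} \<subseteq> Z"
    using P by (auto simp: eventually_ae_filter)
  have Zm[measurable]: "Z \<in> sets borel" using Z(1) by auto
  have "AE s::real in lborel. s \<noteq> 0"
    by (rule AE_lborel_singleton)
  then have "AE s::real in lborel. AE x in lborel. s *\<^sub>R x \<notin> Z"
  proof eventually_elim
    case (elim s)
    have "AE x in lborel. x \<notin> Z" using Z(1) by (rule AE_not_in)
    then show ?case using elim by (intro AE_lborel_scaleR)
  qed
  then have "AE x in lborel. AE s::real in lborel. s *\<^sub>R x \<notin> Z"
  proof (subst lborel_pair.AE_commute[symmetric])
    have "(\<lambda>x::real \<times> 'a. fst x *\<^sub>R snd x) -` (- Z) \<inter> space (lborel \<Otimes>\<^sub>M lborel) \<in> sets (lborel \<Otimes>\<^sub>M lborel)"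
      by (rule measurable_sets[of _ _ borel]) (use Zm in auto)
    then show "{x \<in> space (lborel \<Otimes>\<^sub>M lborel :: (real \<times> 'a) measure). fst x *\<^sub>R snd x \<notin> Z} \<in> sets (lborel \<Otimes>\<^sub>M lborel)"
      by (simp add: vimage_def Int_def conj_commute)
  qed
  moreover have "AE x::'a in lborel. x \<noteq> 0"
    by (rule AE_lborel_singleton)
  ultimately show ?thesis
  proof eventually_elim
    case (elim x)
    then have "AE t::real in lborel. (inverse (norm x) *\<^sub>R t) *\<^sub>R x \<notin> Z"
      by (intro AE_lborel_scaleR[of "inverse (norm x)" "\<lambda>s. s *\<^sub>R x \<notin> Z"]) auto
    then show ?case
      by eventually_elim (use Z(2) in \<open>auto simp: mult_ac\<close>)
  qed
qed

lemma measurable_poly_cheb [measurable]: "poly (cheb k) \<in> borel_measurable borel"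
  by (intro borel_measurable_continuous_onI continuous_intros)

lemma cheb_coeff_lborel:
  fixes w :: "'a::euclidean_space \<Rightarrow> complex"
  assumes [measurable]: "w \<in> borel_measurable borel"
  shows "cheb_coeff r w k \<theta> = of_real ((if k = 0 then 1 else 2) / pi) *
     (LINT t:{-r<..<r}|lborel. w (t *\<^sub>R \<theta>) * of_real (poly (cheb k) (t / r)) / of_real (sqrt (r\<^sup>2 - t\<^sup>2)))"
  unfolding cheb_coeff_def set_lebesgue_integral_def by (subst integral_completion) auto

lemma extrapolate_measurable:
  fixes w :: "'a::euclidean_space \<Rightarrow> complex"
  assumes [measurable]: "w \<in> borel_measurable borel"
  shows "extrapolate r R n w \<in> borel_measurable borel"
proof -
  have [measurable]: "(\<lambda>\<xi>. cheb_coeff r w k (\<xi> /\<^sub>R norm \<xi>)) \<in> borel_measurable borel" for k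
    unfolding cheb_coeff_lborel[OF assms] set_lebesgue_integral_def by measurable
  show ?thesis unfolding extrapolate_def[abs_def] mem_ball dist_0_norm
    by measurable
qed

text \<open>The coefficients are integrals along lines, which are null sets for \<open>d > 1\<close>; a change of the data on a null set
  is nevertheless invisible on almost every line.\<close>

lemma extrapolate_cong_AE:
  fixes w w' :: "'a::euclidean_space \<Rightarrow> complex"
  assumes [measurable]: "w' \<in> borel_measurable borel" and eq: "AE \<xi> in lborel. \<xi> \<in> ball 0 r \<longrightarrow> w \<xi> = w' \<xi>"
  shows "AE \<xi> in lborel. extrapolate r R n w \<xi> = extrapolate r R n w' \<xi>"
  using eq AE_lborel_rays[OF eq] AE_lborel_singleton[of "0::'a"]
proof eventually_elim
  case (elim \<xi>)
  define \<theta> where "\<theta> = \<xi> /\<^sub>R norm \<xi>"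
  have \<theta>: "norm \<theta> = 1" using elim(3) by (simp add: \<theta>_def)
  have "cheb_coeff r w k \<theta> = cheb_coeff r w' k \<theta>" for k
  proof -
    let ?f = "\<lambda>w t. indicator {-r<..<r} t *\<^sub>R (w (t *\<^sub>R \<theta>) * of_real (poly (cheb k) (t / r)) / of_real (sqrt (r\<^sup>2 - t\<^sup>2)))"
    have ae: "AE t in lborel. ?f w t = ?f w' t"
      using elim(2) unfolding \<theta>_def[symmetric]
      by eventually_elim (use \<theta> in \<open>auto simp: indicator_def abs_less_iff\<close>)
    have m: "?f w' \<in> borel_measurable lebesgue"
      by (intro measurable_completion) measurable
    have "(LINT t|lebesgue. ?f w t) = (LINT t|lebesgue. ?f w' t)"
      using borel_measurable_lebesgue_AE[OF m ae] m ae by (intro integral_cong_AE) (simp_all add: AE_lebesgue_iff)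
    then show ?thesis unfolding cheb_coeff_def set_lebesgue_integral_def by simp
  qed
  then show ?case using elim(1) unfolding extrapolate_def \<theta>_def by simp
qed

lemma sum_power_le_power:
  fixes x :: real
  assumes "x \<ge> 2"
  shows "(\<Sum>k<n. x ^ k) \<le> x ^ n"
proof (induction n)
  case (Suc n)
  have "(\<Sum>k<Suc n. x ^ k) \<le> 2 * x ^ n" using Suc by simp
  also have "\<dots> \<le> x * x ^ n" using assms by (intro mult_right_mono) auto
  finally show ?case by simp
qed simp

text \<open>The first term is the data error, amplified by the Chebyshev polynomials outside the unit interval; the second
  one is the truncation error for exact data.\<close>

lemma extrapolate_error_AE:
  fixes v w :: "'a::euclidean_space \<Rightarrow> complex"
  assumes v: "integrable lborel v" and w: "w \<in> borel_measurable borel"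
    and \<delta>: "AE \<xi> in lborel. \<xi> \<in> ball 0 r \<longrightarrow> cmod (w \<xi> - fourier_L1 v \<xi>) \<le> \<delta>" "\<delta> \<ge> 0"
    and r: "r > 0" and L: "L \<ge> 1" and \<rho>: "\<rho> \<ge> 4 * L" and n: "n \<ge> 1"
    and vi: "integrable lborel (\<lambda>x. exp (r * \<rho> / 2 * norm x) * norm (v x))"
    and M: "1 / (2 * pi) ^ DIM('a) * (\<integral>x. exp (r * \<rho> / 2 * norm x) * norm (v x) \<partial>lborel) \<le> M"
  shows "AE \<xi> in lborel. \<xi> \<in> ball 0 (r * L) - ball 0 r \<longrightarrow>
     cmod (fourier_L1 v \<xi> - extrapolate r (r * L) n w \<xi>) \<le> \<delta> * (2 * L) ^ n + 2 * M * (2 * L / \<rho>) ^ n"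
  using AE_lborel_rays[OF \<delta>(1)]
proof eventually_elim
  case (elim \<xi>)
  define F where "F = fourier_L1 v"
  have Fm[measurable]: "F \<in> borel_measurable borel" unfolding F_def by (rule fourier_L1_measurable[OF v])
  note [measurable] = w
  show ?case
  proof
    assume \<xi>: "\<xi> \<in> ball 0 (r * L) - ball 0 r"
    define \<theta> where "\<theta> = \<xi> /\<^sub>R norm \<xi>"
    define t where "t = norm \<xi> / r"
    have nz: "norm \<xi> > 0" using \<xi> r by auto
    have \<theta>: "norm \<theta> = 1" using nz by (simp add: \<theta>_def)
    have t: "t \<ge> 1" "t \<le> L" using \<xi> r by (auto simp: t_def field_simps)
    have \<xi>_eq: "\<xi> = (r * t) *\<^sub>R \<theta>" using nz r by (simp add: \<theta>_def t_def)
    define a where "a = (\<lambda>k. cheb_coeff r w k \<theta>)"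
    define b where "b = (\<lambda>k. cheb_coeff r F k \<theta>)"
    have ae: "AE s in lborel. s \<in> {-r<..<r} \<longrightarrow> cmod (w (s *\<^sub>R \<theta>) - F (s *\<^sub>R \<theta>)) \<le> \<delta>"
      using elim unfolding \<theta>_def[symmetric] F_def[symmetric]
      by eventually_elim (use \<theta> in auto)
    define B where "B = 1 / (2 * pi) ^ DIM('a) * (\<integral>x. cmod (v x) \<partial>lborel)"
    have FB: "cmod (F \<xi>) \<le> B" for \<xi> unfolding F_def B_def by (rule norm_fourier_L1_le[OF v])
    have ae': "AE s in lborel. s \<in> {-r<..<r} \<longrightarrow> cmod (w (s *\<^sub>R \<theta>)) \<le> B + \<delta>"
      using ae
    proof eventually_elim
      case (elim s)
      then show ?case
        using FB[of "s *\<^sub>R \<theta>"] norm_triangle_sub[of "w (s *\<^sub>R \<theta>)" "F (s *\<^sub>R \<theta>)"] by (auto simp: norm_minus_commute)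
    qed
    have ab: "cmod (a k - b k) \<le> (if k = 0 then 1 else 2) * \<delta>" for k
    proof -
      let ?I = "\<lambda>f. LINT s:{-r<..<r}|lborel. f s * of_real (poly (cheb k) (s / r)) / of_real (sqrt (r\<^sup>2 - s\<^sup>2)) :: complex"
      have "?I (\<lambda>s. w (s *\<^sub>R \<theta>)) - ?I (\<lambda>s. F (s *\<^sub>R \<theta>)) = ?I (\<lambda>s. w (s *\<^sub>R \<theta>) - F (s *\<^sub>R \<theta>))"
        unfolding left_diff_distrib diff_divide_distrib
        by (rule set_integral_diff(2)[symmetric]; rule cheb_weighted_integrable(1)[OF r])
           (use ae' FB in auto)
      moreover have "cmod (?I (\<lambda>s. w (s *\<^sub>R \<theta>) - F (s *\<^sub>R \<theta>))) \<le> \<delta> * pi"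
        by (rule cheb_weighted_integrable(2)[OF r _ ae]) measurable
      ultimately have le: "cmod (?I (\<lambda>s. w (s *\<^sub>R \<theta>)) - ?I (\<lambda>s. F (s *\<^sub>R \<theta>))) \<le> \<delta> * pi" by simp
      have "cmod (a k - b k) = (if k = 0 then 1 else 2) / pi * cmod (?I (\<lambda>s. w (s *\<^sub>R \<theta>)) - ?I (\<lambda>s. F (s *\<^sub>R \<theta>)))"
        unfolding a_def b_def cheb_coeff_lborel[OF w] cheb_coeff_lborel[OF Fm] right_diff_distrib[symmetric] norm_mult norm_of_real
        by simp
      also have "\<dots> \<le> (if k = 0 then 1 else 2) / pi * (\<delta> * pi)"
        by (rule mult_left_mono[OF le]) simp
      finally show ?thesis by simp
    qed
    have summand: "cmod ((a k - b k) * of_real (poly (cheb k) t)) \<le> \<delta> * (2 * L) ^ k" for k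
    proof (cases "k = 0")
      case True then show ?thesis using ab[of 0] by (simp add: cheb_0)
    next
      case False
      then have k: "k \<ge> 1" by simp
      have "cmod ((a k - b k) * of_real (poly (cheb k) t)) \<le> 2 * \<delta> * poly (cheb k) t"
        using ab[of k] poly_cheb_bounds[OF t(1) k] False by (simp add: norm_mult mult_right_mono)
      also have "\<dots> \<le> \<delta> * (2 * t) ^ k"
        using mult_left_mono[OF poly_cheb_bounds(2)[OF t(1) k] \<delta>(2)] by (simp add: mult_ac)
      also have "\<dots> \<le> \<delta> * (2 * L) ^ k"
        using t \<delta>(2) by (intro mult_left_mono power_mono) auto
      finally show ?thesis .
    qed
    have "cmod (\<Sum>k<n. (a k - b k) * of_real (poly (cheb k) t)) \<le> (\<Sum>k<n. \<delta> * (2 * L) ^ k)"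
      by (rule sum_norm_le) (rule summand)
    also have "\<dots> = \<delta> * (\<Sum>k<n. (2 * L) ^ k)" by (simp add: sum_distrib_left)
    also have "\<dots> \<le> \<delta> * (2 * L) ^ n" using \<delta>(2) L by (intro mult_left_mono sum_power_le_power) auto
    finally have 1: "cmod (\<Sum>k<n. (a k - b k) * of_real (poly (cheb k) t)) \<le> \<delta> * (2 * L) ^ n" .
    have M0: "0 \<le> M" using M by (rule order.trans[rotated]) simp
    have "cmod (F \<xi> - (\<Sum>k<n. b k * of_real (poly (cheb k) t)))
      \<le> 2 * (1 / (2 * pi) ^ DIM('a) * (\<integral>x. exp (r * \<rho> / 2 * norm x) * norm (v x) \<partial>lborel)) * (2 * t / \<rho>) ^ n"
      unfolding F_def b_def using fourier_ray_remainder[OF v r \<theta> t(1) _ n vi] \<rho> t \<xi>_eq by simp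
    also have "\<dots> \<le> 2 * M * (2 * L / \<rho>) ^ n"
      using M M0 t \<rho> L by (intro mult_mono power_mono divide_right_mono) auto
    finally have 2: "cmod (F \<xi> - (\<Sum>k<n. b k * of_real (poly (cheb k) t))) \<le> 2 * M * (2 * L / \<rho>) ^ n" .
    have "extrapolate r (r * L) n w \<xi> = (\<Sum>k<n. a k * of_real (poly (cheb k) t))"
      using \<xi> unfolding extrapolate_def a_def \<theta>_def t_def by auto
    then have "F \<xi> - extrapolate r (r * L) n w \<xi>
       = (F \<xi> - (\<Sum>k<n. b k * of_real (poly (cheb k) t))) - (\<Sum>k<n. (a k - b k) * of_real (poly (cheb k) t))"
      by (simp add: left_diff_distrib sum_subtractf)
    then have "cmod (F \<xi> - extrapolate r (r * L) n w \<xi>) = cmod ((F \<xi> - (\<Sum>k<n. b k * of_real (poly (cheb k) t))) - (\<Sum>k<n. (a k - b k) * of_real (poly (cheb k) t)))"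
      by (rule arg_cong)
    then have "cmod (F \<xi> - extrapolate r (r * L) n w \<xi>) \<le> 2 * M * (2 * L / \<rho>) ^ n + \<delta> * (2 * L) ^ n"
      using norm_triangle_ineq4[of "F \<xi> - (\<Sum>k<n. b k * of_real (poly (cheb k) t))" "\<Sum>k<n. (a k - b k) * of_real (poly (cheb k) t)"] 1 2 by linarith
    then show "cmod (fourier_L1 v \<xi> - extrapolate r (r * L) n w \<xi>) \<le> \<delta> * (2 * L) ^ n + 2 * M * (2 * L / \<rho>) ^ n"
      by (simp add: F_def)
  qed
qed

section \<open>Choice of the parameters\<close>

text \<open>The number \<open>\<tau>\<close> is the smaller root of \<open>(2 - \<tau>) * \<tau> = (1 - \<alpha>) / \<nu>\<close>.\<close>

lemma tau_bounds:
  fixes \<alpha> \<nu> \<tau> :: real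
  assumes \<nu>: "\<nu> \<ge> 1" and \<alpha>: "0 \<le> \<alpha>" "\<alpha> \<le> 1" and \<tau>: "\<tau> = 1 - sqrt (1 - (1 - \<alpha>) / \<nu>)"
  shows "0 \<le> \<tau>" "\<tau> \<le> 1" "(2 - \<tau>) * \<tau> * \<nu> = 1 - \<alpha>" "\<tau> * \<nu> \<le> 1"
proof -
  define x where "x = (1 - \<alpha>) / \<nu>"
  have x: "0 \<le> x" "x \<le> 1 / \<nu>" "x \<le> 1"
    using \<nu> \<alpha> by (auto simp: x_def divide_right_mono field_simps)
  have t: "\<tau> = 1 - sqrt (1 - x)" using \<tau> by (simp add: x_def)
  have s: "0 \<le> sqrt (1 - x)" "sqrt (1 - x) \<le> 1" "(sqrt (1 - x))\<^sup>2 = 1 - x" using x by auto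
  show "0 \<le> \<tau>" "\<tau> \<le> 1" using s t by auto
  have "(2 - \<tau>) * \<tau> = 1 - (sqrt (1 - x))\<^sup>2" unfolding t by (simp add: power2_eq_square algebra_simps)
  then have e: "(2 - \<tau>) * \<tau> = x" using s by simp
  then show "(2 - \<tau>) * \<tau> * \<nu> = 1 - \<alpha>" using \<nu> by (simp add: x_def)
  have "\<tau> * 1 \<le> \<tau> * (2 - \<tau>)" using \<open>0 \<le> \<tau>\<close> \<open>\<tau> \<le> 1\<close> by (intro mult_left_mono) auto
  then have "\<tau> \<le> 1 / \<nu>" using e x by (simp add: mult.commute)
  then show "\<tau> * \<nu> \<le> 1" using \<nu> by (simp add: field_simps)
qed

lemma Lpar_ge_1: "Lpar N \<sigma> \<nu> r \<tau> \<delta> \<ge> 1"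
  by (simp add: Lpar_def)

text \<open>Both \<open>L\<close> and \<open>n\<close> are designed for the radius \<open>\<rho> = 2 * A powr (1 / \<nu>)\<close>, where \<open>2 * L = A powr \<tau>\<close>: the growth
  factor \<open>exp (\<sigma> * (r * \<rho> / 2) powr \<nu>)\<close> is then \<open>(N / \<delta>) powr (1 - \<tau>)\<close>, and \<open>n\<close> is the least number of terms for which
  \<open>\<rho> ^ n\<close> compensates it down to \<open>\<delta>\<close>.  The relation \<open>\<rho> \<ge> 4 * L\<close> expresses \<open>\<tau> * \<nu> \<le> 1\<close>.
  For \<open>L = 1\<close> the formula for \<open>n\<close> is not matched to \<open>A\<close>, but then there is nothing to extrapolate.\<close>

lemma parameter_choice:
  fixes N \<sigma> r \<nu> \<delta> \<alpha> \<tau> :: real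
  assumes N: "N > 0" and \<sigma>: "\<sigma> > 0" and r: "r > 0" and \<nu>: "\<nu> \<ge> 1" and \<delta>: "0 < \<delta>" "\<delta> < N"
    and \<alpha>: "0 \<le> \<alpha>" "\<alpha> \<le> 1" and \<tau>: "\<tau> = 1 - sqrt (1 - (1 - \<alpha>) / \<nu>)"
    and L1: "Lpar N \<sigma> \<nu> r \<tau> \<delta> > 1"
  defines "L \<equiv> Lpar N \<sigma> \<nu> r \<tau> \<delta>" and "n \<equiv> npar N \<sigma> \<nu> r \<tau> \<delta>"
  obtains \<rho> where "\<rho> \<ge> 4 * L" "n \<ge> 1"
    "\<delta> * (2 * L) ^ n + 2 * (N * exp (\<sigma> * (r * \<rho> / 2) powr \<nu>)) * (2 * L / \<rho>) ^ n \<le> 8 * N powr (1 - \<alpha>) * L * \<delta> powr \<alpha>"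
proof -
  note tb = tau_bounds[OF \<nu> \<alpha> \<tau>]
  define \<Lambda> where "\<Lambda> = ln (N / \<delta>)"
  have \<Lambda>: "\<Lambda> > 0" unfolding \<Lambda>_def using \<delta> by (intro ln_gt_zero) simp
  have exp\<Lambda>: "exp (c * \<Lambda>) = N powr c * \<delta> powr (- c)" for c
  proof -
    have "\<Lambda> = ln N - ln \<delta>" using \<delta> N by (simp add: \<Lambda>_def ln_div)
    then have "c * \<Lambda> = c * ln N + - c * ln \<delta>" by (simp add: right_diff_distrib)
    then show ?thesis using \<delta> N by (simp only: exp_add) (simp add: powr_def)
  qed
  define A where "A = (1 - \<tau>) * \<Lambda> / (\<sigma> * r powr \<nu>)"
  have L_eq: "L = 1/2 * A powr \<tau>"
    using L1 unfolding L_def Lpar_def A_def \<Lambda>_def by (auto simp: max_def split: if_splits)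
  have A0: "A > 0"
  proof -
    have "A \<ge> 0" unfolding A_def using tb \<Lambda> \<sigma> r by simp
    moreover have "A \<noteq> 0" using L1 L_eq L_def by auto
    ultimately show ?thesis by simp
  qed
  have twoL: "2 * L = A powr \<tau>" "2 * L > 2" using L_eq L1 L_def by auto
  have \<tau>0: "\<tau> > 0" using tb twoL A0 by (cases "\<tau> = 0") auto
  have lnA: "ln A > 0"
  proof (rule ccontr)
    assume "\<not> ln A > 0"
    then have "\<tau> * ln A \<le> 0" using \<tau>0 by (simp add: mult_nonneg_nonpos)
    then have "A powr \<tau> \<le> 1" using A0 by (simp add: powr_def)
    then show False using twoL by simp
  qed
  \<comment> \<open>The denominator in the definition of \<open>n\<close> is the logarithm of this radius.\<close>
  define \<rho> where "\<rho> = 2 * A powr (1 / \<nu>)"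
  have \<rho>0: "\<rho> > 0" using A0 by (simp add: \<rho>_def)
  have ln2L: "ln (2 * L) = \<tau> * ln A" unfolding twoL(1) using A0 by (simp add: ln_powr)
  define D where "D = ln 2 + 1 / (\<tau> * \<nu>) * ln (2 * L)"
  have D_eq: "D = ln \<rho>"
    unfolding D_def ln2L \<rho>_def using A0 \<tau>0 \<nu> by (simp add: ln_mult ln_powr field_simps)
  have D0: "D > 0" unfolding D_def ln2L using \<tau>0 \<nu> lnA by (intro add_pos_pos) auto
  define y where "y = (2 - \<tau>) * \<Lambda> / D"
  have y0: "y > 0" unfolding y_def using tb \<Lambda> D0 by simp
  have n_eq: "n = nat \<lceil>y\<rceil>" unfolding n_def npar_def y_def D_def \<Lambda>_def L_def using \<tau>0 by simp
  have n: "y \<le> real n" "real n \<le> y + 1" "n \<ge> 1"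
    unfolding n_eq using y0 by (linarith, linarith, simp add: Suc_leI)
  have \<rho>4: "\<rho> \<ge> 4 * L"
  proof -
    have "\<tau> * ln A \<le> (1 / \<nu>) * ln A"
      using tb(4) \<nu> lnA by (intro mult_right_mono) (auto simp: field_simps)
    then have "A powr \<tau> \<le> A powr (1 / \<nu>)" using A0 by (simp add: powr_def)
    then show ?thesis unfolding \<rho>_def using twoL by simp
  qed
  have "(r * \<rho> / 2) powr \<nu> = r powr \<nu> * A"
    unfolding \<rho>_def using r A0 \<nu> by (simp add: powr_mult powr_powr)
  then have "\<sigma> * (r * \<rho> / 2) powr \<nu> = (1 - \<tau>) * \<Lambda>"
    unfolding A_def using \<sigma> r by simp
  then have E: "exp (\<sigma> * (r * \<rho> / 2) powr \<nu>) = exp ((1 - \<tau>) * \<Lambda>)" by simp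
  have "exp ((2 - \<tau>) * \<Lambda>) \<le> exp (real n * D)"
    using n(1) D0 unfolding y_def by (simp add: field_simps)
  also have "exp (real n * D) = \<rho> ^ n"
    unfolding D_eq using \<rho>0 by (simp add: exp_of_nat_mult)
  finally have \<rho>n: "exp ((2 - \<tau>) * \<Lambda>) \<le> \<rho> ^ n" .
  have "N * exp ((1 - \<tau>) * \<Lambda>) \<le> \<delta> * \<rho> ^ n"
  proof -
    have "N = \<delta> * exp \<Lambda>" using \<delta> N by (simp add: \<Lambda>_def)
    then have "N * exp ((1 - \<tau>) * \<Lambda>) = \<delta> * exp ((2 - \<tau>) * \<Lambda>)"
      by (simp add: mult_exp_exp algebra_simps)
    also have "\<dots> \<le> \<delta> * \<rho> ^ n" using \<rho>n \<delta> by (intro mult_left_mono) auto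
    finally show ?thesis .
  qed
  then have "N * exp ((1 - \<tau>) * \<Lambda>) / \<rho> ^ n \<le> \<delta>" using \<rho>0 by (simp add: field_simps)
  then have "2 * (N * exp ((1 - \<tau>) * \<Lambda>) / \<rho> ^ n) * (2 * L) ^ n \<le> 2 * \<delta> * (2 * L) ^ n"
    using twoL by (intro mult_right_mono) auto
  then have 1: "\<delta> * (2 * L) ^ n + 2 * (N * exp (\<sigma> * (r * \<rho> / 2) powr \<nu>)) * (2 * L / \<rho>) ^ n \<le> 3 * \<delta> * (2 * L) ^ n"
    unfolding E by (simp add: power_divide mult_ac)
  have ln0: "ln (2 * L) > 0" unfolding ln2L using \<tau>0 lnA by simp
  have "(2 * L) ^ n = exp (real n * ln (2 * L))"
    by (subst exp_of_nat_mult, subst exp_ln) (use twoL in auto)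
  also have "\<dots> \<le> exp ((y + 1) * ln (2 * L))" using n(2) ln0 by simp
  also have "\<dots> = exp (y * ln (2 * L)) * (2 * L)"
  proof -
    have "0 < 2 * L" using twoL by linarith
    then show ?thesis by (simp only: distrib_right exp_add mult_1_left exp_ln)
  qed
  also have "\<dots> \<le> exp ((1 - \<alpha>) * \<Lambda>) * (2 * L)"
  proof -
    have "ln (2 * L) \<le> \<tau> * \<nu> * D"
      unfolding D_def using \<tau>0 \<nu> by (simp add: distrib_left)
    then have "y * ln (2 * L) \<le> y * (\<tau> * \<nu> * D)" using y0 by (intro mult_left_mono) auto
    also have "\<dots> = ((2 - \<tau>) * \<tau> * \<nu>) * \<Lambda>" unfolding y_def using D0 by simp
    finally have "y * ln (2 * L) \<le> (1 - \<alpha>) * \<Lambda>" unfolding tb(3) .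
    then show ?thesis using twoL by (intro mult_right_mono) auto
  qed
  finally have "(2 * L) ^ n \<le> N powr (1 - \<alpha>) * \<delta> powr (- (1 - \<alpha>)) * (2 * L)" unfolding exp\<Lambda> .
  then have "3 * \<delta> * (2 * L) ^ n \<le> 3 * \<delta> * (N powr (1 - \<alpha>) * \<delta> powr (- (1 - \<alpha>)) * (2 * L))"
    using \<delta> by (intro mult_left_mono) auto
  also have "\<dots> = 6 * N powr (1 - \<alpha>) * L * (\<delta> powr 1 * \<delta> powr (- (1 - \<alpha>)))" using \<delta> by simp
  also have "\<dots> = 6 * N powr (1 - \<alpha>) * L * \<delta> powr \<alpha>" unfolding powr_add[symmetric] by simp
  also have "\<dots> \<le> 8 * N powr (1 - \<alpha>) * L * \<delta> powr \<alpha>"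
    using twoL by (intro mult_right_mono) auto
  finally show ?thesis using that[OF \<rho>4 n(3)] 1 by linarith
qed

section \<open>The uniform error of the extrapolated transform\<close>

lemma measurable_lebesgue_on_representative:
  fixes w :: "'a::euclidean_space \<Rightarrow> complex"
  assumes w: "w \<in> borel_measurable (lebesgue_on S)" and S: "S \<in> sets lebesgue"
  obtains w' where "w' \<in> borel_measurable borel" "AE \<xi> in lborel. \<xi> \<in> S \<longrightarrow> w \<xi> = w' \<xi>"
proof -
  have "(\<lambda>x. indicator S x *\<^sub>R w x) \<in> borel_measurable lebesgue"
    using w S by (subst (asm) borel_measurable_restrict_space_iff) auto
  then obtain w' where w': "w' \<in> borel_measurable borel" and ae: "AE x in lborel. indicator S x *\<^sub>R w x = w' x"
    using lebesgue_AE_borel_complex by blast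
  have "AE x in lborel. x \<in> S \<longrightarrow> w x = w' x"
    using ae by eventually_elim auto
  then show ?thesis by (rule that[OF w'])
qed

lemma AE_lebesgue_on_iff:
  assumes "S \<in> sets lebesgue"
  shows "(AE x in lebesgue_on S. P x) \<longleftrightarrow> (AE x in lborel. x \<in> S \<longrightarrow> P x)"
  using assms by (subst AE_restrict_space_iff) (auto simp: AE_lebesgue_iff)

lemma Q_finite_imp:
  fixes v :: "'a::euclidean_space \<Rightarrow> complex"
  assumes v: "v \<in> borel_measurable borel" and Q: "Q v l \<le> ennreal M" and M: "M \<ge> 0"
  shows "integrable lborel (\<lambda>x. exp (l * norm x) * norm (v x))"
    and "1 / (2 * pi) ^ DIM('a) * (\<integral>x. exp (l * norm x) * norm (v x) \<partial>lborel) \<le> M"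
proof -
  note [measurable] = v
  define c where "c = 1 / (2 * pi) ^ DIM('a)"
  have c: "c > 0" by (simp add: c_def)
  define I where "I = (\<integral>\<^sup>+x. ennreal (exp (l * norm x) * norm (v x)) \<partial>lborel)"
  have QI: "Q v l = ennreal c * I"
    unfolding Q_def I_def c_def by (simp add: nn_integral_completion)
  have "I \<noteq> \<infinity>"
  proof
    assume "I = \<infinity>"
    then have "Q v l = \<infinity>" unfolding QI using c by (simp add: ennreal_mult_top)
    then show False using Q by (simp add: top_unique)
  qed
  then show i: "integrable lborel (\<lambda>x. exp (l * norm x) * norm (v x))"
    by (intro integrableI_bounded) (auto simp: I_def less_top)
  have "I = ennreal (\<integral>x. exp (l * norm x) * norm (v x) \<partial>lborel)"
    unfolding I_def by (rule nn_integral_eq_integral[OF i]) simp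
  then have "ennreal (c * (\<integral>x. exp (l * norm x) * norm (v x) \<partial>lborel)) \<le> ennreal M"
    using Q c unfolding QI by (simp add: ennreal_mult)
  then show "1 / (2 * pi) ^ DIM('a) * (\<integral>x. exp (l * norm x) * norm (v x) \<partial>lborel) \<le> M"
    using M unfolding c_def by (simp only: ennreal_le_iff)
qed

lemma Q_cong_AE:
  assumes "AE x in lborel. v x = v' x"
  shows "Q v l = Q v' l"
  unfolding Q_def
  by (intro arg_cong2[where f="(*)"] refl nn_integral_cong_AE) (use assms in \<open>auto simp: AE_lebesgue_iff elim!: eventually_mono\<close>)

text \<open>Inside \<open>ball 0 r\<close> the error is at most \<open>\<delta>\<close>, which the bound dominates because of \<open>\<delta> < N\<close>; in the surrounding
  shell, which is empty for \<open>L = 1\<close>, it is the extrapolation error with the radius from \<open>parameter_choice\<close>.\<close>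

theorem extrapolate_star_error:
  fixes v w :: "'a::euclidean_space \<Rightarrow> complex" and N \<sigma> r \<nu> \<delta> \<alpha> \<tau> :: real
  assumes N: "N > 0" and \<sigma>: "\<sigma> > 0" and r: "r > 0" and \<nu>: "\<nu> \<ge> 1" and \<delta>: "0 < \<delta>" "\<delta> < N"
    and \<alpha>: "0 \<le> \<alpha>" "\<alpha> \<le> 1" and \<tau>: "\<tau> = 1 - sqrt (1 - (1 - \<alpha>) / \<nu>)"
    and adm: "admissible_data N \<sigma> \<nu> r \<delta> v w"
  defines "L \<equiv> Lpar N \<sigma> \<nu> r \<tau> \<delta>" and "q \<equiv> extrapolate_star N \<sigma> \<nu> r \<tau> \<delta> w"
  shows "q \<in> borel_measurable lebesgue"
    and "AE \<xi> in lborel. \<xi> \<in> ball 0 (r * L) \<longrightarrow> cmod (fourier v \<xi> - q \<xi>) \<le> 8 * N powr (1 - \<alpha>) * L * \<delta> powr \<alpha>"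
    and "\<And>\<xi>. \<xi> \<notin> ball 0 (r * L) \<Longrightarrow> q \<xi> = 0"
proof -
  have vi: "integrable lebesgue v" and Q: "\<And>l. l \<ge> 0 \<Longrightarrow> Q v l \<le> ennreal (N * exp (\<sigma> * l powr \<nu>))"
    and wm: "w \<in> borel_measurable (lebesgue_on (ball 0 r))"
    and ess: "esssup (lebesgue_on (ball 0 r)) (\<lambda>\<xi>. ereal (norm (w \<xi> - fourier v \<xi>))) \<le> ereal \<delta>"
    using adm by (auto simp: admissible_data_def)
  define n where "n = npar N \<sigma> \<nu> r \<tau> \<delta>"
  define E where "E = 8 * N powr (1 - \<alpha>) * L * \<delta> powr \<alpha>"
  have L: "L \<ge> 1" unfolding L_def by (rule Lpar_ge_1)
  have q_eq: "q = extrapolate r (r * L) n w" unfolding q_def extrapolate_star_def L_def n_def ..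
  have rL: "r \<le> r * L" using r L by simp
  have Fv: "fourier v = fourier_L1 v" using vi by (simp add: fourier_def)
  have vm: "v \<in> borel_measurable lebesgue" using borel_measurable_integrable[OF vi] .
  obtain v' where v'm[measurable]: "v' \<in> borel_measurable borel" and vae: "AE x in lborel. v x = v' x"
    using lebesgue_AE_borel_complex[OF vm] .
  have v'l: "v' \<in> borel_measurable lebesgue" by (intro measurable_completion) simp
  have "integrable lebesgue v'"
    using vi integrable_cong_AE[OF vm v'l] vae unfolding AE_lebesgue_iff by blast
  then have v'i: "integrable lborel v'" by (subst (asm) integrable_completion) auto
  have F_eq: "fourier_L1 v = fourier_L1 v'" by (rule fourier_L1_cong_AE[OF vae vm v'l])
  obtain w' where w'm: "w' \<in> borel_measurable borel" and wae: "AE \<xi> in lborel. \<xi> \<in> ball 0 r \<longrightarrow> w \<xi> = w' \<xi>"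
    using measurable_lebesgue_on_representative[OF wm] by auto
  have qae: "AE \<xi> in lborel. q \<xi> = extrapolate r (r * L) n w' \<xi>"
    unfolding q_eq by (rule extrapolate_cong_AE[OF w'm wae])
  have "extrapolate r (r * L) n w' \<in> borel_measurable lebesgue"
    by (intro measurable_completion) (simp add: extrapolate_measurable[OF w'm])
  then show "q \<in> borel_measurable lebesgue" by (rule borel_measurable_lebesgue_AE[OF _ qae])
  show "q \<xi> = 0" if "\<xi> \<notin> ball 0 (r * L)" for \<xi>
    using that rL unfolding q_eq extrapolate_def by auto
  have "AE \<xi> in lebesgue_on (ball 0 r). ereal (norm (w \<xi> - fourier v \<xi>)) \<le> ereal \<delta>"
    using esssup_AE by (rule eventually_mono) (rule order.trans[OF _ ess])
  then have dae: "AE \<xi> in lborel. \<xi> \<in> ball 0 r \<longrightarrow> cmod (w \<xi> - fourier_L1 v \<xi>) \<le> \<delta>"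
    by (subst (asm) AE_lebesgue_on_iff) (auto simp: Fv)
  have dae': "AE \<xi> in lborel. \<xi> \<in> ball 0 r \<longrightarrow> cmod (w' \<xi> - fourier_L1 v' \<xi>) \<le> \<delta>"
    using dae wae unfolding F_eq by eventually_elim auto
  have \<delta>E: "\<delta> \<le> E"
  proof -
    have "\<delta> = \<delta> powr (1 - \<alpha>) * \<delta> powr \<alpha>" unfolding powr_add[symmetric] using \<delta> by simp
    also have "\<dots> \<le> N powr (1 - \<alpha>) * \<delta> powr \<alpha>"
      using \<delta> \<alpha> by (intro mult_right_mono powr_mono2) auto
    also have "\<dots> * 1 \<le> (N powr (1 - \<alpha>) * \<delta> powr \<alpha>) * (8 * L)"
      using L by (intro mult_left_mono) auto
    finally show ?thesis by (simp add: E_def mult_ac)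
  qed
  have inner: "AE \<xi> in lborel. \<xi> \<in> ball 0 r \<longrightarrow> cmod (fourier v \<xi> - q \<xi>) \<le> E"
    using dae by eventually_elim (use \<delta>E in \<open>auto simp: q_eq extrapolate_def Fv norm_minus_commute\<close>)
  show "AE \<xi> in lborel. \<xi> \<in> ball 0 (r * L) \<longrightarrow> cmod (fourier v \<xi> - q \<xi>) \<le> 8 * N powr (1 - \<alpha>) * L * \<delta> powr \<alpha>"
    unfolding E_def[symmetric]
  proof (cases "L > 1")
    case False
    then have "L = 1" using L by simp
    then show "AE \<xi> in lborel. \<xi> \<in> ball 0 (r * L) \<longrightarrow> cmod (fourier v \<xi> - q \<xi>) \<le> E"
      using inner by simp
  next
    case True
    obtain \<rho> where \<rho>: "\<rho> \<ge> 4 * L" "n \<ge> 1"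
      "\<delta> * (2 * L) ^ n + 2 * (N * exp (\<sigma> * (r * \<rho> / 2) powr \<nu>)) * (2 * L / \<rho>) ^ n \<le> E"
      using parameter_choice[OF N \<sigma> r \<nu> \<delta> \<alpha> \<tau>] True unfolding L_def n_def E_def by blast
    have "r * \<rho> / 2 \<ge> 0" using r \<rho> L by simp
    from Q[OF this] have Q': "Q v' (r * \<rho> / 2) \<le> ennreal (N * exp (\<sigma> * (r * \<rho> / 2) powr \<nu>))"
      unfolding Q_cong_AE[OF vae] .
    have M0: "0 \<le> N * exp (\<sigma> * (r * \<rho> / 2) powr \<nu>)" using N by simp
    note Qf = Q_finite_imp[OF v'm Q' M0]
    have "AE \<xi> in lborel. \<xi> \<in> ball 0 (r * L) - ball 0 r \<longrightarrow> cmod (fourier_L1 v' \<xi> - extrapolate r (r * L) n w' \<xi>) \<le> \<delta> * (2 * L) ^ n + 2 * (N * exp (\<sigma> * (r * \<rho> / 2) powr \<nu>)) * (2 * L / \<rho>) ^ n"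
      using extrapolate_error_AE[OF v'i w'm dae' _ r L \<rho>(1,2) Qf] \<delta> by simp
    then show "AE \<xi> in lborel. \<xi> \<in> ball 0 (r * L) \<longrightarrow> cmod (fourier v \<xi> - q \<xi>) \<le> E"
      using inner qae
    proof eventually_elim
      case (elim \<xi>)
      show ?case
      proof (cases "\<xi> \<in> ball 0 r")
        case False
        then show ?thesis using elim \<rho>(3) by (auto simp: Fv F_eq)
      qed (use elim in auto)
    qed
  qed
qed

section \<open>Plancherel identity for integrable functions\<close>

lemma gaussian_fourier_real:
  "integrable lborel (\<lambda>x. exp (\<i> * of_real (t * x)) * complex_of_real (exp (- x\<^sup>2 / 2)))"
  "(\<integral>x. exp (\<i> * of_real (t * x)) * complex_of_real (exp (- x\<^sup>2 / 2)) \<partial>lborel) = of_real (sqrt (2 * pi) * exp (- t\<^sup>2 / 2))"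
proof -
  have e: "exp (- x\<^sup>2 / 2) = sqrt (2 * pi) * std_normal_density x" for x
    by (simp add: std_normal_density_def)
  have i: "integrable lborel (\<lambda>x. exp (- x\<^sup>2 / 2) :: real)"
    unfolding e by (intro integrable_mult_right) simp
  show "integrable lborel (\<lambda>x. exp (\<i> * of_real (t * x)) * complex_of_real (exp (- x\<^sup>2 / 2)))"
    by (rule Bochner_Integration.integrable_bound[OF i]) (auto simp: norm_mult norm_exp_i_times)
  have "of_real (exp (- (t^2) / 2)) = (CLINT x|std_normal_distribution. iexp (t * x))"
    using char_std_normal_distribution unfolding char_def by metis
  also have "\<dots> = (\<integral>x. std_normal_density x *\<^sub>R iexp (t * x) \<partial>lborel)"
    by (rule integral_density) auto
  finally have c: "(\<integral>x. std_normal_density x *\<^sub>R iexp (t * x) \<partial>lborel) = of_real (exp (- (t^2) / 2))" ..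
  have "(\<integral>x. exp (\<i> * of_real (t * x)) * complex_of_real (exp (- x\<^sup>2 / 2)) \<partial>lborel)
     = (\<integral>x. of_real (sqrt (2 * pi)) * (std_normal_density x *\<^sub>R iexp (t * x)) \<partial>lborel)"
    unfolding e by (simp add: scaleR_conv_of_real mult_ac)
  then show "(\<integral>x. exp (\<i> * of_real (t * x)) * complex_of_real (exp (- x\<^sup>2 / 2)) \<partial>lborel) = of_real (sqrt (2 * pi) * exp (- t\<^sup>2 / 2))"
    unfolding integral_mult_right_zero c by simp
qed

text \<open>The Gaussian is a product of functions of one coordinate, for which the transform is the characteristic function
  of the normal distribution.\<close>

lemma gaussian_fourier:
  fixes z :: "'a::euclidean_space"
  shows "integrable lborel (\<lambda>x::'a. exp (\<i> * of_real (z \<bullet> x)) * complex_of_real (exp (- (norm x)\<^sup>2 / 2)))" (is ?I)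
    and "(\<integral>x. exp (\<i> * of_real (z \<bullet> x)) * complex_of_real (exp (- (norm x)\<^sup>2 / 2)) \<partial>lborel)
         = of_real (sqrt (2 * pi) ^ DIM('a) * exp (- (norm z)\<^sup>2 / 2))" (is ?E)
proof -
  interpret product_sigma_finite "\<lambda>_::'a. lborel :: real measure" ..
  define f where "f = (\<lambda>x::'a. exp (\<i> * of_real (z \<bullet> x)) * complex_of_real (exp (- (norm x)\<^sup>2 / 2)))"
  define g where "g = (\<lambda>b x. exp (\<i> * of_real ((z \<bullet> b) * x)) * complex_of_real (exp (- x\<^sup>2 / 2)))"
  have norm2: "(norm x)\<^sup>2 = (\<Sum>b\<in>Basis. (x \<bullet> b)\<^sup>2)" for x :: 'a
    unfolding power2_norm_eq_inner by (subst euclidean_inner) (simp add: power2_eq_square)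
  have f_eq: "f (\<Sum>b\<in>Basis. x b *\<^sub>R b) = (\<Prod>b\<in>Basis. g b (x b))" for x
  proof -
    have "z \<bullet> (\<Sum>b\<in>Basis. x b *\<^sub>R b) = (\<Sum>b\<in>Basis. (z \<bullet> b) * x b)"
      by (simp add: inner_sum_right mult.commute)
    moreover have "- (norm (\<Sum>b\<in>Basis. x b *\<^sub>R b :: 'a))\<^sup>2 / 2 = (\<Sum>b\<in>Basis. - (x b)\<^sup>2 / 2)"
      by (simp add: norm2 sum_negf sum_divide_distrib)
    ultimately show ?thesis
      unfolding f_def g_def prod.distrib by (simp add: exp_sum sum_distrib_left)
  qed
  have [measurable]: "f \<in> borel_measurable borel" unfolding f_def by measurable
  have [measurable]: "(\<lambda>x. \<Sum>b\<in>Basis. x b *\<^sub>R b :: 'a) \<in> (\<Pi>\<^sub>M b\<in>Basis. lborel) \<rightarrow>\<^sub>M borel" by measurable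
  have gi: "integrable lborel (g b)" for b unfolding g_def by (rule gaussian_fourier_real)
  have "integrable (\<Pi>\<^sub>M b\<in>Basis. lborel) (\<lambda>x. \<Prod>b\<in>(Basis :: 'a set). g b (x b))"
    by (rule product_integrable_prod) (auto intro: gi)
  then show ?I unfolding f_def[symmetric]
    by (subst lborel_eq) (simp add: integrable_distr_eq f_eq)
  have "(\<integral>x. f x \<partial>lborel) = (\<integral>x. (\<Prod>b\<in>(Basis :: 'a set). g b (x b)) \<partial>(\<Pi>\<^sub>M b\<in>Basis. lborel))"
    by (subst lborel_eq) (simp add: integral_distr f_eq)
  also have "\<dots> = (\<Prod>b\<in>Basis. integral\<^sup>L lborel (g b))"
    by (rule product_integral_prod) (auto intro: gi)
  also have "\<dots> = (\<Prod>b\<in>Basis. of_real (sqrt (2 * pi) * exp (- (z \<bullet> b)\<^sup>2 / 2)))"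
    unfolding g_def by (rule prod.cong[OF refl]) (rule gaussian_fourier_real(2))
  also have "\<dots> = of_real (sqrt (2 * pi) ^ DIM('a) * exp (- (norm z)\<^sup>2 / 2))"
    by (simp add: norm2 prod.distrib exp_sum[symmetric] sum_negf sum_divide_distrib flip: of_real_prod)
  finally show ?E unfolding f_def .
qed

lemma fourier_L1_multiplication_formula:
  fixes h q :: "'a::euclidean_space \<Rightarrow> complex"
  assumes h: "integrable lborel h" and q: "integrable lborel q"
  shows "(\<integral>\<xi>. fourier_L1 h \<xi> * q \<xi> \<partial>lborel) = (\<integral>x. h x * fourier_L1 q x \<partial>lborel)"
proof -
  have hm[measurable]: "h \<in> borel_measurable borel" and qm[measurable]: "q \<in> borel_measurable borel"
    using borel_measurable_integrable[OF h] borel_measurable_integrable[OF q] by simp_all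
  define C where "C = complex_of_real (1 / (2 * pi) ^ DIM('a))"
  have "(\<integral>\<xi>. (\<integral>x. exp (\<i> * of_real (\<xi> \<bullet> x)) * h x * q \<xi> \<partial>lborel) \<partial>lborel)
      = (\<integral>x. (\<integral>\<xi>. exp (\<i> * of_real (\<xi> \<bullet> x)) * h x * q \<xi> \<partial>lborel) \<partial>lborel)"
    by (rule fubini_dominated[OF _ integrable_norm[OF h] integrable_norm[OF q]])
       (auto simp: norm_mult norm_exp_i_times)
  also have "\<dots> = (\<integral>x. (\<integral>\<xi>. h x * (exp (\<i> * of_real (x \<bullet> \<xi>)) * q \<xi>) \<partial>lborel) \<partial>lborel)"
    by (simp only: inner_commute mult_ac)
  finally have "C * (\<integral>\<xi>. (\<integral>x. exp (\<i> * of_real (\<xi> \<bullet> x)) * h x \<partial>lborel) * q \<xi> \<partial>lborel)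
      = C * (\<integral>x. h x * (\<integral>\<xi>. exp (\<i> * of_real (x \<bullet> \<xi>)) * q \<xi> \<partial>lborel) \<partial>lborel)"
    by (simp only: integral_mult_left_zero integral_mult_right_zero)
  then show ?thesis
    unfolding fourier_L1_lborel[OF hm] fourier_L1_lborel[OF qm] C_def[symmetric]
    by (simp only: mult.assoc mult.left_commute[of _ C] integral_mult_right_zero)
qed

text \<open>For an open set the lower semicontinuity of the indicator function gives pointwise convergence of the
  positive part of the difference; the negative part has the same integral by translation invariance.\<close>

lemma L1_translation_continuous_open:
  fixes u :: "nat \<Rightarrow> 'a::euclidean_space"
  assumes U: "open U" "emeasure lborel U < \<infinity>" and u: "u \<longlonglongrightarrow> 0"
  shows "(\<lambda>n. \<integral>y. \<bar>indicator U (u n + y) - indicator U y :: real\<bar> \<partial>lborel) \<longlonglongrightarrow> 0"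
proof -
  have [measurable]: "U \<in> sets borel" using U(1) by simp
  have Ui: "integrable lborel (indicator U :: 'a \<Rightarrow> real)"
    using U by (simp add: integrable_real_indicator)
  have Ut: "integrable lborel (\<lambda>y. indicator U (u n + y) :: real)" for n
    by (rule lborel_integrable_translation[OF Ui])
  have mi: "integrable lborel (\<lambda>y. max 0 (indicator U y - indicator U (u n + y)) :: real)" for n
    using Ui Ut by (intro integrable_max) auto
  have "(\<lambda>n. \<integral>y. max 0 (indicator U y - indicator U (u n + y) :: real) \<partial>lborel) \<longlonglongrightarrow> (\<integral>y. 0 \<partial>(lborel :: 'a measure))"
  proof (rule integral_dominated_convergence[where w="indicator U"])
    show "AE y in lborel. (\<lambda>n. max 0 (indicator U y - indicator U (u n + y) :: real)) \<longlonglongrightarrow> 0"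
    proof (rule AE_I2)
      fix y
      show "(\<lambda>n. max 0 (indicator U y - indicator U (u n + y) :: real)) \<longlonglongrightarrow> 0"
      proof (cases "y \<in> U")
        case True
        have "(\<lambda>n. u n + y) \<longlonglongrightarrow> 0 + y" by (intro tendsto_intros u)
        then have "eventually (\<lambda>n. u n + y \<in> U) sequentially"
          using U(1) True by (auto dest: topological_tendstoD)
        then have "eventually (\<lambda>n. max 0 (indicator U y - indicator U (u n + y) :: real) = 0) sequentially"
          by eventually_elim (simp add: True)
        then show ?thesis by (rule tendsto_eventually)
      next
        case False
        then have "max 0 (indicator U y - indicator U (u n + y) :: real) = 0" for n by simp
        then show ?thesis by simp
      qed
    qed
  qed (use Ui in \<open>auto simp: indicator_def\<close>)
  then have "(\<lambda>n. 2 * (\<integral>y. max 0 (indicator U y - indicator U (u n + y) :: real) \<partial>lborel)) \<longlonglongrightarrow> 2 * 0"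
    by (intro tendsto_intros) simp
  moreover have "(\<integral>y. \<bar>indicator U (u n + y) - indicator U y :: real\<bar> \<partial>lborel)
      = 2 * (\<integral>y. max 0 (indicator U y - indicator U (u n + y) :: real) \<partial>lborel)" for n
  proof -
    have "(\<integral>y. \<bar>indicator U (u n + y) - indicator U y :: real\<bar> \<partial>lborel)
      = (\<integral>y. 2 * max 0 (indicator U y - indicator U (u n + y)) + (indicator U (u n + y) - indicator U y) \<partial>lborel)"
      by (intro Bochner_Integration.integral_cong refl) (auto simp: max_def abs_if)
    also have "\<dots> = 2 * (\<integral>y. max 0 (indicator U y - indicator U (u n + y)) \<partial>lborel) + ((\<integral>y. indicator U (u n + y) \<partial>lborel) - (\<integral>y. indicator U y \<partial>lborel))"
      using mi Ui Ut by (subst Bochner_Integration.integral_add) (auto intro!: Bochner_Integration.integrable_diff)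
    also have "(\<integral>y. indicator U (u n + y) \<partial>lborel) = (\<integral>y. indicator U y \<partial>lborel :: real)"
      by (rule lborel_integral_translation) simp
    finally show ?thesis by simp
  qed
  ultimately show ?thesis by simp
qed

text \<open>Indicator functions of measurable sets are approximated by those of open sets, and general functions by simple ones;
  translations are isometries of \<open>L\<^sup>1\<close>.\<close>

lemma L1_translation_continuous:
  fixes h :: "'a::euclidean_space \<Rightarrow> complex"
  assumes h: "integrable lborel h"
  shows "\<forall>u. u \<longlonglongrightarrow> 0 \<longrightarrow> (\<lambda>n. \<integral>y. cmod (h (u n + y) - h y) \<partial>lborel) \<longlonglongrightarrow> 0"
  using h
proof (induction rule: integrable_induct)
  case (base A c)
  show ?case
  proof (intro allI impI)
    fix u :: "nat \<Rightarrow> 'a" assume u: "u \<longlonglongrightarrow> 0"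
    have [measurable]: "A \<in> sets borel" using base by simp
    have e: "(\<integral>y. cmod (indicator A (u n + y) *\<^sub>R c - indicator A y *\<^sub>R c) \<partial>lborel) = cmod c * (\<integral>y. \<bar>indicator A (u n + y) - indicator A y :: real\<bar> \<partial>lborel)" for n
      unfolding scaleR_left_diff_distrib[symmetric] norm_scaleR by (simp add: mult.commute)
    have "(\<lambda>n. \<integral>y. \<bar>indicator A (u n + y) - indicator A y :: real\<bar> \<partial>lborel) \<longlonglongrightarrow> 0"
    proof (rule LIMSEQ_I)
      fix e :: real assume "e > 0"
      then obtain U where U: "open U" "A \<subseteq> U" "U - A \<in> lmeasurable" "emeasure lebesgue (U - A) < ennreal (e/3)"
        using sets_lebesgue_outer_open[of A "e/3"] base by (metis divide_pos_pos sets_completionI_sets zero_less_numeral)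
      have [measurable]: "U \<in> sets borel" using U by simp
      have mUA: "emeasure lborel (U - A) < ennreal (e/3)" using U by simp
      have "emeasure lborel U \<le> emeasure lborel A + emeasure lborel (U - A)"
        using U(2) by (intro order.trans[OF _ emeasure_subadditive] emeasure_mono) auto
      also have "\<dots> < \<infinity>" using base mUA by (auto simp: less_top[symmetric])
      finally have Uf: "emeasure lborel U < \<infinity>" .
      have Ui: "integrable lborel (indicator U :: 'a \<Rightarrow> real)" and Ai: "integrable lborel (indicator A :: 'a \<Rightarrow> real)"
        and Di: "integrable lborel (indicator (U - A) :: 'a \<Rightarrow> real)"
        using Uf base order.strict_trans[OF mUA ennreal_less_top] by (auto simp: integrable_real_indicator)
      have D: "(\<integral>y. indicator (U - A) y \<partial>lborel) < e / 3"
        using mUA \<open>e > 0\<close> by (simp add: measure_def) (metis enn2real_less_iff ennreal_less_top order.strict_trans less_imp_le less_divide_eq_numeral1(1) mult_zero_left)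
      from LIMSEQ_D[OF L1_translation_continuous_open[OF U(1) Uf u], of "e/3"] \<open>e > 0\<close>
      obtain N where N: "\<And>n. n \<ge> N \<Longrightarrow> norm ((\<integral>y. \<bar>indicator U (u n + y) - indicator U y :: real\<bar> \<partial>lborel) - 0) < e / 3"
        by auto
      have "norm ((\<integral>y. \<bar>indicator A (u n + y) - indicator A y :: real\<bar> \<partial>lborel) - 0) < e" if n: "n \<ge> N" for n
      proof -
        have "(\<integral>y. \<bar>indicator A (u n + y) - indicator A y :: real\<bar> \<partial>lborel)
           \<le> (\<integral>y. indicator (U - A) (u n + y) + \<bar>indicator U (u n + y) - indicator U y\<bar> + indicator (U - A) y \<partial>lborel)"
        proof (intro integral_mono Bochner_Integration.integrable_add integrable_abs Bochner_Integration.integrable_diff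
               lborel_integrable_translation Ui Ai Di)
          fix y
          show "\<bar>indicator A (u n + y) - indicator A y :: real\<bar> \<le> indicator (U - A) (u n + y) + \<bar>indicator U (u n + y) - indicator U y\<bar> + indicator (U - A) y"
            using U(2) by (auto simp: indicator_def)
        qed
        also have "\<dots> = (\<integral>y. indicator (U - A) (u n + y) \<partial>lborel) + (\<integral>y. \<bar>indicator U (u n + y) - indicator U y\<bar> \<partial>lborel) + (\<integral>y. indicator (U - A) y \<partial>lborel)"
          using Ui Di lborel_integrable_translation[OF Ui] lborel_integrable_translation[OF Di] by simp
        also have "(\<integral>y. indicator (U - A) (u n + y) \<partial>lborel) = (\<integral>y. indicator (U - A) y \<partial>lborel :: real)"
          by (rule lborel_integral_translation) simp
        finally show ?thesis using D N[OF n] by simp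
      qed
      then show "\<exists>N. \<forall>n\<ge>N. norm ((\<integral>y. \<bar>indicator A (u n + y) - indicator A y :: real\<bar> \<partial>lborel) - 0) < e" by blast
    qed
    from tendsto_mult_left[OF this, of "cmod c"]
    show "(\<lambda>n. \<integral>y. cmod (indicator A (u n + y) *\<^sub>R c - indicator A y *\<^sub>R c) \<partial>lborel) \<longlonglongrightarrow> 0"
      unfolding e by simp
  qed
next
  case (add f g)
  show ?case
  proof (intro allI impI)
    fix u :: "nat \<Rightarrow> 'a" assume u: "u \<longlonglongrightarrow> 0"
    have "(\<lambda>n. (\<integral>y. cmod (f (u n + y) - f y) \<partial>lborel) + (\<integral>y. cmod (g (u n + y) - g y) \<partial>lborel)) \<longlonglongrightarrow> 0 + 0"
      using add u by (intro tendsto_add) auto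
    then have lim: "(\<lambda>n. (\<integral>y. cmod (f (u n + y) - f y) \<partial>lborel) + (\<integral>y. cmod (g (u n + y) - g y) \<partial>lborel)) \<longlonglongrightarrow> 0" by simp
    have fi: "integrable lborel (\<lambda>y. f (u n + y) - f y)" and gi: "integrable lborel (\<lambda>y. g (u n + y) - g y)" for n
      using add by (auto intro!: Bochner_Integration.integrable_diff lborel_integrable_translation)
    have le: "(\<integral>y. cmod (f (u n + y) + g (u n + y) - (f y + g y)) \<partial>lborel) \<le> (\<integral>y. cmod (f (u n + y) - f y) \<partial>lborel) + (\<integral>y. cmod (g (u n + y) - g y) \<partial>lborel)" for n
    proof -
      have "integrable lborel (\<lambda>y. (f (u n + y) - f y) + (g (u n + y) - g y))"
        by (intro Bochner_Integration.integrable_add fi gi)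
      then have i: "integrable lborel (\<lambda>y. f (u n + y) + g (u n + y) - (f y + g y))" by (simp add: algebra_simps)
      have "(\<integral>y. cmod (f (u n + y) + g (u n + y) - (f y + g y)) \<partial>lborel) \<le> (\<integral>y. cmod (f (u n + y) - f y) + cmod (g (u n + y) - g y) \<partial>lborel)"
        by (intro integral_mono integrable_norm i Bochner_Integration.integrable_add fi gi)
           (metis add_diff_add norm_triangle_ineq)
      also have "\<dots> = (\<integral>y. cmod (f (u n + y) - f y) \<partial>lborel) + (\<integral>y. cmod (g (u n + y) - g y) \<partial>lborel)"
        by (intro Bochner_Integration.integral_add integrable_norm fi gi)
      finally show ?thesis .
    qed
    show "(\<lambda>n. \<integral>y. cmod (f (u n + y) + g (u n + y) - (f y + g y)) \<partial>lborel) \<longlonglongrightarrow> 0"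
      by (rule tendsto_sandwich[OF _ _ tendsto_const lim]) (auto intro!: always_eventually le)
  qed
next
  case (lim f s)
  show ?case
  proof (intro allI impI)
    fix u :: "nat \<Rightarrow> 'a" assume u: "u \<longlonglongrightarrow> 0"
    note fi = lim(4) and si = lim(1)
    have [measurable]: "f \<in> borel_measurable borel" "s i \<in> borel_measurable borel" for i
      using borel_measurable_integrable[OF fi] borel_measurable_integrable[OF si] by simp_all
    have conv: "(\<lambda>i. \<integral>y. cmod (s i y - f y) \<partial>lborel) \<longlonglongrightarrow> (\<integral>y. 0 \<partial>(lborel :: 'a measure))"
    proof (rule integral_dominated_convergence[where w="\<lambda>y. 3 * cmod (f y)"])
      show "AE y in lborel. (\<lambda>i. cmod (s i y - f y)) \<longlonglongrightarrow> 0"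
        using lim(2) by (intro AE_I2 tendsto_norm_zero) (simp add: LIM_zero_iff)
      show "AE y in lborel. norm (cmod (s i y - f y)) \<le> 3 * cmod (f y)" for i
      proof (rule AE_I2)
        fix y
        show "norm (cmod (s i y - f y)) \<le> 3 * cmod (f y)"
          using norm_triangle_ineq4[of "s i y" "f y"] lim(3)[of y i] by simp
      qed
    qed (use fi in auto)
    show "(\<lambda>n. \<integral>y. cmod (f (u n + y) - f y) \<partial>lborel) \<longlonglongrightarrow> 0"
    proof (rule LIMSEQ_I)
      fix e :: real assume e: "e > 0"
      have "eventually (\<lambda>i. (\<integral>y. cmod (s i y - f y) \<partial>lborel) < e / 3) sequentially"
        using conv by (rule order_tendstoD) (use e in simp)
      then obtain i where i: "(\<integral>y. cmod (s i y - f y) \<partial>lborel) < e / 3"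
        by (auto simp: eventually_sequentially)
      from lim.IH[of i] u have "(\<lambda>n. \<integral>y. cmod (s i (u n + y) - s i y) \<partial>lborel) \<longlonglongrightarrow> 0" by blast
      then have "eventually (\<lambda>n. (\<integral>y. cmod (s i (u n + y) - s i y) \<partial>lborel) < e / 3) sequentially"
        by (rule order_tendstoD) (use e in simp)
      then obtain N where N: "\<And>n. n \<ge> N \<Longrightarrow> (\<integral>y. cmod (s i (u n + y) - s i y) \<partial>lborel) < e / 3"
        by (auto simp: eventually_sequentially)
      have "norm ((\<integral>y. cmod (f (u n + y) - f y) \<partial>lborel) - 0) < e" if n: "n \<ge> N" for n
      proof -
        have di: "integrable lborel (\<lambda>y. cmod (s i y - f y))"
          using fi si by (intro integrable_norm Bochner_Integration.integrable_diff)
        have di': "integrable lborel (\<lambda>y. cmod (s i (u n + y) - f (u n + y)))"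
          using lborel_integrable_translation[OF di] .
        have si': "integrable lborel (\<lambda>y. cmod (s i (u n + y) - s i y))"
          using si by (intro integrable_norm Bochner_Integration.integrable_diff lborel_integrable_translation)
        have fi': "integrable lborel (\<lambda>y. cmod (f (u n + y) - f y))"
          using fi by (intro integrable_norm Bochner_Integration.integrable_diff lborel_integrable_translation)
        have "(\<integral>y. cmod (f (u n + y) - f y) \<partial>lborel)
            \<le> (\<integral>y. cmod (s i (u n + y) - f (u n + y)) + cmod (s i (u n + y) - s i y) + cmod (s i y - f y) \<partial>lborel)"
        proof (intro integral_mono Bochner_Integration.integrable_add fi' di' si' di)
          fix y
          have "f (u n + y) - f y = - (s i (u n + y) - f (u n + y)) + (s i (u n + y) - s i y) + (s i y - f y)" by simp
          then show "cmod (f (u n + y) - f y) \<le> cmod (s i (u n + y) - f (u n + y)) + cmod (s i (u n + y) - s i y) + cmod (s i y - f y)"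
            using norm_triangle_ineq[of "- (s i (u n + y) - f (u n + y)) + (s i (u n + y) - s i y)" "s i y - f y"]
              norm_triangle_ineq[of "- (s i (u n + y) - f (u n + y))" "s i (u n + y) - s i y"]
            unfolding norm_minus_cancel by (simp only:)
        qed
        also have "\<dots> = (\<integral>y. cmod (s i (u n + y) - f (u n + y)) \<partial>lborel) + (\<integral>y. cmod (s i (u n + y) - s i y) \<partial>lborel) + (\<integral>y. cmod (s i y - f y) \<partial>lborel)"
          using di di' si' by simp
        also have "(\<integral>y. cmod (s i (u n + y) - f (u n + y)) \<partial>lborel) = (\<integral>y. cmod (s i y - f y) \<partial>lborel)"
          by (rule lborel_integral_translation[of "\<lambda>y. cmod (s i y - f y)"]) measurable
        finally show ?thesis using i N[OF n] by simp
      qed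
      then show "\<exists>N. \<forall>n\<ge>N. norm ((\<integral>y. cmod (f (u n + y) - f y) \<partial>lborel) - 0) < e" by blast
    qed
  qed
qed

lemma measurable_cnj [measurable]: "cnj \<in> borel_measurable borel"
  by (intro borel_measurable_continuous_onI continuous_intros)

definition autocorr :: "('a::euclidean_space \<Rightarrow> complex) \<Rightarrow> 'a \<Rightarrow> complex" where
  "autocorr h u = (\<integral>y. h (u + y) * cnj (h y) \<partial>lborel)"

lemma weighted_am_gm:
  fixes a b l :: real
  assumes "l > 0"
  shows "a * b \<le> (l * a\<^sup>2 + b\<^sup>2 / l) / 2"
proof -
  have "0 \<le> (l * a - b)\<^sup>2 / l" using assms by simp
  also have "\<dots> = l * a\<^sup>2 + b\<^sup>2 / l - 2 * (a * b)"
    using assms by (simp add: power2_eq_square field_simps)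
  finally show ?thesis by simp
qed

context
  fixes h :: "'a::euclidean_space \<Rightarrow> complex"
  assumes h1: "integrable lborel h" and h2: "integrable lborel (\<lambda>x. (cmod (h x))\<^sup>2)"
begin

lemma h_borel_measurable: "h \<in> borel_measurable borel"
  using borel_measurable_integrable[OF h1] by simp

lemma autocorr_integrand:
  shows "integrable lborel (\<lambda>y. h (u + y) * cnj (h y))"
    and "cmod (autocorr h u) \<le> (\<integral>x. (cmod (h x))\<^sup>2 \<partial>lborel)"
proof -
  note [measurable] = h_borel_measurable
  have t: "integrable lborel (\<lambda>y. (cmod (h (u + y)))\<^sup>2)"
    by (rule lborel_integrable_translation[OF h2])
  have i: "integrable lborel (\<lambda>y. ((cmod (h (u + y)))\<^sup>2 + (cmod (h y))\<^sup>2) / 2)"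
    using t h2 by simp
  have le: "cmod (h (u + y) * cnj (h y)) \<le> ((cmod (h (u + y)))\<^sup>2 + (cmod (h y))\<^sup>2) / 2" for y
    using weighted_am_gm[of 1 "cmod (h (u + y))" "cmod (h y)"] by (simp add: norm_mult)
  show a: "integrable lborel (\<lambda>y. h (u + y) * cnj (h y))"
  proof (rule Bochner_Integration.integrable_bound[OF i])
    show "AE y in lborel. norm (h (u + y) * cnj (h y)) \<le> norm (((cmod (h (u + y)))\<^sup>2 + (cmod (h y))\<^sup>2) / 2)"
      by (rule AE_I2) (simp only: real_norm_def order.trans[OF le abs_ge_self])
  qed measurable
  have "cmod (autocorr h u) \<le> (\<integral>y. cmod (h (u + y) * cnj (h y)) \<partial>lborel)"
    unfolding autocorr_def by (rule integral_norm_bound)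
  also have "\<dots> \<le> (\<integral>y. ((cmod (h (u + y)))\<^sup>2 + (cmod (h y))\<^sup>2) / 2 \<partial>lborel)"
    by (intro integral_mono integrable_norm a i le)
  also have "\<dots> = ((\<integral>y. (cmod (h (u + y)))\<^sup>2 \<partial>lborel) + (\<integral>y. (cmod (h y))\<^sup>2 \<partial>lborel)) / 2"
    using t h2 by simp
  also have "(\<integral>y. (cmod (h (u + y)))\<^sup>2 \<partial>lborel) = (\<integral>y. (cmod (h y))\<^sup>2 \<partial>lborel)"
    by (rule lborel_integral_translation[of "\<lambda>y. (cmod (h y))\<^sup>2"]) measurable
  finally show "cmod (autocorr h u) \<le> (\<integral>x. (cmod (h x))\<^sup>2 \<partial>lborel)" by simp
qed

lemma autocorr_0: "autocorr h 0 = of_real (\<integral>x. (cmod (h x))\<^sup>2 \<partial>lborel)"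
  unfolding autocorr_def by (simp add: complex_norm_square[symmetric] flip: of_real_power)

lemma autocorr_pair_integrable:
  "integrable (lborel \<Otimes>\<^sub>M lborel) (\<lambda>(y, u). h (u + y) * cnj (h y))"
proof (rule lborel_pair.Fubini_integrable)
  note [measurable] = h_borel_measurable
  have t: "integrable lborel (\<lambda>u. h (u + y))" for y
    using lborel_integrable_translation[OF h1, of y] by (simp add: add.commute)
  show "(\<lambda>(y, u). h (u + y) * cnj (h y)) \<in> borel_measurable (lborel \<Otimes>\<^sub>M lborel)" by measurable
  have "(\<integral>u. cmod (h (u + y)) \<partial>lborel) = (\<integral>u. cmod (h u) \<partial>lborel)" for y
    using lborel_integral_translation[of "\<lambda>u. cmod (h u)" y] by (simp add: add.commute)
  then have "(\<integral>u. cmod (h (u + y) * cnj (h y)) \<partial>lborel) = (\<integral>u. cmod (h u) \<partial>lborel) * cmod (h y)" for y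
    by (simp add: norm_mult)
  then show "integrable lborel (\<lambda>y. \<integral>u. cmod (case (y, u) of (y, u) \<Rightarrow> h (u + y) * cnj (h y)) \<partial>lborel)"
    using h1 by simp
  show "AE y in lborel. integrable lborel (\<lambda>u. case (y, u) of (y, u) \<Rightarrow> h (u + y) * cnj (h y))"
    using t by simp
qed

lemma autocorr_integrable: "integrable lborel (autocorr h)"
  unfolding autocorr_def[abs_def]
  using lborel_pair.integrable_snd[OF autocorr_pair_integrable] by simp

text \<open>The autocorrelation is the convolution of \<open>h\<close> with its reflected conjugate.\<close>

lemma fourier_autocorr: "of_real ((cmod (fourier_L1 h \<xi>))\<^sup>2) = of_real (1 / (2 * pi) ^ DIM('a)) * fourier_L1 (autocorr h) \<xi>"
proof -
  note [measurable] = h_borel_measurable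
  define C where "C = complex_of_real (1 / (2 * pi) ^ DIM('a))"
  define e where "e = (\<lambda>x. exp (\<i> * of_real (\<xi> \<bullet> x)))"
  have [measurable]: "e \<in> borel_measurable borel" unfolding e_def by measurable
  have ne: "cmod (e x) = 1" for x unfolding e_def by (rule norm_exp_i_times)
  define H where "H = (\<integral>x. e x * h x \<partial>lborel)"
  have Am: "autocorr h \<in> borel_measurable borel" using borel_measurable_integrable[OF autocorr_integrable] by simp
  have pi: "integrable (lborel \<Otimes>\<^sub>M lborel) (\<lambda>(y, u). e u * (h (u + y) * cnj (h y)))"
    by (rule Bochner_Integration.integrable_bound[OF autocorr_pair_integrable]) (auto simp: norm_mult ne)
  have "fourier_L1 (autocorr h) \<xi> = C * (\<integral>u. e u * (\<integral>y. h (u + y) * cnj (h y) \<partial>lborel) \<partial>lborel)"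
    unfolding fourier_L1_lborel[OF Am] C_def e_def autocorr_def ..
  also have "\<dots> = C * (\<integral>u. (\<integral>y. e u * (h (u + y) * cnj (h y)) \<partial>lborel) \<partial>lborel)"
    by (simp only: integral_mult_right_zero)
  also have "\<dots> = C * (\<integral>y. (\<integral>u. e u * (h (u + y) * cnj (h y)) \<partial>lborel) \<partial>lborel)"
    by (subst lborel_pair.Fubini_integral[OF pi]) simp
  also have "\<dots> = C * (\<integral>y. cnj (e y * h y) * H \<partial>lborel)"
  proof -
    have "(\<integral>u. e u * (h (u + y) * cnj (h y)) \<partial>lborel) = cnj (e y * h y) * H" for y
    proof -
      have "cnj (e y) = exp (- (\<i> * of_real (\<xi> \<bullet> y)))" by (simp add: e_def exp_cnj)
      then have "cnj (e y) * e (y + u) = e u" for u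
        by (simp add: e_def inner_add_right mult_exp_exp algebra_simps)
      then have "cnj (e y * h y) * (e (y + u) * h (y + u)) = e u * (cnj (h y) * h (y + u))" for u
        by (metis (no_types, lifting) complex_cnj_mult mult.assoc mult.left_commute)
      then have "e u * (h (u + y) * cnj (h y)) = cnj (e y * h y) * (e (y + u) * h (y + u))" for u
        by (simp only: add.commute mult.commute[of "cnj (h y)"])
      then have "(\<integral>u. e u * (h (u + y) * cnj (h y)) \<partial>lborel) = cnj (e y * h y) * (\<integral>u. e (y + u) * h (y + u) \<partial>lborel)"
        by (simp only: integral_mult_right_zero)
      also have "(\<integral>u. e (y + u) * h (y + u) \<partial>lborel) = H"
        unfolding H_def by (rule lborel_integral_translation[of "\<lambda>u. e u * h u"]) measurable
      finally show ?thesis .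
    qed
    then show ?thesis by simp
  qed
  also have "\<dots> = C * (cnj H * H)"
    unfolding H_def by (simp only: integral_mult_left_zero Bochner_Integration.integral_cnj)
  finally have 1: "fourier_L1 (autocorr h) \<xi> = C * (cnj H * H)" .
  have F: "fourier_L1 h \<xi> = C * H" unfolding fourier_L1_lborel[OF h_borel_measurable] C_def e_def H_def ..
  have "of_real ((cmod (fourier_L1 h \<xi>))\<^sup>2) = (C * H) * cnj (C * H)"
    unfolding F by (simp only: complex_norm_square[symmetric] of_real_power)
  also have "\<dots> = C * (C * (cnj H * H))" by (simp add: C_def)
  finally show ?thesis by (simp only: 1 C_def)
qed

text \<open>Where \<open>\<bar>h\<bar> \<le> M\<close>, the difference is controlled by the continuity of translation in \<open>L\<^sup>1\<close>.  The remaining part of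
  \<open>h\<close> has small \<open>L\<^sup>2\<close> norm; a weighted inequality between arithmetic and geometric means replaces the
  Cauchy-Schwarz inequality.\<close>

lemma autocorr_continuous_0:
  assumes u: "u \<longlonglongrightarrow> 0"
  shows "(\<lambda>n. autocorr h (u n)) \<longlonglongrightarrow> autocorr h 0"
proof (rule LIMSEQ_I)
  note [measurable] = h_borel_measurable
  fix e :: real assume e: "e > 0"
  define S where "S = (\<integral>x. (cmod (h x))\<^sup>2 \<partial>lborel)"
  have S0: "S \<ge> 0" by (simp add: S_def)
  \<comment> \<open>The weight is chosen such that the translated square, whose integral is always \<open>S\<close>, contributes at most \<open>e / 4\<close>.\<close>
  define l where "l = e / (2 * (S + 1))"
  have l: "l > 0" "l / 2 * S \<le> e / 4" using e S0 by (auto simp: l_def field_simps)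
  define T where "T = (\<lambda>M x. if cmod (h x) \<le> real M then 0 else (cmod (h x))\<^sup>2)"
  have [measurable]: "T M \<in> borel_measurable borel" for M unfolding T_def by measurable
  have Ti: "integrable lborel (T M)" for M
    by (rule Bochner_Integration.integrable_bound[OF h2]) (auto simp: T_def)
  have "(\<lambda>M. \<integral>x. T M x \<partial>lborel) \<longlonglongrightarrow> (\<integral>x. 0 \<partial>(lborel :: 'a measure))"
  proof (rule integral_dominated_convergence[OF _ _ h2])
    show "AE x in lborel. (\<lambda>M. T M x) \<longlonglongrightarrow> 0"
    proof (rule AE_I2)
      fix x
      obtain M0 where "cmod (h x) \<le> real M0" using real_arch_simple by blast
      then have "eventually (\<lambda>M. T M x = 0) sequentially"
        unfolding T_def eventually_sequentially by (intro exI[of _ M0]) auto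
      then show "(\<lambda>M. T M x) \<longlonglongrightarrow> 0" by (rule tendsto_eventually)
    qed
  qed (auto simp: T_def)
  then have "(\<lambda>M. (1 + 1 / (2 * l)) * (\<integral>x. T M x \<partial>lborel)) \<longlonglongrightarrow> (1 + 1 / (2 * l)) * 0"
    by (intro tendsto_intros) simp
  then have "eventually (\<lambda>M. (1 + 1 / (2 * l)) * (\<integral>x. T M x \<partial>lborel) < e / 2) sequentially"
    by (rule order_tendstoD) (use e in simp)
  then obtain M where M: "(1 + 1 / (2 * l)) * (\<integral>x. T M x \<partial>lborel) < e / 2"
    by (auto simp: eventually_sequentially)
  have "(\<lambda>n. real M * (\<integral>y. cmod (h (u n + y) - h y) \<partial>lborel)) \<longlonglongrightarrow> real M * 0"
    using L1_translation_continuous[OF h1] u by (intro tendsto_intros) auto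
  then have "eventually (\<lambda>n. real M * (\<integral>y. cmod (h (u n + y) - h y) \<partial>lborel) < e / 4) sequentially"
    by (rule order_tendstoD) (use e in simp)
  then obtain N where N: "\<And>n. n \<ge> N \<Longrightarrow> real M * (\<integral>y. cmod (h (u n + y) - h y) \<partial>lborel) < e / 4"
    by (auto simp: eventually_sequentially)
  have "norm (autocorr h (u n) - autocorr h 0) < e" if n: "n \<ge> N" for n
  proof -
    have di: "integrable lborel (\<lambda>y. cmod (h (u n + y) - h y))"
      using h1 by (intro integrable_norm Bochner_Integration.integrable_diff lborel_integrable_translation)
    have ti: "integrable lborel (\<lambda>y. (cmod (h (u n + y)))\<^sup>2)"
      by (rule lborel_integrable_translation[OF h2])
    have gi: "integrable lborel (\<lambda>y. h (u n + y) * cnj (h y) - h (0 + y) * cnj (h y))"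
      by (intro Bochner_Integration.integrable_diff autocorr_integrand)
    have bi: "integrable lborel (\<lambda>y. real M * cmod (h (u n + y) - h y) + (l / 2) * (cmod (h (u n + y)))\<^sup>2 + (1 + 1 / (2 * l)) * T M y)"
      by (intro Bochner_Integration.integrable_add integrable_mult_right di ti Ti)
    have le: "cmod (h (u n + y) * cnj (h y) - h (0 + y) * cnj (h y)) \<le> real M * cmod (h (u n + y) - h y) + (l / 2) * (cmod (h (u n + y)))\<^sup>2 + (1 + 1 / (2 * l)) * T M y" for y
    proof -
      have e: "cmod (h (u n + y) * cnj (h y) - h (0 + y) * cnj (h y)) = cmod (h (u n + y) - h y) * cmod (h y)"
        by (simp add: left_diff_distrib[symmetric] norm_mult)
      show ?thesis
      proof (cases "cmod (h y) \<le> real M")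
        case True
        then have "cmod (h (u n + y) - h y) * cmod (h y) \<le> real M * cmod (h (u n + y) - h y)"
          using mult_left_mono[OF True norm_ge_zero[of "h (u n + y) - h y"]] by (simp only: mult.commute)
        moreover have "0 \<le> (l / 2) * (cmod (h (u n + y)))\<^sup>2" using l by simp
        ultimately show ?thesis using True unfolding e by (simp add: T_def)
      next
        case False
        have "cmod (h (u n + y) - h y) * cmod (h y) \<le> (cmod (h (u n + y)) + cmod (h y)) * cmod (h y)"
          by (intro mult_right_mono norm_triangle_ineq4) auto
        also have "\<dots> = cmod (h (u n + y)) * cmod (h y) + (cmod (h y))\<^sup>2"
          by (simp add: distrib_right power2_eq_square)
        also have "\<dots> \<le> (l * (cmod (h (u n + y)))\<^sup>2 + (cmod (h y))\<^sup>2 / l) / 2 + (cmod (h y))\<^sup>2"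
          using weighted_am_gm[OF l(1)] by simp
        also have "\<dots> = (l / 2) * (cmod (h (u n + y)))\<^sup>2 + (1 + 1 / (2 * l)) * T M y"
          using False by (simp add: T_def field_simps)
        also have "\<dots> \<le> real M * cmod (h (u n + y) - h y) + (l / 2) * (cmod (h (u n + y)))\<^sup>2 + (1 + 1 / (2 * l)) * T M y"
          by simp
        finally show ?thesis unfolding e .
      qed
    qed
    have "autocorr h (u n) - autocorr h 0 = (\<integral>y. h (u n + y) * cnj (h y) - h (0 + y) * cnj (h y) \<partial>lborel)"
      unfolding autocorr_def by (rule Bochner_Integration.integral_diff[symmetric]) (rule autocorr_integrand)+
    also have "cmod \<dots> \<le> (\<integral>y. cmod (h (u n + y) * cnj (h y) - h (0 + y) * cnj (h y)) \<partial>lborel)"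
      by (rule integral_norm_bound)
    also have "\<dots> \<le> (\<integral>y. real M * cmod (h (u n + y) - h y) + (l / 2) * (cmod (h (u n + y)))\<^sup>2 + (1 + 1 / (2 * l)) * T M y \<partial>lborel)"
      by (intro integral_mono integrable_norm gi bi le)
    also have "\<dots> = real M * (\<integral>y. cmod (h (u n + y) - h y) \<partial>lborel) + (l / 2) * (\<integral>y. (cmod (h (u n + y)))\<^sup>2 \<partial>lborel) + (1 + 1 / (2 * l)) * (\<integral>y. T M y \<partial>lborel)"
      using di ti Ti by simp
    also have "(\<integral>y. (cmod (h (u n + y)))\<^sup>2 \<partial>lborel) = S"
      unfolding S_def by (rule lborel_integral_translation[of "\<lambda>y. (cmod (h y))\<^sup>2"]) measurable
    also have "real M * (\<integral>y. cmod (h (u n + y) - h y) \<partial>lborel) + (l / 2) * S + (1 + 1 / (2 * l)) * (\<integral>y. T M y \<partial>lborel) < e / 4 + e / 4 + e / 2"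
      using N[OF n] M l(2) by (intro add_less_le_mono add_strict_mono) auto
    finally show ?thesis by simp
  qed
  then show "\<exists>N. \<forall>n\<ge>N. norm (autocorr h (u n) - autocorr h 0) < e" by blast
qed

text \<open>The multiplication formula moves the transform from the autocorrelation to the Gaussian, which is explicit.\<close>

lemma gaussian_energy:
  assumes \<epsilon>: "\<epsilon> > 0"
  shows "of_real (\<integral>\<xi>. (cmod (fourier_L1 h \<xi>))\<^sup>2 * exp (- (norm (\<epsilon> *\<^sub>R \<xi>))\<^sup>2 / 2) \<partial>lborel)
    = of_real ((1 / (2 * pi) ^ DIM('a))\<^sup>2 * sqrt (2 * pi) ^ DIM('a)) * (\<integral>z. autocorr h (\<epsilon> *\<^sub>R z) * of_real (exp (- (norm z)\<^sup>2 / 2)) \<partial>lborel)"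
proof -
  define C where "C = complex_of_real (1 / (2 * pi) ^ DIM('a))"
  define g where "g = (\<lambda>\<xi>::'a. complex_of_real (exp (- (norm (\<epsilon> *\<^sub>R \<xi>))\<^sup>2 / 2)))"
  have gm[measurable]: "g \<in> borel_measurable borel" unfolding g_def by measurable
  have Am[measurable]: "autocorr h \<in> borel_measurable borel" using borel_measurable_integrable[OF autocorr_integrable] by simp
  have g1: "integrable lborel (\<lambda>x::'a. complex_of_real (exp (- (norm x)\<^sup>2 / 2)))"
    using gaussian_fourier(1)[of "0::'a"] by simp
  have gi: "integrable lborel g"
    unfolding g_def using lborel_integrable_affine[OF g1, of \<epsilon> 0] \<epsilon> by simp
  have scale: "\<bar>\<epsilon>\<bar> ^ DIM('a) *\<^sub>R fourier_L1 g (\<epsilon> *\<^sub>R z) = C * of_real (sqrt (2 * pi) ^ DIM('a) * exp (- (norm z)\<^sup>2 / 2))" for z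
  proof -
    have "\<bar>\<epsilon>\<bar> ^ DIM('a) *\<^sub>R (\<integral>\<xi>. exp (\<i> * of_real ((\<epsilon> *\<^sub>R z) \<bullet> \<xi>)) * g \<xi> \<partial>lborel)
       = (\<integral>\<xi>. exp (\<i> * of_real (z \<bullet> \<xi>)) * complex_of_real (exp (- (norm \<xi>)\<^sup>2 / 2)) \<partial>lborel)"
      using lborel_integral_affine[of "\<lambda>\<xi>. exp (\<i> * of_real (z \<bullet> \<xi>)) * complex_of_real (exp (- (norm \<xi>)\<^sup>2 / 2))" \<epsilon> 0] \<epsilon>
      by (simp add: g_def)
    then have "C * (\<bar>\<epsilon>\<bar> ^ DIM('a) *\<^sub>R (\<integral>\<xi>. exp (\<i> * of_real ((\<epsilon> *\<^sub>R z) \<bullet> \<xi>)) * g \<xi> \<partial>lborel)) = C * of_real (sqrt (2 * pi) ^ DIM('a) * exp (- (norm z)\<^sup>2 / 2))"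
      unfolding gaussian_fourier(2) by (rule arg_cong)
    then show ?thesis unfolding fourier_L1_lborel[OF gm] C_def by (simp only: mult_scaleR_right)
  qed
  have Fgm[measurable]: "fourier_L1 g \<in> borel_measurable borel" by (rule fourier_L1_measurable[OF gi])
  have "of_real (\<integral>\<xi>. (cmod (fourier_L1 h \<xi>))\<^sup>2 * exp (- (norm (\<epsilon> *\<^sub>R \<xi>))\<^sup>2 / 2) \<partial>lborel)
     = (\<integral>\<xi>. of_real ((cmod (fourier_L1 h \<xi>))\<^sup>2) * g \<xi> \<partial>lborel)"
    unfolding g_def by (simp only: of_real_mult[symmetric] integral_complex_of_real)
  also have "\<dots> = (\<integral>\<xi>. C * (fourier_L1 (autocorr h) \<xi> * g \<xi>) \<partial>lborel)"
    unfolding fourier_autocorr C_def by (simp only: mult.assoc)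
  also have "\<dots> = C * (\<integral>u. autocorr h u * fourier_L1 g u \<partial>lborel)"
    unfolding integral_mult_right_zero fourier_L1_multiplication_formula[OF autocorr_integrable gi] ..
  also have "(\<integral>u. autocorr h u * fourier_L1 g u \<partial>lborel) = \<bar>\<epsilon>\<bar> ^ DIM('a) *\<^sub>R (\<integral>z. autocorr h (\<epsilon> *\<^sub>R z) * fourier_L1 g (\<epsilon> *\<^sub>R z) \<partial>lborel)"
    using lborel_integral_affine[of "\<lambda>u. autocorr h u * fourier_L1 g u" \<epsilon> 0] \<epsilon> by simp
  also have "\<dots> = (\<integral>z. autocorr h (\<epsilon> *\<^sub>R z) * (\<bar>\<epsilon>\<bar> ^ DIM('a) *\<^sub>R fourier_L1 g (\<epsilon> *\<^sub>R z)) \<partial>lborel)"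
    by (simp only: mult_scaleR_right integral_scaleR_right)
  also have "\<dots> = (\<integral>z. C * of_real (sqrt (2 * pi) ^ DIM('a)) * (autocorr h (\<epsilon> *\<^sub>R z) * of_real (exp (- (norm z)\<^sup>2 / 2))) \<partial>lborel)"
    unfolding scale by (simp only: of_real_mult mult_ac)
  finally show ?thesis
    unfolding integral_mult_right_zero C_def by (simp add: power2_eq_square)
qed

text \<open>As \<open>\<epsilon>\<close> tends to \<open>0\<close>, the regularised energy increases to the left-hand side by monotone convergence, and the
  right-hand side of \<open>gaussian_energy\<close> tends to a multiple of \<open>autocorr h 0\<close>, the integral of \<open>\<bar>h\<bar>\<^sup>2\<close>.\<close>

theorem plancherel_L1_L2:
  shows "integrable lborel (\<lambda>\<xi>. (cmod (fourier_L1 h \<xi>))\<^sup>2)"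
    and "(\<integral>\<xi>. (cmod (fourier_L1 h \<xi>))\<^sup>2 \<partial>lborel) = (1 / (2 * pi) ^ DIM('a)) * (\<integral>x. (cmod (h x))\<^sup>2 \<partial>lborel)"
proof -
  define c where "c = (2 * pi) ^ DIM('a)"
  define S where "S = (\<integral>x. (cmod (h x))\<^sup>2 \<partial>lborel)"
  define \<epsilon> where "\<epsilon> = (\<lambda>n. 1 / real (Suc n))"
  have \<epsilon>0: "\<epsilon> n > 0" for n by (simp add: \<epsilon>_def)
  have \<epsilon>l: "\<epsilon> \<longlonglongrightarrow> 0" unfolding \<epsilon>_def using LIMSEQ_inverse_real_of_nat by (simp add: inverse_eq_divide)
  have c: "sqrt (2 * pi) ^ DIM('a) * sqrt (2 * pi) ^ DIM('a) = c" "c > 0"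
    unfolding c_def power_mult_distrib[symmetric] by simp_all
  have Fm[measurable]: "fourier_L1 h \<in> borel_measurable borel" by (rule fourier_L1_measurable[OF h1])
  have Am[measurable]: "autocorr h \<in> borel_measurable borel" using borel_measurable_integrable[OF autocorr_integrable] by simp
  have g1: "integrable lborel (\<lambda>x::'a. complex_of_real (exp (- (norm x)\<^sup>2 / 2)))"
    and gI: "(\<integral>x. complex_of_real (exp (- (norm x)\<^sup>2 / 2)) \<partial>(lborel :: 'a measure)) = of_real (sqrt (2 * pi) ^ DIM('a))"
    using gaussian_fourier[of "0::'a"] by simp_all
  define E where "E = (\<lambda>n \<xi>. (cmod (fourier_L1 h \<xi>))\<^sup>2 * exp (- (norm (\<epsilon> n *\<^sub>R \<xi>))\<^sup>2 / 2))"
  have [measurable]: "E n \<in> borel_measurable borel" for n unfolding E_def by measurable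
  have "(\<lambda>n. \<integral>z. autocorr h (\<epsilon> n *\<^sub>R z) * of_real (exp (- (norm z)\<^sup>2 / 2)) \<partial>lborel)
      \<longlonglongrightarrow> (\<integral>z. autocorr h 0 * of_real (exp (- (norm z)\<^sup>2 / 2)) \<partial>(lborel :: 'a measure))"
  proof (rule integral_dominated_convergence[where w="\<lambda>z. S * exp (- (norm z)\<^sup>2 / 2)"])
    show "AE z in lborel. (\<lambda>n. autocorr h (\<epsilon> n *\<^sub>R z) * of_real (exp (- (norm z)\<^sup>2 / 2))) \<longlonglongrightarrow> autocorr h 0 * of_real (exp (- (norm z)\<^sup>2 / 2))"
    proof (rule AE_I2)
      fix z :: 'a
      have "(\<lambda>n. \<epsilon> n *\<^sub>R z) \<longlonglongrightarrow> 0 *\<^sub>R z" by (rule tendsto_scaleR[OF \<epsilon>l tendsto_const])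
      then show "(\<lambda>n. autocorr h (\<epsilon> n *\<^sub>R z) * of_real (exp (- (norm z)\<^sup>2 / 2))) \<longlonglongrightarrow> autocorr h 0 * of_real (exp (- (norm z)\<^sup>2 / 2))"
        by (intro tendsto_intros autocorr_continuous_0) simp
    qed
    show "AE z in lborel. cmod (autocorr h (\<epsilon> n *\<^sub>R z) * of_real (exp (- (norm z)\<^sup>2 / 2))) \<le> S * exp (- (norm z)\<^sup>2 / 2)" for n
      using autocorr_integrand(2) by (intro AE_I2) (simp add: norm_mult S_def mult_right_mono)
    have "integrable lborel (\<lambda>x::'a. cmod (complex_of_real (exp (- (norm x)\<^sup>2 / 2))))"
      by (rule integrable_norm[OF g1])
    then show "integrable lborel (\<lambda>z::'a. S * exp (- (norm z)\<^sup>2 / 2))" by (simp only: norm_of_real abs_exp_cancel integrable_mult_right)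
  qed measurable
  then have "(\<lambda>n. of_real ((1 / c)\<^sup>2 * sqrt (2 * pi) ^ DIM('a)) * (\<integral>z. autocorr h (\<epsilon> n *\<^sub>R z) * of_real (exp (- (norm z)\<^sup>2 / 2)) \<partial>lborel))
      \<longlonglongrightarrow> of_real ((1 / c)\<^sup>2 * sqrt (2 * pi) ^ DIM('a)) * (autocorr h 0 * of_real (sqrt (2 * pi) ^ DIM('a)))"
    unfolding integral_mult_right_zero gI by (rule tendsto_mult_left)
  also have "(\<lambda>n. of_real ((1 / c)\<^sup>2 * sqrt (2 * pi) ^ DIM('a)) * (\<integral>z. autocorr h (\<epsilon> n *\<^sub>R z) * of_real (exp (- (norm z)\<^sup>2 / 2)) \<partial>lborel))
     = (\<lambda>n. complex_of_real (\<integral>\<xi>. E n \<xi> \<partial>lborel))"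
    unfolding E_def gaussian_energy[OF \<epsilon>0] c_def ..
  also have "of_real ((1 / c)\<^sup>2 * sqrt (2 * pi) ^ DIM('a)) * (autocorr h 0 * of_real (sqrt (2 * pi) ^ DIM('a))) = complex_of_real ((1 / c)\<^sup>2 * (sqrt (2 * pi) ^ DIM('a) * sqrt (2 * pi) ^ DIM('a)) * S)"
    unfolding autocorr_0 S_def by (simp only: of_real_mult mult_ac)
  also have "(1 / c)\<^sup>2 * (sqrt (2 * pi) ^ DIM('a) * sqrt (2 * pi) ^ DIM('a)) * S = (1 / c) * S"
    unfolding c(1) using c(2) by (simp add: power2_eq_square)
  finally have lim: "(\<lambda>n. \<integral>\<xi>. E n \<xi> \<partial>lborel) \<longlonglongrightarrow> (1 / c) * S"
    by (simp only: tendsto_of_real_iff)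
  have Ei: "integrable lborel (E n)" for n
  proof -
    define B where "B = (1 / (2 * pi) ^ DIM('a)) * (\<integral>x. cmod (h x) \<partial>lborel)"
    have "integrable lborel (\<lambda>\<xi>. cmod (complex_of_real (exp (- (norm (0 + \<epsilon> n *\<^sub>R \<xi>::'a))\<^sup>2 / 2))))"
      by (intro integrable_norm lborel_integrable_affine[OF g1]) (use \<epsilon>0[of n] in simp)
    then have i: "integrable lborel (\<lambda>\<xi>::'a. B\<^sup>2 * exp (- (norm (\<epsilon> n *\<^sub>R \<xi>))\<^sup>2 / 2))"
      by (simp only: norm_of_real abs_exp_cancel integrable_mult_right add_0)
    show ?thesis
    proof (rule Bochner_Integration.integrable_bound[OF i])
      show "AE \<xi> in lborel. norm (E n \<xi>) \<le> norm (B\<^sup>2 * exp (- (norm (\<epsilon> n *\<^sub>R \<xi>))\<^sup>2 / 2))"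
        unfolding E_def B_def using norm_fourier_L1_le[OF h1] by (intro AE_I2) (simp add: abs_mult power_mono mult_right_mono)
    qed measurable
  qed
  have mono: "incseq (\<lambda>n. E n \<xi>)" for \<xi> :: 'a
  proof (rule incseq_SucI)
    fix n
    have "norm (\<epsilon> (Suc n) *\<^sub>R \<xi>) \<le> norm (\<epsilon> n *\<^sub>R \<xi>)"
      by (auto simp: \<epsilon>_def field_simps intro!: mult_right_mono)
    then show "E n \<xi> \<le> E (Suc n) \<xi>"
      unfolding E_def by (intro mult_left_mono) (auto intro!: divide_right_mono power_mono)
  qed
  have ptw: "(\<lambda>n. E n \<xi>) \<longlonglongrightarrow> (cmod (fourier_L1 h \<xi>))\<^sup>2" for \<xi> :: 'a
  proof -
    have "(\<lambda>n. (cmod (fourier_L1 h \<xi>))\<^sup>2 * exp (- (norm (\<epsilon> n *\<^sub>R \<xi>))\<^sup>2 / 2)) \<longlonglongrightarrow> (cmod (fourier_L1 h \<xi>))\<^sup>2 * exp (- (norm (0 *\<^sub>R \<xi>))\<^sup>2 / 2)"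
      by (intro tendsto_mult tendsto_exp tendsto_divide tendsto_minus tendsto_power tendsto_norm tendsto_const
           tendsto_scaleR[OF \<epsilon>l]) simp
    then show ?thesis by (simp add: E_def)
  qed
  show "integrable lborel (\<lambda>\<xi>. (cmod (fourier_L1 h \<xi>))\<^sup>2)"
    by (rule integral_monotone_convergence_nonneg(1)[where f=E and x="(1/c) * S"])
       (use Ei lim mono ptw in \<open>auto simp: E_def\<close>)
  show "(\<integral>\<xi>. (cmod (fourier_L1 h \<xi>))\<^sup>2 \<partial>lborel) = (1 / (2 * pi) ^ DIM('a)) * (\<integral>x. (cmod (h x))\<^sup>2 \<partial>lborel)"
    unfolding c_def[symmetric] S_def[symmetric]
    by (rule integral_monotone_convergence_nonneg(2)[where f=E])
       (use Ei lim mono ptw in \<open>auto simp: E_def\<close>)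
qed

end

section \<open>Completeness of the space of square-integrable functions\<close>

lemma L2_measurable: "f \<in> L2 \<Longrightarrow> f \<in> borel_measurable lebesgue"
  by (simp add: L2_def)

lemma L2_integrable: "f \<in> L2 \<Longrightarrow> integrable lebesgue (\<lambda>x. (cmod (f x))\<^sup>2)"
  by (simp add: L2_def)

lemma L2_norm_nonneg: "L2_norm f \<ge> 0"
  by (simp add: L2_norm_def)

lemma L2_norm_power2: "(L2_norm f)\<^sup>2 = (\<integral>x. (cmod (f x))\<^sup>2 \<partial>lebesgue)"
  by (simp add: L2_norm_def)

lemma cmod_add_power2_le:
  assumes "t > 0"
  shows "(cmod (a + b))\<^sup>2 \<le> (1 + t) * (cmod a)\<^sup>2 + (1 + 1/t) * (cmod b)\<^sup>2"
proof -
  have "(cmod (a + b))\<^sup>2 \<le> (cmod a + cmod b)\<^sup>2"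
    by (intro power_mono norm_triangle_ineq) simp
  also have "\<dots> = (cmod a)\<^sup>2 + (cmod b)\<^sup>2 + 2 * (cmod a * cmod b)"
    by (simp add: power2_eq_square algebra_simps)
  also have "2 * (cmod a * cmod b) \<le> t * (cmod a)\<^sup>2 + (cmod b)\<^sup>2 / t"
    using weighted_am_gm[OF assms, of "cmod a" "cmod b"] by simp
  finally show ?thesis by (simp add: algebra_simps)
qed

lemma L2_add:
  assumes f: "f \<in> L2" and g: "g \<in> L2"
  shows "(\<lambda>x. f x + g x) \<in> L2"
proof -
  note [measurable] = L2_measurable[OF f] L2_measurable[OF g]
  have i: "integrable lebesgue (\<lambda>x. (1 + 1) * (cmod (f x))\<^sup>2 + (1 + 1/1) * (cmod (g x))\<^sup>2)"
    using L2_integrable[OF f] L2_integrable[OF g] by simp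
  have "integrable lebesgue (\<lambda>x. (cmod (f x + g x))\<^sup>2)"
    by (rule Bochner_Integration.integrable_bound[OF i])
       (use cmod_add_power2_le[of 1] in \<open>auto intro!: AE_I2\<close>)
  then show ?thesis by (simp add: L2_def)
qed

lemma L2_cmult:
  assumes f: "f \<in> L2"
  shows "(\<lambda>x. c * f x) \<in> L2"
  using f by (auto simp: L2_def norm_mult power_mult_distrib)

lemma L2_uminus: "f \<in> L2 \<Longrightarrow> (\<lambda>x. - f x) \<in> L2"
  by (simp add: L2_def)

lemma L2_diff: "f \<in> L2 \<Longrightarrow> g \<in> L2 \<Longrightarrow> (\<lambda>x. f x - g x) \<in> L2"
  using L2_add[OF _ L2_uminus, of f g] by simp

lemma L2_norm_minus_commute: "L2_norm (\<lambda>x. f x - g x) = L2_norm (\<lambda>x. g x - f x)"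
  by (simp add: L2_norm_def norm_minus_commute)

text \<open>Minkowski's inequality: the optimal weight in \<open>cmod_add_power2_le\<close> is the quotient of the two norms.  The
  norms are increased by \<open>e / 2\<close> to avoid a division by zero.\<close>

lemma L2_norm_triangle:
  assumes f: "f \<in> L2" and g: "g \<in> L2"
  shows "L2_norm (\<lambda>x. f x + g x) \<le> L2_norm f + L2_norm g"
proof (rule field_le_epsilon)
  fix e :: real assume e: "e > 0"
  define a where "a = L2_norm f + e / 2"
  define b where "b = L2_norm g + e / 2"
  have a: "a > 0" "L2_norm f \<le> a" and b: "b > 0" "L2_norm g \<le> b"
    using e L2_norm_nonneg[of f] L2_norm_nonneg[of g] by (auto simp: a_def b_def)
  have i: "integrable lebesgue (\<lambda>x. (1 + b/a) * (cmod (f x))\<^sup>2 + (1 + 1/(b/a)) * (cmod (g x))\<^sup>2)"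
    using L2_integrable[OF f] L2_integrable[OF g] by simp
  have "(L2_norm (\<lambda>x. f x + g x))\<^sup>2 \<le> (\<integral>x. (1 + b/a) * (cmod (f x))\<^sup>2 + (1 + 1/(b/a)) * (cmod (g x))\<^sup>2 \<partial>lebesgue)"
    unfolding L2_norm_power2 using a b
    by (intro integral_mono L2_integrable[OF L2_add[OF f g]] i cmod_add_power2_le) simp
  also have "\<dots> = (1 + b/a) * (L2_norm f)\<^sup>2 + (1 + a/b) * (L2_norm g)\<^sup>2"
    using L2_integrable[OF f] L2_integrable[OF g] by (simp add: L2_norm_power2)
  also have "\<dots> \<le> (1 + b/a) * a\<^sup>2 + (1 + a/b) * b\<^sup>2"
    using a b L2_norm_nonneg[of f] L2_norm_nonneg[of g]
    by (intro add_mono mult_left_mono power_mono) auto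
  also have "\<dots> = (a + b)\<^sup>2"
    using a b by (simp add: power2_eq_square field_simps)
  finally have "L2_norm (\<lambda>x. f x + g x) \<le> a + b"
    by (rule power2_le_imp_le) (use a b in simp)
  then show "L2_norm (\<lambda>x. f x + g x) \<le> L2_norm f + L2_norm g + e"
    by (simp add: a_def b_def)
qed

lemma L2_norm_triangle_diff:
  assumes "f \<in> L2" "g \<in> L2" "h \<in> L2"
  shows "L2_norm (\<lambda>x. f x - h x) \<le> L2_norm (\<lambda>x. f x - g x) + L2_norm (\<lambda>x. g x - h x)"
  using L2_norm_triangle[OF L2_diff[OF assms(1,2)] L2_diff[OF assms(2,3)]] by simp

lemma L2_norm_diff_ge:
  assumes "f \<in> L2" "g \<in> L2"
  shows "\<bar>L2_norm f - L2_norm g\<bar> \<le> L2_norm (\<lambda>x. f x - g x)"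
  using L2_norm_triangle[OF L2_diff[OF assms] assms(2)]
    L2_norm_triangle[OF L2_diff[OF assms(2,1)] assms(1)]
  unfolding L2_norm_minus_commute[of g f] by simp

lemma L2_norm_tendsto:
  assumes "L2_tendsto f g"
  shows "(\<lambda>n. L2_norm (f n)) \<longlonglongrightarrow> L2_norm g"
proof -
  have "(\<lambda>n. L2_norm (\<lambda>x. f n x - g x)) \<longlonglongrightarrow> 0" using assms by (simp add: L2_tendsto_def)
  then have "(\<lambda>n. L2_norm (f n) - L2_norm g) \<longlonglongrightarrow> 0"
    by (rule Lim_null_comparison[rotated])
       (use assms in \<open>auto simp: L2_tendsto_def intro!: always_eventually L2_norm_diff_ge\<close>)
  then show ?thesis by (rule LIM_zero_cancel)
qed

lemma L2_norm_0_imp_AE: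
  assumes f: "f \<in> L2" "L2_norm f = 0"
  shows "AE x in lborel. f x = 0"
proof -
  have "AE x in lebesgue. (cmod (f x))\<^sup>2 = 0"
    using integral_nonneg_eq_0_iff_AE[OF L2_integrable[OF f(1)]] f(2) L2_norm_power2[of f] by simp
  then show ?thesis unfolding AE_lebesgue_iff by simp
qed

lemma L2_cong_AE:
  assumes g: "g \<in> L2" and ae: "AE x in lborel. f x = g x"
  shows "f \<in> L2" "L2_norm f = L2_norm g"
proof -
  note [measurable] = L2_measurable[OF g] borel_measurable_lebesgue_AE[OF L2_measurable[OF g] ae]
  have ae': "AE x in lebesgue. (cmod (f x))\<^sup>2 = (cmod (g x))\<^sup>2"
    unfolding AE_lebesgue_iff using ae by eventually_elim simp
  have "integrable lebesgue (\<lambda>x. (cmod (f x))\<^sup>2) \<longleftrightarrow> integrable lebesgue (\<lambda>x. (cmod (g x))\<^sup>2)"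
    by (rule integrable_cong_AE) (use ae' in measurable)
  then show "f \<in> L2" using L2_integrable[OF g] by (simp add: L2_def)
  have "(\<integral>x. (cmod (f x))\<^sup>2 \<partial>lebesgue) = (\<integral>x. (cmod (g x))\<^sup>2 \<partial>lebesgue)"
    by (rule integral_cong_AE) (use ae' in measurable)
  then show "L2_norm f = L2_norm g" by (simp add: L2_norm_def)
qed

lemma L2_tendsto_unique:
  assumes f: "L2_tendsto f g" "L2_tendsto f h"
  shows "AE x in lborel. g x = h x"
proof -
  have L: "f n \<in> L2" "g \<in> L2" "h \<in> L2" for n using f by (auto simp: L2_tendsto_def)
  have "(\<lambda>n. L2_norm (\<lambda>x. f n x - g x) + L2_norm (\<lambda>x. f n x - h x)) \<longlonglongrightarrow> 0 + 0"
    using f by (intro tendsto_add) (auto simp: L2_tendsto_def)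
  moreover have "L2_norm (\<lambda>x. g x - h x) \<le> L2_norm (\<lambda>x. f n x - g x) + L2_norm (\<lambda>x. f n x - h x)" for n
    using L2_norm_triangle_diff[OF L(2,1,3), of n] L2_norm_minus_commute[of g "f n"] by simp
  ultimately have "L2_norm (\<lambda>x. g x - h x) \<le> 0 + 0"
    by (intro LIMSEQ_le_const[of _ _ "L2_norm (\<lambda>x. g x - h x)"]) auto
  then have "L2_norm (\<lambda>x. g x - h x) = 0" using L2_norm_nonneg[of "\<lambda>x. g x - h x"] by simp
  from L2_norm_0_imp_AE[OF L2_diff[OF L(2,3)] this] show ?thesis by eventually_elim simp
qed

text \<open>Together with the next lemma this expresses norms by nonnegative integrals, to which Fatou's lemma applies.\<close>

lemma L2_nn_integral:
  assumes "f \<in> L2"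
  shows "(\<integral>\<^sup>+x. ennreal ((cmod (f x))\<^sup>2) \<partial>lebesgue) = ennreal ((L2_norm f)\<^sup>2)"
  unfolding L2_norm_power2 by (rule nn_integral_eq_integral[OF L2_integrable[OF assms]]) simp

lemma L2_I_nn_integral:
  assumes f: "f \<in> borel_measurable lebesgue" and e: "e \<ge> 0"
    and le: "(\<integral>\<^sup>+x. ennreal ((cmod (f x))\<^sup>2) \<partial>lebesgue) \<le> ennreal (e\<^sup>2)"
  shows "f \<in> L2" "L2_norm f \<le> e"
proof -
  note [measurable] = f
  have "integrable lebesgue (\<lambda>x. (cmod (f x))\<^sup>2)"
    by (rule integrableI_bounded) (use le in \<open>auto intro: le_less_trans\<close>)
  then show L: "f \<in> L2" using f by (simp add: L2_def)
  have "(L2_norm f)\<^sup>2 \<le> e\<^sup>2" using le unfolding L2_nn_integral[OF L] by simp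
  then show "L2_norm f \<le> e" using e by (rule power2_le_imp_le)
qed

text \<open>The increments decay geometrically.\<close>

lemma convergent_of_weighted_increments:
  fixes a :: "nat \<Rightarrow> complex"
  assumes "(\<Sum>k. ennreal (2 ^ k * (cmod (a (Suc k) - a k))\<^sup>2)) \<noteq> \<infinity>"
  shows "convergent a"
proof -
  define S where "S = (\<Sum>k. ennreal (2 ^ k * (cmod (a (Suc k) - a k))\<^sup>2))"
  have "S \<noteq> \<infinity>" unfolding S_def by (rule assms)
  then obtain C where C: "C \<ge> 0" "S = ennreal C"
    by (cases S) auto
  have le: "cmod (a (Suc k) - a k) \<le> sqrt C * (1 / sqrt 2) ^ k" for k
  proof -
    have "(\<Sum>k\<in>{k}. ennreal (2 ^ k * (cmod (a (Suc k) - a k))\<^sup>2)) \<le> S"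
      unfolding S_def by (rule sum_le_suminf[OF summableI]) auto
    then have "ennreal (2 ^ k * (cmod (a (Suc k) - a k))\<^sup>2) \<le> ennreal C"
      by (simp add: C(2))
    then have "2 ^ k * (cmod (a (Suc k) - a k))\<^sup>2 \<le> C" using C(1) by (simp only: ennreal_le_iff)
    then have "(cmod (a (Suc k) - a k))\<^sup>2 \<le> C / 2 ^ k" by (simp add: field_simps)
    then have "cmod (a (Suc k) - a k) \<le> sqrt (C / 2 ^ k)" by (rule real_le_rsqrt)
    then show ?thesis by (simp add: real_sqrt_divide real_sqrt_power power_divide)
  qed
  have "summable (\<lambda>k. sqrt C * (1 / sqrt 2) ^ k)"
    by (intro summable_mult summable_geometric) simp
  then have "summable (\<lambda>k. a (Suc k) - a k)"
    by (rule summable_comparison_test'[where N=0]) (rule le)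
  then have "(\<lambda>n. a 0 + (\<Sum>k<n. a (Suc k) - a k)) \<longlonglongrightarrow> a 0 + (\<Sum>k. a (Suc k) - a k)"
    by (intro tendsto_intros summable_LIMSEQ)
  then show ?thesis unfolding convergent_def sum_lessThan_telescope by auto
qed

text \<open>For a subsequence with increments of norm at most \<open>2^(-k)\<close>, the squared increments weighted with \<open>2^k\<close> have an
  integrable sum, so that the subsequence converges almost everywhere.  Fatou's lemma shows that its limit is
  also the limit in norm.\<close>

lemma L2_complete:
  fixes f :: "nat \<Rightarrow> 'a::euclidean_space \<Rightarrow> complex"
  assumes f: "\<And>n. f n \<in> L2"
    and cauchy: "\<And>e. e > 0 \<Longrightarrow> \<exists>N. \<forall>m\<ge>N. \<forall>n\<ge>N. L2_norm (\<lambda>x. f m x - f n x) < e"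
  shows "\<exists>g. L2_tendsto f g"
proof -
  note fm[measurable] = L2_measurable[OF f]
  obtain N where N: "\<And>k m n. m \<ge> N k \<Longrightarrow> n \<ge> N k \<Longrightarrow> L2_norm (\<lambda>x. f m x - f n x) < (1/2) ^ k"
    using cauchy[of "(1/2) ^ k" for k] by (metis zero_less_divide_1_iff zero_less_numeral zero_less_power)
  define r where "r = (\<lambda>k. \<Sum>i\<le>k. N i)"
  have rN: "N k \<le> r k" for k unfolding r_def by (rule member_le_sum) auto
  have rS: "r k \<le> r (Suc k)" for k unfolding r_def by simp
  have r_mono: "r k \<le> r j" if "k \<le> j" for k j using lift_Suc_mono_le[of r, OF rS that] .
  have "(\<integral>\<^sup>+x. (\<Sum>k. ennreal (2 ^ k * (cmod (f (r (Suc k)) x - f (r k) x))\<^sup>2)) \<partial>lebesgue)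
      = (\<Sum>k. \<integral>\<^sup>+x. ennreal (2 ^ k * (cmod (f (r (Suc k)) x - f (r k) x))\<^sup>2) \<partial>lebesgue)"
    by (rule nn_integral_suminf) measurable
  also have "\<dots> \<le> (\<Sum>k. ennreal ((1/2) ^ k))"
  proof (rule suminf_le)
    fix k
    have "(\<integral>\<^sup>+x. ennreal (2 ^ k * (cmod (f (r (Suc k)) x - f (r k) x))\<^sup>2) \<partial>lebesgue)
       = ennreal (2 ^ k) * ennreal ((L2_norm (\<lambda>x. f (r (Suc k)) x - f (r k) x))\<^sup>2)"
      unfolding L2_nn_integral[OF L2_diff[OF f f], symmetric]
      by (subst nn_integral_cmult[symmetric]) (auto simp: ennreal_mult)
    also have "\<dots> \<le> ennreal (2 ^ k) * ennreal (((1/2) ^ k)\<^sup>2)"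
      using N[of k "r (Suc k)" "r k"] rN[of k] rS[of k] L2_norm_nonneg
      by (intro mult_left_mono ennreal_leI power_mono) auto
    also have "\<dots> = ennreal ((1/2) ^ k)"
      by (simp add: ennreal_mult[symmetric] power2_eq_square power_divide)
    finally show "(\<integral>\<^sup>+x. ennreal (2 ^ k * (cmod (f (r (Suc k)) x - f (r k) x))\<^sup>2) \<partial>lebesgue) \<le> ennreal ((1/2) ^ k)" .
  qed auto
  also have "\<dots> = ennreal (\<Sum>k. (1/2) ^ k)"
    by (rule suminf_ennreal2) (auto intro!: summable_geometric)
  also have "\<dots> < \<infinity>" by simp
  finally have "(\<integral>\<^sup>+x. (\<Sum>k. ennreal (2 ^ k * (cmod (f (r (Suc k)) x - f (r k) x))\<^sup>2)) \<partial>lebesgue) \<noteq> \<infinity>"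
    by (rule less_imp_neq)
  then have "AE x in lebesgue. (\<Sum>k. ennreal (2 ^ k * (cmod (f (r (Suc k)) x - f (r k) x))\<^sup>2)) \<noteq> \<infinity>"
    by (rule nn_integral_PInf_AE[rotated]) measurable
  then have conv: "AE x in lebesgue. convergent (\<lambda>k. f (r k) x)"
    by eventually_elim (rule convergent_of_weighted_increments)
  define g where "g = (\<lambda>x. lim (\<lambda>k. f (r k) x))"
  have gm[measurable]: "g \<in> borel_measurable lebesgue"
    unfolding g_def by (rule borel_measurable_lim_metric) measurable
  have lim: "AE x in lebesgue. (\<lambda>k. f (r k) x) \<longlonglongrightarrow> g x"
    using conv by eventually_elim (simp add: g_def convergent_LIMSEQ_iff)
  have dist: "(\<lambda>x. f m x - g x) \<in> L2 \<and> L2_norm (\<lambda>x. f m x - g x) \<le> (1/2) ^ k" if m: "m \<ge> N k" for m k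
  proof -
    have "(\<integral>\<^sup>+x. ennreal ((cmod (f m x - g x))\<^sup>2) \<partial>lebesgue)
       \<le> (\<integral>\<^sup>+x. liminf (\<lambda>j. ennreal ((cmod (f m x - f (r j) x))\<^sup>2)) \<partial>lebesgue)"
    proof (rule nn_integral_mono_AE)
      show "AE x in lebesgue. ennreal ((cmod (f m x - g x))\<^sup>2) \<le> liminf (\<lambda>j. ennreal ((cmod (f m x - f (r j) x))\<^sup>2))"
        using lim
      proof eventually_elim
        case (elim x)
        then have "(\<lambda>j. ennreal ((cmod (f m x - f (r j) x))\<^sup>2)) \<longlonglongrightarrow> ennreal ((cmod (f m x - g x))\<^sup>2)"
          by (intro tendsto_ennrealI tendsto_intros)
        from lim_imp_Liminf[OF trivial_limit_sequentially this] show ?case by (simp only: order_refl)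
      qed
    qed
    also have "\<dots> \<le> liminf (\<lambda>j. \<integral>\<^sup>+x. ennreal ((cmod (f m x - f (r j) x))\<^sup>2) \<partial>lebesgue)"
      by (rule nn_integral_liminf) measurable
    also have "\<dots> \<le> ennreal (((1/2) ^ k)\<^sup>2)"
    proof (rule Liminf_le)
      show "eventually (\<lambda>j. (\<integral>\<^sup>+x. ennreal ((cmod (f m x - f (r j) x))\<^sup>2) \<partial>lebesgue) \<le> ennreal (((1/2) ^ k)\<^sup>2)) sequentially"
        unfolding L2_nn_integral[OF L2_diff[OF f f]] eventually_sequentially
      proof (intro exI[of _ k] allI impI ennreal_leI power_mono L2_norm_nonneg)
        fix j assume "j \<ge> k"
        then show "L2_norm (\<lambda>x. f m x - f (r j) x) \<le> (1/2) ^ k"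
          using N[OF m, of "r j"] rN[of k] r_mono[of k j] by simp
      qed
    qed simp
    finally show ?thesis using L2_I_nn_integral[of "\<lambda>x. f m x - g x" "(1/2) ^ k"] by simp
  qed
  have gL: "g \<in> L2"
    using L2_diff[OF f[of "N 0"] conjunct1[OF dist[of 0 "N 0"]]] by simp
  have "(\<lambda>n. L2_norm (\<lambda>x. f n x - g x)) \<longlonglongrightarrow> 0"
  proof (rule LIMSEQ_I)
    fix e :: real assume "e > 0"
    then obtain k where k: "(1/2::real) ^ k < e" using real_arch_pow_inv[of e "1/2"] by auto
    have "norm (L2_norm (\<lambda>x. f n x - g x) - 0) < e" if "n \<ge> N k" for n
      using dist[OF that] k L2_norm_nonneg[of "\<lambda>x. f n x - g x"] by simp
    then show "\<exists>no. \<forall>n\<ge>no. norm (L2_norm (\<lambda>x. f n x - g x) - 0) < e" by blast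
  qed
  then show ?thesis using f gL unfolding L2_tendsto_def by blast
qed

lemma L2_truncation:
  fixes u :: "'a::euclidean_space \<Rightarrow> complex"
  assumes u: "u \<in> L2"
  defines "U \<equiv> \<lambda>n x. indicator (ball 0 (real n)) x * u x"
  shows "integrable lebesgue (U n)" "L2_tendsto U u"
proof -
  note um[measurable] = L2_measurable[OF u]
  have ui: "integrable lebesgue (\<lambda>x. (cmod (u x))\<^sup>2)" by (rule L2_integrable[OF u])
  have [measurable]: "ball (0::'a) a \<in> sets lebesgue" for a by simp
  have Um[measurable]: "U n \<in> borel_measurable lebesgue" for n unfolding U_def by measurable
  have bi: "integrable lebesgue (indicator (ball (0::'a) (real n)) :: 'a \<Rightarrow> real)"
    using emeasure_lborel_ball_finite[of "0::'a" "real n"] by (simp add: integrable_real_indicator)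
  show "integrable lebesgue (U n)"
  proof (rule Bochner_Integration.integrable_bound[OF Bochner_Integration.integrable_add[OF bi ui]])
    have "cmod (u x) \<le> 1 + (cmod (u x))\<^sup>2" for x
      using zero_le_power2[of "cmod (u x) - 1/2"] by (simp add: power2_eq_square algebra_simps)
    then show "AE x in lebesgue. norm (U n x) \<le> norm (indicator (ball 0 (real n)) x + (cmod (u x))\<^sup>2 :: real)"
      by (intro AE_I2) (auto simp: U_def indicator_def)
  qed measurable
  have UL: "U n \<in> L2" for n
  proof -
    have "integrable lebesgue (\<lambda>x. (cmod (U n x))\<^sup>2)"
    proof (rule Bochner_Integration.integrable_bound[OF ui])
      show "AE x in lebesgue. norm ((cmod (U n x))\<^sup>2) \<le> norm ((cmod (u x))\<^sup>2)"
        by (rule AE_I2) (simp add: U_def indicator_def)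
    qed measurable
    then show ?thesis by (simp add: L2_def)
  qed
  have "(\<lambda>n. \<integral>x. (cmod (U n x - u x))\<^sup>2 \<partial>lebesgue) \<longlonglongrightarrow> (\<integral>x. 0 \<partial>(lebesgue :: 'a measure))"
  proof (rule integral_dominated_convergence[OF _ _ ui])
    show "AE x in lebesgue. (\<lambda>n. (cmod (U n x - u x))\<^sup>2) \<longlonglongrightarrow> 0"
    proof (rule AE_I2)
      fix x :: 'a
      obtain M where M: "norm x < real M" using reals_Archimedean2 by blast
      then have "eventually (\<lambda>n. (cmod (U n x - u x))\<^sup>2 = 0) sequentially"
        unfolding U_def eventually_sequentially by (intro exI[of _ M]) auto
      then show "(\<lambda>n. (cmod (U n x - u x))\<^sup>2) \<longlonglongrightarrow> 0" by (rule tendsto_eventually)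
    qed
    show "AE x in lebesgue. norm ((cmod (U n x - u x))\<^sup>2) \<le> (cmod (u x))\<^sup>2" for n
      by (rule AE_I2) (auto simp: U_def indicator_def)
  qed measurable
  then have "(\<lambda>n. sqrt (\<integral>x. (cmod (U n x - u x))\<^sup>2 \<partial>lebesgue)) \<longlonglongrightarrow> sqrt 0"
    by (intro tendsto_real_sqrt) simp
  then show "L2_tendsto U u" using UL u by (simp add: L2_tendsto_def L2_norm_def)
qed

text \<open>The images of the truncations form a Cauchy sequence, and its limit has the property by which the extension is
  chosen.\<close>

lemma L2_extension_isometry:
  fixes T :: "('a::euclidean_space \<Rightarrow> complex) \<Rightarrow> 'a \<Rightarrow> complex"
  assumes diff: "\<And>f g. integrable lebesgue f \<Longrightarrow> integrable lebesgue g \<Longrightarrow> T (\<lambda>x. f x - g x) = (\<lambda>x. T f x - T g x)"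
    and iso: "\<And>f. integrable lebesgue f \<Longrightarrow> f \<in> L2 \<Longrightarrow> T f \<in> L2 \<and> L2_norm (T f) = \<kappa> * L2_norm f"
    and \<kappa>: "\<kappa> > 0" and u: "u \<in> L2"
  shows "L2_extension T u \<in> L2"
    and "L2_norm (L2_extension T u) = \<kappa> * L2_norm u"
    and "\<And>f. (\<And>n. integrable lebesgue (f n)) \<Longrightarrow> L2_tendsto f u \<Longrightarrow> L2_tendsto (\<lambda>n. T (f n)) (L2_extension T u)"
proof -
  define U where "U = (\<lambda>n x. indicator (ball 0 (real n)) x * u x)"
  have Ui: "integrable lebesgue (U n)" for n
    unfolding U_def by (rule L2_truncation[OF u])
  have Ut: "L2_tendsto U u"
    unfolding U_def by (rule L2_truncation[OF u])
  have UL: "U n \<in> L2" for n using Ut by (simp add: L2_tendsto_def)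
  have U0: "(\<lambda>n. L2_norm (\<lambda>x. U n x - u x)) \<longlonglongrightarrow> 0" using Ut by (simp add: L2_tendsto_def)
  have Tdiff: "L2_norm (\<lambda>x. T f x - T g x) = \<kappa> * L2_norm (\<lambda>x. f x - g x)"
    if "integrable lebesgue f" "integrable lebesgue g" "f \<in> L2" "g \<in> L2" for f g
    using iso[of "\<lambda>x. f x - g x"] diff[of f g] that L2_diff by auto
  have TU: "T (U n) \<in> L2" for n using iso[OF Ui UL] by simp
  have "\<exists>g. L2_tendsto (\<lambda>n. T (U n)) g"
  proof (rule L2_complete[OF TU])
    fix e :: real assume e: "e > 0"
    have "eventually (\<lambda>n. L2_norm (\<lambda>x. U n x - u x) < e / (2 * \<kappa>)) sequentially"
      using U0 by (rule order_tendstoD) (use e \<kappa> in simp)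
    then obtain N where N: "\<And>n. n \<ge> N \<Longrightarrow> L2_norm (\<lambda>x. U n x - u x) < e / (2 * \<kappa>)"
      by (auto simp: eventually_sequentially)
    have "L2_norm (\<lambda>x. T (U m) x - T (U n) x) < e" if "m \<ge> N" "n \<ge> N" for m n
    proof -
      have "L2_norm (\<lambda>x. U m x - U n x) \<le> L2_norm (\<lambda>x. U m x - u x) + L2_norm (\<lambda>x. U n x - u x)"
        using L2_norm_triangle_diff[OF UL u UL, of m n] L2_norm_minus_commute[of u "U n"] by simp
      also have "\<dots> < e / (2 * \<kappa>) + e / (2 * \<kappa>)" using N that by (intro add_strict_mono)
      also have "\<dots> = e / \<kappa>" using \<kappa> by (simp add: field_simps)
      finally show ?thesis using \<kappa> by (simp add: Tdiff[OF Ui Ui UL UL] field_simps)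
    qed
    then show "\<exists>N. \<forall>m\<ge>N. \<forall>n\<ge>N. L2_norm (\<lambda>x. T (U m) x - T (U n) x) < e" by blast
  qed
  then obtain g where g: "L2_tendsto (\<lambda>n. T (U n)) g" by blast
  have "\<forall>f. (\<forall>n. integrable lebesgue (f n)) \<and> L2_tendsto f u \<longrightarrow> L2_tendsto (\<lambda>n. T (f n)) g"
  proof (intro allI impI, elim conjE)
    fix f assume fi: "\<forall>n. integrable lebesgue (f n)" and ft: "L2_tendsto f u"
    have fL: "f n \<in> L2" for n using ft by (simp add: L2_tendsto_def)
    have Tf: "T (f n) \<in> L2" for n using iso[of "f n"] fi fL by simp
    have gL: "g \<in> L2" using g by (simp add: L2_tendsto_def)
    have lim: "(\<lambda>n. \<kappa> * (L2_norm (\<lambda>x. f n x - u x) + L2_norm (\<lambda>x. U n x - u x)) + L2_norm (\<lambda>x. T (U n) x - g x)) \<longlonglongrightarrow> \<kappa> * (0 + 0) + 0"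
      using ft g U0 by (intro tendsto_intros) (auto simp: L2_tendsto_def)
    have le: "L2_norm (\<lambda>x. T (f n) x - g x) \<le> \<kappa> * (L2_norm (\<lambda>x. f n x - u x) + L2_norm (\<lambda>x. U n x - u x)) + L2_norm (\<lambda>x. T (U n) x - g x)" for n
    proof -
      have "L2_norm (\<lambda>x. T (f n) x - g x) \<le> L2_norm (\<lambda>x. T (f n) x - T (U n) x) + L2_norm (\<lambda>x. T (U n) x - g x)"
        by (rule L2_norm_triangle_diff[OF Tf TU gL])
      also have "L2_norm (\<lambda>x. T (f n) x - T (U n) x) = \<kappa> * L2_norm (\<lambda>x. f n x - U n x)"
        using fi by (intro Tdiff Ui fL UL) simp
      also have "\<dots> \<le> \<kappa> * (L2_norm (\<lambda>x. f n x - u x) + L2_norm (\<lambda>x. U n x - u x))"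
        using \<kappa> L2_norm_triangle_diff[OF fL u UL, of n n] L2_norm_minus_commute[of u "U n"]
        by (intro mult_left_mono) auto
      finally show ?thesis by simp
    qed
    have "(\<lambda>n. L2_norm (\<lambda>x. T (f n) x - g x)) \<longlonglongrightarrow> 0"
    proof (rule tendsto_sandwich[OF always_eventually always_eventually tendsto_const])
      show "\<forall>n. 0 \<le> L2_norm (\<lambda>x. T (f n) x - g x)" by (rule allI) (rule L2_norm_nonneg)
      show "\<forall>n. L2_norm (\<lambda>x. T (f n) x - g x) \<le> \<kappa> * (L2_norm (\<lambda>x. f n x - u x) + L2_norm (\<lambda>x. U n x - u x)) + L2_norm (\<lambda>x. T (U n) x - g x)"
        by (rule allI) (rule le)
      show "(\<lambda>n. \<kappa> * (L2_norm (\<lambda>x. f n x - u x) + L2_norm (\<lambda>x. U n x - u x)) + L2_norm (\<lambda>x. T (U n) x - g x)) \<longlonglongrightarrow> 0"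
        using lim by simp
    qed
    then show "L2_tendsto (\<lambda>n. T (f n)) g" using Tf gL by (simp add: L2_tendsto_def)
  qed
  then have ext: "\<forall>f. (\<forall>n. integrable lebesgue (f n)) \<and> L2_tendsto f u \<longrightarrow> L2_tendsto (\<lambda>n. T (f n)) (L2_extension T u)"
    unfolding L2_extension_def
    by (rule someI[of "\<lambda>g. \<forall>f. (\<forall>n. integrable lebesgue (f n)) \<and> L2_tendsto f u \<longrightarrow> L2_tendsto (\<lambda>n. T (f n)) g"])
  then show "\<And>f. (\<And>n. integrable lebesgue (f n)) \<Longrightarrow> L2_tendsto f u \<Longrightarrow> L2_tendsto (\<lambda>n. T (f n)) (L2_extension T u)"
    by blast
  have TUt: "L2_tendsto (\<lambda>n. T (U n)) (L2_extension T u)" using ext Ui Ut by blast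
  then show "L2_extension T u \<in> L2" by (simp add: L2_tendsto_def)
  have "(\<lambda>n. \<kappa> * L2_norm (U n)) \<longlonglongrightarrow> \<kappa> * L2_norm u"
    by (intro tendsto_intros L2_norm_tendsto Ut)
  moreover have "(\<lambda>n. \<kappa> * L2_norm (U n)) \<longlonglongrightarrow> L2_norm (L2_extension T u)"
    using L2_norm_tendsto[OF TUt] iso[OF Ui UL] by simp
  ultimately show "L2_norm (L2_extension T u) = \<kappa> * L2_norm u"
    by (rule LIMSEQ_unique[rotated])
qed

section \<open>The Fourier transforms of square-integrable functions\<close>

text \<open>Transfers the Plancherel identity from Borel to Lebesgue measurable functions.\<close>

lemma L1_L2_borel_representative:
  fixes h :: "'a::euclidean_space \<Rightarrow> complex"
  assumes h: "integrable lebesgue h" "h \<in> L2"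
  obtains g where "integrable lborel g" "integrable lborel (\<lambda>x. (cmod (g x))\<^sup>2)" "g \<in> borel_measurable borel"
    "AE x in lborel. h x = g x" "g \<in> L2" "integrable lebesgue g" "L2_norm h = L2_norm g"
    "(L2_norm g)\<^sup>2 = (\<integral>x. (cmod (g x))\<^sup>2 \<partial>lborel)" "fourier_L1 h = fourier_L1 g"
proof -
  have hm: "h \<in> borel_measurable lebesgue" using borel_measurable_integrable[OF h(1)] .
  obtain g where g[measurable]: "g \<in> borel_measurable borel" and ae: "AE x in lborel. h x = g x"
    using lebesgue_AE_borel_complex[OF hm] .
  have gm: "g \<in> borel_measurable lebesgue" by (intro measurable_completion) simp
  have ae': "AE x in lborel. g x = h x" using ae by eventually_elim simp
  have gL: "g \<in> L2" "L2_norm g = L2_norm h" using L2_cong_AE[OF h(2) ae'] by auto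
  have gi: "integrable lebesgue g"
    using h(1) integrable_cong_AE[OF hm gm] ae unfolding AE_lebesgue_iff by blast
  then have g1: "integrable lborel g" by (subst (asm) integrable_completion) auto
  have g2: "integrable lborel (\<lambda>x. (cmod (g x))\<^sup>2)"
    using L2_integrable[OF gL(1)] by (subst (asm) integrable_completion) auto
  have n: "(L2_norm g)\<^sup>2 = (\<integral>x. (cmod (g x))\<^sup>2 \<partial>lborel)"
    unfolding L2_norm_power2 by (rule integral_completion) measurable
  show ?thesis
    by (rule that[OF g1 g2 g ae gL(1) gi gL(2)[symmetric] n fourier_L1_cong_AE[OF ae hm gm]])
qed

lemma inv_fourier_L1_eq: "inv_fourier_L1 q x = of_real ((2 * pi) ^ DIM('a)) * fourier_L1 q (- x)"
  for q :: "'a::euclidean_space \<Rightarrow> complex"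
  unfolding inv_fourier_L1_def fourier_L1_def by (simp add: inner_commute mult.commute)

text \<open>The inverse transform multiplies the norm of \<open>L\<^sup>2\<close> by this constant, and the direct transform divides it
  by the same constant.\<close>

definition fourier_const :: "'a::euclidean_space itself \<Rightarrow> real" where
  "fourier_const _ = (2 * pi) powr (real DIM('a) / 2)"

lemma fourier_const: "fourier_const TYPE('a::euclidean_space) > 0"
  "(fourier_const TYPE('a))\<^sup>2 = (2 * pi) ^ DIM('a)"
proof -
  show "fourier_const TYPE('a) > 0" by (simp add: fourier_const_def)
  have "(fourier_const TYPE('a))\<^sup>2 = (2 * pi) powr (real DIM('a) / 2 + real DIM('a) / 2)"
    unfolding power2_eq_square fourier_const_def powr_add ..
  also have "\<dots> = (2 * pi) ^ DIM('a)" by (simp add: powr_realpow)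
  finally show "(fourier_const TYPE('a))\<^sup>2 = (2 * pi) ^ DIM('a)" .
qed

lemma fourier_L1_isometry:
  fixes h :: "'a::euclidean_space \<Rightarrow> complex"
  assumes h: "integrable lebesgue h" "h \<in> L2"
  shows "fourier_L1 h \<in> L2" "fourier_const TYPE('a) * L2_norm (fourier_L1 h) = L2_norm h"
proof -
  obtain g where g: "integrable lborel g" "integrable lborel (\<lambda>x. (cmod (g x))\<^sup>2)" "g \<in> borel_measurable borel"
    "AE x in lborel. h x = g x" "g \<in> L2" "integrable lebesgue g" "L2_norm h = L2_norm g"
    "(L2_norm g)\<^sup>2 = (\<integral>x. (cmod (g x))\<^sup>2 \<partial>lborel)" "fourier_L1 h = fourier_L1 g"
    by (rule L1_L2_borel_representative[OF h])
  have [measurable]: "fourier_L1 g \<in> borel_measurable borel" by (rule fourier_L1_measurable[OF g(1)])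
  have i: "integrable lebesgue (\<lambda>x. (cmod (fourier_L1 g x))\<^sup>2)"
    using plancherel_L1_L2(1)[OF g(1,2)] by (subst integrable_completion) auto
  show "fourier_L1 h \<in> L2"
    unfolding g(9) L2_def using i by (auto intro: measurable_completion)
  have "(L2_norm (fourier_L1 g))\<^sup>2 = (\<integral>x. (cmod (fourier_L1 g x))\<^sup>2 \<partial>lborel)"
    unfolding L2_norm_power2 by (rule integral_completion) measurable
  also have "\<dots> = (L2_norm g)\<^sup>2 / (fourier_const TYPE('a))\<^sup>2"
    unfolding plancherel_L1_L2(2)[OF g(1,2)] fourier_const g(8) by simp
  finally have "(fourier_const TYPE('a) * L2_norm (fourier_L1 g))\<^sup>2 = (L2_norm g)\<^sup>2"
    using fourier_const(1)[where 'a='a] by (simp add: power_mult_distrib)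
  then show "fourier_const TYPE('a) * L2_norm (fourier_L1 h) = L2_norm h"
    unfolding g(7,9)
    by (rule power2_eq_imp_eq)
       (use fourier_const(1)[where 'a='a] L2_norm_nonneg[of g] L2_norm_nonneg[of "fourier_L1 g"] in auto)
qed

lemma L2_reflect:
  fixes h :: "'a::euclidean_space \<Rightarrow> complex"
  assumes h: "h \<in> L2"
  shows "(\<lambda>x. h (- x)) \<in> L2" "L2_norm (\<lambda>x. h (- x)) = L2_norm h"
proof -
  have hm: "h \<in> borel_measurable lebesgue" by (rule L2_measurable[OF h])
  obtain g where g[measurable]: "g \<in> borel_measurable borel" and ae: "AE x in lborel. h x = g x"
    using lebesgue_AE_borel_complex[OF hm] .
  have ae': "AE x in lborel. g x = h x" using ae by eventually_elim simp
  have gL: "g \<in> L2" "L2_norm g = L2_norm h" using L2_cong_AE[OF h ae'] by auto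
  have g2: "integrable lborel (\<lambda>x. (cmod (g x))\<^sup>2)"
    using L2_integrable[OF gL(1)] by (subst (asm) integrable_completion) auto
  have r2: "integrable lborel (\<lambda>x. (cmod (g (- x)))\<^sup>2)"
    using lborel_integrable_affine[OF g2, of "-1" 0] by simp
  have rm: "(\<lambda>x. g (- x)) \<in> borel_measurable lebesgue"
    by (intro measurable_completion) measurable
  have rL: "(\<lambda>x. g (- x)) \<in> L2"
    unfolding L2_def using r2 rm by (auto simp: integrable_completion)
  have "(L2_norm (\<lambda>x. g (- x)))\<^sup>2 = (\<integral>x. (cmod (g (- x)))\<^sup>2 \<partial>lborel)"
    unfolding L2_norm_power2 by (rule integral_completion) measurable
  also have "\<dots> = (\<integral>x. (cmod (g x))\<^sup>2 \<partial>lborel)"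
    using lborel_integral_affine[of "\<lambda>x. (cmod (g x))\<^sup>2" "-1" 0] by simp
  also have "\<dots> = (L2_norm g)\<^sup>2"
    unfolding L2_norm_power2 by (rule integral_completion[symmetric]) measurable
  finally have rn: "L2_norm (\<lambda>x. g (- x)) = L2_norm g"
    by (rule power2_eq_imp_eq) (rule L2_norm_nonneg)+
  have ae2: "AE x in lborel. h (- x) = g (- x)"
    using AE_lborel_scaleR[OF _ ae, of "-1"] by simp
  show "(\<lambda>x. h (- x)) \<in> L2" "L2_norm (\<lambda>x. h (- x)) = L2_norm h"
    using L2_cong_AE[OF rL ae2] rn gL by auto
qed

lemma inv_fourier_L1_isometry:
  fixes h :: "'a::euclidean_space \<Rightarrow> complex"
  assumes h: "integrable lebesgue h" "h \<in> L2"
  shows "inv_fourier_L1 h \<in> L2" "L2_norm (inv_fourier_L1 h) = fourier_const TYPE('a) * L2_norm h"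
proof -
  let ?c = "complex_of_real ((2 * pi) ^ DIM('a))"
  have e: "inv_fourier_L1 h = (\<lambda>x. ?c * fourier_L1 h (- x))" by (rule ext) (rule inv_fourier_L1_eq)
  note F = fourier_L1_isometry[OF h]
  show "inv_fourier_L1 h \<in> L2" unfolding e by (intro L2_cmult L2_reflect F)
  have "L2_norm (inv_fourier_L1 h) = (fourier_const TYPE('a))\<^sup>2 * L2_norm (\<lambda>x. fourier_L1 h (- x))"
    unfolding e L2_norm_def fourier_const(2) norm_mult power_mult_distrib norm_of_real
    by (simp add: real_sqrt_mult)
  also have "\<dots> = fourier_const TYPE('a) * L2_norm h"
    unfolding L2_reflect(2)[OF F(1)] F(2)[symmetric] by (simp add: power2_eq_square)
  finally show "L2_norm (inv_fourier_L1 h) = fourier_const TYPE('a) * L2_norm h" .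
qed

lemma integrable_lebesgue_exp_mult:
  fixes v :: "'a::euclidean_space \<Rightarrow> complex"
  assumes v: "integrable lebesgue v"
  shows "integrable lebesgue (\<lambda>x. exp (\<i> * of_real (\<xi> \<bullet> x)) * v x)"
proof -
  have [measurable]: "(\<lambda>x::'a. exp (\<i> * of_real (\<xi> \<bullet> x))) \<in> borel_measurable lebesgue"
    by (intro measurable_completion) auto
  note [measurable] = borel_measurable_integrable[OF v]
  show ?thesis
    by (rule Bochner_Integration.integrable_bound[OF v]) (auto simp: norm_mult norm_exp_i_times)
qed

lemma fourier_L1_diff:
  fixes f g :: "'a::euclidean_space \<Rightarrow> complex"
  assumes "integrable lebesgue f" "integrable lebesgue g"
  shows "fourier_L1 (\<lambda>x. f x - g x) = (\<lambda>x. fourier_L1 f x - fourier_L1 g x)"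
  unfolding fourier_L1_def using assms[THEN integrable_lebesgue_exp_mult]
  by (simp add: right_diff_distrib)

lemma inv_fourier_L1_diff:
  fixes f g :: "'a::euclidean_space \<Rightarrow> complex"
  assumes "integrable lebesgue f" "integrable lebesgue g"
  shows "inv_fourier_L1 (\<lambda>x. f x - g x) = (\<lambda>x. inv_fourier_L1 f x - inv_fourier_L1 g x)"
  unfolding inv_fourier_L1_eq fourier_L1_diff[OF assms] by (simp add: right_diff_distrib)

text \<open>All that is needed of the inverse transform in a Sobolev norm is its effect on the norm of \<open>L\<^sup>2\<close>.\<close>

theorem inv_fourier_isometry:
  fixes u :: "'a::euclidean_space \<Rightarrow> complex"
  assumes u: "u \<in> L2"
  shows "inv_fourier u \<in> L2" "L2_norm (inv_fourier u) = fourier_const TYPE('a) * L2_norm u"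
proof -
  have "inv_fourier u \<in> L2 \<and> L2_norm (inv_fourier u) = fourier_const TYPE('a) * L2_norm u"
  proof (cases "integrable lebesgue u")
    case True
    then show ?thesis using inv_fourier_L1_isometry[OF True u] by (simp add: inv_fourier_def)
  next
    case False
    have iso: "inv_fourier_L1 f \<in> L2 \<and> L2_norm (inv_fourier_L1 f) = fourier_const TYPE('a) * L2_norm f"
      if "integrable lebesgue f" "f \<in> L2" for f :: "'a \<Rightarrow> complex"
      using inv_fourier_L1_isometry[OF that] by (rule conjI)
    have "inv_fourier u = L2_extension inv_fourier_L1 u"
      unfolding inv_fourier_def using False by (rule if_not_P)
    moreover have "L2_extension inv_fourier_L1 u \<in> L2"
      by (rule L2_extension_isometry(1)[OF inv_fourier_L1_diff iso fourier_const(1) u])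
    moreover have "L2_norm (L2_extension inv_fourier_L1 u) = fourier_const TYPE('a) * L2_norm u"
      by (rule L2_extension_isometry(2)[OF inv_fourier_L1_diff iso fourier_const(1) u])
    ultimately show ?thesis by (simp only: simp_thms)
  qed
  then show "inv_fourier u \<in> L2" "L2_norm (inv_fourier u) = fourier_const TYPE('a) * L2_norm u" by auto
qed

lemma cmod_add_power2: "(cmod (a + b))\<^sup>2 = (cmod a)\<^sup>2 + (cmod b)\<^sup>2 + 2 * Re (a * cnj b)"
  unfolding cmod_power2 by (simp add: power2_eq_square algebra_simps)

lemma integrable_mult_cnj:
  assumes f: "f \<in> L2" and g: "g \<in> L2"
  shows "integrable lebesgue (\<lambda>x. f x * cnj (g x))"
proof -
  have i: "integrable lebesgue (\<lambda>x. ((cmod (f x))\<^sup>2 + (cmod (g x))\<^sup>2) / 2)"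
    using L2_integrable[OF f] L2_integrable[OF g] by simp
  note [measurable] = L2_measurable[OF f] L2_measurable[OF g]
  have le: "cmod (f x * cnj (g x)) \<le> ((cmod (f x))\<^sup>2 + (cmod (g x))\<^sup>2) / 2" for x
    using weighted_am_gm[of 1 "cmod (f x)" "cmod (g x)"] by (simp add: norm_mult)
  show ?thesis
  proof (rule Bochner_Integration.integrable_bound[OF i])
    show "AE x in lebesgue. norm (f x * cnj (g x)) \<le> norm (((cmod (f x))\<^sup>2 + (cmod (g x))\<^sup>2) / 2)"
      by (rule AE_I2) (simp only: real_norm_def order.trans[OF le abs_ge_self])
  qed measurable
qed

lemma L2_norm_add_power2:
  assumes f: "f \<in> L2" and g: "g \<in> L2"
  shows "(L2_norm (\<lambda>x. f x + g x))\<^sup>2 = (L2_norm f)\<^sup>2 + (L2_norm g)\<^sup>2 + 2 * Re (\<integral>x. f x * cnj (g x) \<partial>lebesgue)"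
proof -
  have i: "integrable lebesgue (\<lambda>x. Re (f x * cnj (g x)))"
    by (intro integrable_Re integrable_mult_cnj f g)
  have "(L2_norm (\<lambda>x. f x + g x))\<^sup>2 = (\<integral>x. ((cmod (f x))\<^sup>2 + (cmod (g x))\<^sup>2) + 2 * Re (f x * cnj (g x)) \<partial>lebesgue)"
    unfolding L2_norm_power2 cmod_add_power2 ..
  also have "\<dots> = (\<integral>x. (cmod (f x))\<^sup>2 + (cmod (g x))\<^sup>2 \<partial>lebesgue) + (\<integral>x. 2 * Re (f x * cnj (g x)) \<partial>lebesgue)"
    by (intro Bochner_Integration.integral_add Bochner_Integration.integrable_add integrable_mult_right i L2_integrable f g)
  also have "(\<integral>x. (cmod (f x))\<^sup>2 + (cmod (g x))\<^sup>2 \<partial>lebesgue) = (L2_norm f)\<^sup>2 + (L2_norm g)\<^sup>2"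
    unfolding L2_norm_power2 by (intro Bochner_Integration.integral_add L2_integrable f g)
  also have "(\<integral>x. 2 * Re (f x * cnj (g x)) \<partial>lebesgue) = 2 * Re (\<integral>x. f x * cnj (g x) \<partial>lebesgue)"
    unfolding integral_mult_right_zero integral_Re[OF integrable_mult_cnj[OF f g]] ..
  finally show ?thesis .
qed

text \<open>The direct transform and the inverse transform are adjoint to each other, up to normalisation.\<close>

lemma fourier_cross_term:
  fixes h q :: "'a::euclidean_space \<Rightarrow> complex"
  assumes h: "integrable lebesgue h" "h \<in> L2" and q: "integrable lebesgue q" "q \<in> L2"
  shows "(\<integral>x. h x * cnj (inv_fourier_L1 q x) \<partial>lebesgue) = of_real ((2 * pi) ^ DIM('a)) * (\<integral>\<xi>. fourier_L1 h \<xi> * cnj (q \<xi>) \<partial>lebesgue)"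
proof -
  obtain h' where h': "integrable lborel h'" "integrable lborel (\<lambda>x. (cmod (h' x))\<^sup>2)" "h' \<in> borel_measurable borel"
    "AE x in lborel. h x = h' x" "h' \<in> L2" "integrable lebesgue h'" "L2_norm h = L2_norm h'"
    "(L2_norm h')\<^sup>2 = (\<integral>x. (cmod (h' x))\<^sup>2 \<partial>lborel)" "fourier_L1 h = fourier_L1 h'"
    by (rule L1_L2_borel_representative[OF h])
  obtain q' where q': "integrable lborel q'" "integrable lborel (\<lambda>x. (cmod (q' x))\<^sup>2)" "q' \<in> borel_measurable borel"
    "AE x in lborel. q x = q' x" "q' \<in> L2" "integrable lebesgue q'" "L2_norm q = L2_norm q'"
    "(L2_norm q')\<^sup>2 = (\<integral>x. (cmod (q' x))\<^sup>2 \<partial>lborel)" "fourier_L1 q = fourier_L1 q'"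
    by (rule L1_L2_borel_representative[OF q])
  have invq: "inv_fourier_L1 q = inv_fourier_L1 q'" by (rule ext) (simp add: inv_fourier_L1_eq q'(9))
  note [measurable] = h'(3) q'(3)
  have Fm[measurable]: "fourier_L1 h' \<in> borel_measurable borel" "fourier_L1 q' \<in> borel_measurable borel"
    by (rule fourier_L1_measurable[OF h'(1)] fourier_L1_measurable[OF q'(1)])+
  have Im[measurable]: "inv_fourier_L1 q' \<in> borel_measurable borel"
    unfolding inv_fourier_L1_eq[abs_def] by measurable
  have qc: "integrable lborel (\<lambda>\<xi>. cnj (q' \<xi>))" using q'(1) by simp
  have qcm: "(\<lambda>\<xi>. cnj (q' \<xi>)) \<in> borel_measurable borel" by measurable
  have Fq: "cnj (inv_fourier_L1 q' x) = of_real ((2 * pi) ^ DIM('a)) * fourier_L1 (\<lambda>\<xi>. cnj (q' \<xi>)) x" for x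
  proof -
    have "cnj (inv_fourier_L1 q' x) = cnj (\<integral>\<xi>. q' \<xi> * exp (- \<i> * of_real (\<xi> \<bullet> x)) \<partial>lborel)"
      unfolding inv_fourier_L1_def by (subst integral_completion) auto
    also have "\<dots> = (\<integral>\<xi>. cnj (q' \<xi> * exp (- \<i> * of_real (\<xi> \<bullet> x))) \<partial>lborel)"
      by (simp only: Bochner_Integration.integral_cnj)
    also have "\<dots> = (\<integral>\<xi>. exp (\<i> * of_real (x \<bullet> \<xi>)) * cnj (q' \<xi>) \<partial>lborel)"
      by (simp add: exp_cnj inner_commute mult.commute)
    finally show ?thesis by (simp add: fourier_L1_lborel[OF qcm])
  qed
  have m1: "(\<lambda>x. h' x * cnj (inv_fourier_L1 q' x)) \<in> borel_measurable lebesgue"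
    and m2: "(\<lambda>\<xi>. fourier_L1 h' \<xi> * cnj (q' \<xi>)) \<in> borel_measurable lebesgue"
    by (intro measurable_completion; measurable)+
  have a1: "AE x in lborel. h x * cnj (inv_fourier_L1 q' x) = h' x * cnj (inv_fourier_L1 q' x)"
    using h'(4) by eventually_elim simp
  have a2: "AE \<xi> in lborel. fourier_L1 h' \<xi> * cnj (q \<xi>) = fourier_L1 h' \<xi> * cnj (q' \<xi>)"
    using q'(4) by eventually_elim simp
  have "(\<integral>x. h x * cnj (inv_fourier_L1 q x) \<partial>lebesgue) = (\<integral>x. h' x * cnj (inv_fourier_L1 q' x) \<partial>lebesgue)"
    unfolding invq by (rule integral_cong_AE[OF borel_measurable_lebesgue_AE[OF m1 a1] m1]) (simp only: AE_lebesgue_iff a1)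
  also have "\<dots> = (\<integral>x. h' x * cnj (inv_fourier_L1 q' x) \<partial>lborel)"
    by (rule integral_completion) measurable
  also have "\<dots> = (\<integral>x. of_real ((2 * pi) ^ DIM('a)) * (h' x * fourier_L1 (\<lambda>\<xi>. cnj (q' \<xi>)) x) \<partial>lborel)"
    unfolding Fq by (simp only: mult.left_commute)
  also have "\<dots> = of_real ((2 * pi) ^ DIM('a)) * (\<integral>x. fourier_L1 h' x * cnj (q' x) \<partial>lborel)"
    unfolding integral_mult_right_zero fourier_L1_multiplication_formula[OF h'(1) qc] ..
  also have "(\<integral>x. fourier_L1 h' x * cnj (q' x) \<partial>lborel) = (\<integral>x. fourier_L1 h' x * cnj (q' x) \<partial>lebesgue)"
    by (rule integral_completion[symmetric]) measurable
  also have "\<dots> = (\<integral>x. fourier_L1 h' x * cnj (q x) \<partial>lebesgue)"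
    by (rule integral_cong_AE[symmetric, OF borel_measurable_lebesgue_AE[OF m2 a2] m2]) (simp only: AE_lebesgue_iff a2)
  finally show ?thesis unfolding h'(9) .
qed

text \<open>Expanding both squares reduces this to the isometry property of each transform and to their adjointness.
  It says that the direct transform inverts the inverse one, without asking for integrability of \<open>inv_fourier_L1 q\<close>.\<close>

lemma fourier_inv_fourier_isometry:
  fixes h q :: "'a::euclidean_space \<Rightarrow> complex"
  assumes h: "integrable lebesgue h" "h \<in> L2" and q: "integrable lebesgue q" "q \<in> L2"
  shows "L2_norm (\<lambda>x. h x + inv_fourier_L1 q x) = fourier_const TYPE('a) * L2_norm (\<lambda>\<xi>. fourier_L1 h \<xi> + q \<xi>)"
proof (rule power2_eq_imp_eq)
  let ?c = "fourier_const TYPE('a)"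
  note F = fourier_L1_isometry[OF h] and I = inv_fourier_L1_isometry[OF q]
  have "(L2_norm (\<lambda>x. h x + inv_fourier_L1 q x))\<^sup>2 = (?c * L2_norm (fourier_L1 h))\<^sup>2 + (?c * L2_norm q)\<^sup>2 + 2 * Re (of_real (?c\<^sup>2) * (\<integral>\<xi>. fourier_L1 h \<xi> * cnj (q \<xi>) \<partial>lebesgue))"
    unfolding L2_norm_add_power2[OF h(2) I(1)] fourier_cross_term[OF h q] F(2) I(2) fourier_const(2) ..
  also have "\<dots> = (?c * L2_norm (\<lambda>\<xi>. fourier_L1 h \<xi> + q \<xi>))\<^sup>2"
    unfolding power_mult_distrib L2_norm_add_power2[OF F(1) q(2)] by (simp add: algebra_simps)
  finally show "(L2_norm (\<lambda>x. h x + inv_fourier_L1 q x))\<^sup>2 = (?c * L2_norm (\<lambda>\<xi>. fourier_L1 h \<xi> + q \<xi>))\<^sup>2" .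
  show "0 \<le> ?c * L2_norm (\<lambda>\<xi>. fourier_L1 h \<xi> + q \<xi>)"
    using fourier_const(1)[where 'a='a] L2_norm_nonneg by (intro mult_nonneg_nonneg) (auto intro: less_imp_le)
qed (rule L2_norm_nonneg)

text \<open>The function \<open>u\<close> may or may not be integrable, and its transform is defined differently in the two cases.
  In both of them the isometry shows that transforms of integrable approximations of \<open>u\<close>, or of
  \<open>u\<close> itself, are close to \<open>fourier v - q\<close> in \<open>L\<^sup>2\<close>.\<close>

theorem fourier_diff_inv_fourier:
  fixes v q :: "'a::euclidean_space \<Rightarrow> complex"
  assumes v: "integrable lebesgue v" "v \<in> L2" and q: "integrable lebesgue q" "q \<in> L2"
  defines "u \<equiv> \<lambda>x. v x - inv_fourier q x"
  shows "u \<in> L2" "AE \<xi> in lborel. fourier u \<xi> = fourier v \<xi> - q \<xi>"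
proof -
  have u_eq: "u = (\<lambda>x. v x - inv_fourier_L1 q x)" unfolding u_def inv_fourier_def using q by simp
  note I = inv_fourier_L1_isometry[OF q]
  show uL: "u \<in> L2" unfolding u_eq by (rule L2_diff[OF v(2) I(1)])
  have Fv: "fourier v = fourier_L1 v" using v by (simp add: fourier_def)
  have Fq: "(\<lambda>\<xi>. fourier_L1 v \<xi> - q \<xi>) \<in> L2" by (intro L2_diff fourier_L1_isometry v q)
  have key: "fourier_const TYPE('a) * L2_norm (\<lambda>\<xi>. fourier_L1 f \<xi> - (fourier_L1 v \<xi> - q \<xi>)) = L2_norm (\<lambda>x. f x - u x)"
    if f: "integrable lebesgue f" "f \<in> L2" for f
  proof -
    have "(\<lambda>x. f x - u x) = (\<lambda>x. (f x - v x) + inv_fourier_L1 q x)" by (simp add: u_eq algebra_simps)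
    moreover have "(\<lambda>\<xi>. fourier_L1 f \<xi> - (fourier_L1 v \<xi> - q \<xi>)) = (\<lambda>\<xi>. fourier_L1 (\<lambda>x. f x - v x) \<xi> + q \<xi>)"
      by (simp add: fourier_L1_diff[OF f(1) v(1)] algebra_simps)
    ultimately show ?thesis
      using fourier_inv_fourier_isometry[OF Bochner_Integration.integrable_diff[OF f(1) v(1)] L2_diff[OF f(2) v(2)] q] by simp
  qed
  show "AE \<xi> in lborel. fourier u \<xi> = fourier v \<xi> - q \<xi>"
  proof (cases "integrable lebesgue u")
    case True
    have "L2_norm (\<lambda>\<xi>. fourier_L1 u \<xi> - (fourier_L1 v \<xi> - q \<xi>)) = 0"
      using key[OF True uL] fourier_const(1)[where 'a='a] by (simp add: L2_norm_def)
    from L2_norm_0_imp_AE[OF L2_diff[OF fourier_L1_isometry(1)[OF True uL] Fq] this]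
    have "AE \<xi> in lborel. fourier_L1 u \<xi> = fourier_L1 v \<xi> - q \<xi>" by eventually_elim simp
    then show ?thesis using True by (simp add: Fv) (simp add: fourier_def)
  next
    case False
    have iso: "fourier_L1 f \<in> L2 \<and> L2_norm (fourier_L1 f) = (1 / fourier_const TYPE('a)) * L2_norm f"
      if "integrable lebesgue f" "f \<in> L2" for f :: "'a \<Rightarrow> complex"
      using fourier_L1_isometry[OF that] fourier_const(1)[where 'a='a] by (simp add: field_simps)
    define U where "U = (\<lambda>n x. indicator (ball 0 (real n)) x * u x)"
    have Ui: "integrable lebesgue (U n)" for n unfolding U_def by (rule L2_truncation[OF uL])
    have Ut: "L2_tendsto U u" unfolding U_def by (rule L2_truncation[OF uL])
    have UL: "U n \<in> L2" for n using Ut by (simp add: L2_tendsto_def)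
    have e: "fourier u = L2_extension fourier_L1 u" using False by (simp add: fourier_def)
    have \<kappa>: "1 / fourier_const TYPE('a) > 0" using fourier_const(1)[where 'a='a] by simp
    have 1: "L2_tendsto (\<lambda>n. fourier_L1 (U n)) (fourier u)"
      unfolding e by (rule L2_extension_isometry(3)[OF fourier_L1_diff iso \<kappa> uL Ui Ut])
    have "L2_norm (\<lambda>\<xi>. fourier_L1 (U n) \<xi> - (fourier_L1 v \<xi> - q \<xi>)) = L2_norm (\<lambda>x. U n x - u x) / fourier_const TYPE('a)" for n
      using key[OF Ui UL, of n] fourier_const(1)[where 'a='a] by (simp add: field_simps)
    moreover have "(\<lambda>n. L2_norm (\<lambda>x. U n x - u x) / fourier_const TYPE('a)) \<longlonglongrightarrow> 0 / fourier_const TYPE('a)"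
      using Ut fourier_const(1)[where 'a='a] by (intro tendsto_intros) (auto simp: L2_tendsto_def)
    ultimately have 2: "L2_tendsto (\<lambda>n. fourier_L1 (U n)) (\<lambda>\<xi>. fourier_L1 v \<xi> - q \<xi>)"
      using fourier_L1_isometry(1)[OF Ui UL] Fq by (simp add: L2_tendsto_def)
    show ?thesis using L2_tendsto_unique[OF 1 2] by (simp add: Fv)
  qed
qed

section \<open>Integrals of radial functions\<close>

lemma sphere_area_eq: "sphere_area d = real d * unit_ball_vol (real d)"
  by (simp add: sphere_area_def unit_ball_vol_def)

text \<open>Polar coordinates for radial functions only: the image of Lebesgue measure on a ball under the norm is determined
  by the volumes of the smaller balls, and the derivative of the volume is the area of the sphere.\<close>

lemma radial_distribution:
  fixes R :: real
  assumes R: "R > 0"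
  shows "distr (density lborel (indicator (ball (0::'a::euclidean_space) R))) borel norm
       = density lborel (\<lambda>t. ennreal (indicator {0..R} t * (sphere_area DIM('a) * t ^ (DIM('a) - 1))))" (is "?M = ?N")
proof (rule measure_eqI_lessThan)
  have [measurable]: "(indicator (ball (0::'a) R) :: 'a \<Rightarrow> ennreal) \<in> borel_measurable borel"
    by (rule borel_measurable_indicator) simp
  define V where "V = unit_ball_vol (real DIM('a))"
  have V: "V \<ge> 0" by (simp add: V_def unit_ball_vol_nonneg)
  have V_lim: "V * a ^ DIM('a) \<le> V * b ^ DIM('a)" if "0 \<le> a" "a \<le> b" for a b
    using that V by (intro mult_left_mono power_mono)
  show "sets ?M = sets borel" "sets ?N = sets borel" by simp_all
  fix a :: real
  define b where "b = min R (max 0 a)"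
  have b: "0 \<le> b" "b \<le> R" using R by (auto simp: b_def)
  have M: "emeasure ?M {a<..} = ennreal (V * R ^ DIM('a) - V * b ^ DIM('a))"
  proof -
    have "emeasure ?M {a<..} = emeasure (density lborel (indicator (ball (0::'a) R))) {x. a < norm x}"
      by (subst emeasure_distr) (auto simp: vimage_def)
    also have "\<dots> = emeasure lborel (ball (0::'a) R \<inter> {x. a < norm x})"
      by (subst emeasure_density) (auto simp: indicator_inter_arith[symmetric] Int_commute)
    also have "\<dots> = emeasure lborel (ball (0::'a) R) - emeasure lborel (ball (0::'a) R \<inter> {x. norm x \<le> a})"
    proof -
      have "ball (0::'a) R \<inter> {x. a < norm x} = ball 0 R - (ball (0::'a) R \<inter> {x. norm x \<le> a})" by auto
      moreover have "emeasure lborel (ball (0::'a) R \<inter> {x. norm x \<le> a}) \<noteq> \<infinity>"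
      proof -
        have "emeasure lborel (ball (0::'a) R \<inter> {x. norm x \<le> a}) \<le> emeasure lborel (ball (0::'a) R)"
          by (rule emeasure_mono) auto
        also have "\<dots> < \<infinity>" using R by (simp add: emeasure_ball)
        finally show ?thesis by (rule less_imp_neq)
      qed
      ultimately show ?thesis by (simp add: emeasure_Diff)
    qed
    also have "emeasure lborel (ball (0::'a) R) = ennreal (V * R ^ DIM('a))"
      using R by (simp add: emeasure_ball V_def)
    also have "emeasure lborel (ball (0::'a) R \<inter> {x. norm x \<le> a}) = ennreal (V * b ^ DIM('a))"
    proof -
      consider "a < 0" | "0 \<le> a" "a < R" | "R \<le> a" by linarith
      then show ?thesis
      proof cases
        case 1
        then have "ball (0::'a) R \<inter> {x. norm x \<le> a} = {}" by (auto intro: order.trans[OF norm_ge_zero] simp: not_le)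
           (meson norm_ge_zero not_less order.strict_trans2)
        then show ?thesis using 1 R by (simp add: b_def zero_power)
      next
        case 2
        then have "ball (0::'a) R \<inter> {x. norm x \<le> a} = cball 0 a" by auto
        then show ?thesis using 2 by (simp add: emeasure_cball V_def b_def)
      next
        case 3
        then have "ball (0::'a) R \<inter> {x. norm x \<le> a} = ball 0 R" by auto
        then show ?thesis using 3 R by (simp add: emeasure_ball V_def b_def)
      qed
    qed
    finally show ?thesis using V V_lim[OF b] b by (simp add: ennreal_minus)
  qed
  then show "emeasure ?M {a<..} < \<infinity>" by simp
  have "emeasure ?N {a<..} = (\<integral>\<^sup>+t. ennreal (indicator {0..R} t * (sphere_area DIM('a) * t ^ (DIM('a) - 1))) * indicator {a<..} t \<partial>lborel)"
    by (rule emeasure_density) (auto intro!: borel_measurable_times)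
  also have "\<dots> = (\<integral>\<^sup>+t. ennreal (sphere_area DIM('a) * t ^ (DIM('a) - 1)) * indicator {b..R} t \<partial>lborel)"
  proof (rule nn_integral_cong_AE)
    have "AE t in lborel. t \<noteq> a" "AE t in lborel. t \<noteq> R" by (rule AE_lborel_singleton)+
    then show "AE t in lborel. ennreal (indicator {0..R} t * (sphere_area DIM('a) * t ^ (DIM('a) - 1))) * indicator {a<..} t = ennreal (sphere_area DIM('a) * t ^ (DIM('a) - 1)) * indicator {b..R} t"
      by eventually_elim (auto simp: indicator_def b_def)
  qed
  also have "\<dots> = ennreal (V * R ^ DIM('a) - V * b ^ DIM('a))"
  proof (rule nn_integral_FTC_Icc)
    fix t assume t: "t \<in> {b..R}"
    show "((\<lambda>t. V * t ^ DIM('a)) has_real_derivative sphere_area DIM('a) * t ^ (DIM('a) - 1)) (at t)"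
      unfolding sphere_area_eq V_def by (auto intro!: derivative_eq_intros)
    show "0 \<le> sphere_area DIM('a) * t ^ (DIM('a) - 1)"
      unfolding sphere_area_eq using t b by (simp add: unit_ball_vol_nonneg)
  qed (use b in auto)
  finally show "emeasure ?M {a<..} = emeasure ?N {a<..}" unfolding M ..
qed

lemma radial_integral:
  fixes g :: "real \<Rightarrow> real"
  assumes g[measurable]: "g \<in> borel_measurable borel" and R: "R > 0"
  shows "(LINT x:ball (0::'a::euclidean_space) R|lborel. g (norm x))
       = sphere_area DIM('a) * (LINT t:{0..R}|lebesgue. g t * t ^ (DIM('a) - 1))"
proof -
  have [measurable]: "(indicator (ball (0::'a) R) :: 'a \<Rightarrow> real) \<in> borel_measurable borel"
    "(indicator (ball (0::'a) R) :: 'a \<Rightarrow> ennreal) \<in> borel_measurable borel"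
    by (rule borel_measurable_indicator; simp)+
  have sa: "sphere_area DIM('a) \<ge> 0" unfolding sphere_area_eq by (simp add: unit_ball_vol_nonneg)
  have "(LINT x:ball (0::'a) R|lborel. g (norm x)) = (\<integral>x. g (norm x) \<partial>density lborel (\<lambda>x. ennreal (indicator (ball (0::'a) R) x)))"
    unfolding set_lebesgue_integral_def by (subst integral_density) auto
  also have "\<dots> = (\<integral>t. g t \<partial>distr (density lborel (indicator (ball (0::'a) R))) borel norm)"
    by (subst integral_distr) (auto simp: ennreal_indicator)
  also have "\<dots> = (\<integral>t. (indicator {0..R} t * (sphere_area DIM('a) * t ^ (DIM('a) - 1))) *\<^sub>R g t \<partial>lborel)"
    unfolding radial_distribution[OF R]
    by (subst integral_density) (auto simp: indicator_def sa)
  also have "\<dots> = sphere_area DIM('a) * (LINT t:{0..R}|lborel. g t * t ^ (DIM('a) - 1))"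
    unfolding set_lebesgue_integral_def by (subst integral_mult_right_zero[symmetric]) (simp add: mult_ac)
  also have "(LINT t:{0..R}|lborel. g t * t ^ (DIM('a) - 1)) = (LINT t:{0..R}|lebesgue. g t * t ^ (DIM('a) - 1))"
    unfolding set_lebesgue_integral_def by (rule integral_completion[symmetric]) measurable
  finally show ?thesis .
qed

section \<open>The error in Sobolev norms\<close>

text \<open>By Plancherel the squared norm is an integral over frequencies.  Inside the ball the difference is at most \<open>E\<close>, and the
  weight is integrated; outside, \<open>q\<close> vanishes and the weight of order \<open>s\<close> is at most \<open>R powr (2 * (s - m))\<close> times
  the weight of order \<open>m\<close>.\<close>

lemma Sobolev_estimate:
  fixes v q :: "'a::euclidean_space \<Rightarrow> complex" and R E m s :: real
  assumes v: "integrable lebesgue v" "v \<in> sobolev_space m" and sm: "s < m" and R: "R > 0" and E: "E \<ge> 0"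
    and qm: "q \<in> borel_measurable lebesgue"
    and err: "AE \<xi> in lborel. \<xi> \<in> ball 0 R \<longrightarrow> cmod (fourier v \<xi> - q \<xi>) \<le> E"
    and q0: "\<And>\<xi>. \<xi> \<notin> ball 0 R \<Longrightarrow> q \<xi> = 0"
  defines "u \<equiv> \<lambda>x. v x - inv_fourier q x"
  shows "u \<in> sobolev_space s"
    and "sobolev_norm s u \<le> (2 * pi) powr (real DIM('a) / 2) * E *
           sqrt (sphere_area DIM('a) * (LINT t:{0..R}|lebesgue. (1 + t\<^sup>2) powr s * t ^ (DIM('a) - 1)))
         + R powr (s - m) * sobolev_norm m v"
proof -
  let ?c = "fourier_const TYPE('a)"
  have vL: "v \<in> L2" and Mv: "sobolev_multiplier m v \<in> L2" using v by (auto simp: sobolev_space_def)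
  have Fv: "fourier v = fourier_L1 v" using v by (simp add: fourier_def)
  have vm: "v \<in> borel_measurable lebesgue" using borel_measurable_integrable[OF v(1)] .
  have FvL: "fourier v \<in> L2" unfolding Fv by (rule fourier_L1_isometry(1)[OF v(1) vL])
  note Fm = L2_measurable[OF FvL]
  define B where "B = 1 / (2 * pi) ^ DIM('a) * (\<integral>x. cmod (v x) \<partial>lebesgue)"
  have FB: "cmod (fourier v \<xi>) \<le> B" for \<xi>
  proof -
    have "cmod (\<integral>x. exp (\<i> * of_real (\<xi> \<bullet> x)) * v x \<partial>lebesgue) \<le> (\<integral>x. cmod (exp (\<i> * of_real (\<xi> \<bullet> x)) * v x) \<partial>lebesgue)"
      by (rule integral_norm_bound)
    then show ?thesis
      by (simp add: Fv fourier_L1_def B_def norm_mult norm_exp_i_times norm_divide norm_power divide_right_mono)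
  qed
  have bi: "integrable lebesgue (\<lambda>\<xi>::'a. c * indicator (ball 0 R) \<xi> :: real)" for c
    using emeasure_lborel_ball_finite[of "0::'a" R] by (intro integrable_mult_right) (simp add: integrable_real_indicator)
  have qb: "AE \<xi> in lebesgue. cmod (q \<xi>) \<le> (B + E) * indicator (ball 0 R) \<xi>"
    unfolding AE_lebesgue_iff using err
  proof eventually_elim
    case (elim \<xi>)
    show ?case
    proof (cases "\<xi> \<in> ball 0 R")
      case True
      then show ?thesis using elim FB[of \<xi>] norm_triangle_sub[of "q \<xi>" "fourier v \<xi>"] by (simp add: norm_minus_commute)
    qed (simp add: q0)
  qed
  have qi: "integrable lebesgue q"
    by (rule Bochner_Integration.integrable_bound[OF bi[of "B + E"] qm])
       (use qb in \<open>auto elim!: eventually_mono intro: order.trans[OF _ abs_ge_self]\<close>)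
  have qL: "q \<in> L2"
  proof -
    have "integrable lebesgue (\<lambda>\<xi>. (cmod (q \<xi>))\<^sup>2)"
    proof (rule Bochner_Integration.integrable_bound[OF bi[of "(B + E)\<^sup>2"]])
      show "(\<lambda>\<xi>. (cmod (q \<xi>))\<^sup>2) \<in> borel_measurable lebesgue" using qm by measurable
      show "AE \<xi> in lebesgue. norm ((cmod (q \<xi>))\<^sup>2) \<le> norm ((B + E)\<^sup>2 * indicator (ball 0 R) \<xi> :: real)"
        using qb
      proof eventually_elim
        case (elim \<xi>)
        then show ?case
          using power_mono[OF elim norm_ge_zero, of 2] by (auto simp: indicator_def split: if_splits)
      qed
    qed
    then show ?thesis using qm by (simp add: L2_def)
  qed
  note D = fourier_diff_inv_fourier[OF v(1) vL qi qL, folded u_def]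
  define J where "J = (\<lambda>a (\<xi>::'a). (1 + (norm \<xi>)\<^sup>2) powr a)"
  have Jm[measurable]: "J a \<in> borel_measurable borel" for a unfolding J_def by measurable
  have Jl: "J a \<in> borel_measurable lebesgue" for a by (intro measurable_completion) simp
  define G where "G = (\<lambda>\<xi>. of_real (J (s / 2) \<xi>) * (fourier v \<xi> - q \<xi>))"
  have Gm: "G \<in> borel_measurable lebesgue"
    unfolding G_def using Jl[of "s/2"] Fm qm by measurable
  have Gae: "AE \<xi> in lborel. sobolev_multiplier s u \<xi> = G \<xi>"
    using D(2) by eventually_elim (simp add: sobolev_multiplier_def G_def J_def)
  have J2: "(J (a / 2) \<xi>)\<^sup>2 = J a \<xi>" for a \<xi>
    unfolding J_def power2_eq_square powr_add[symmetric] by simp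
  define P where "P = (\<integral>\<xi>. indicator (ball 0 R) \<xi> * J s \<xi> \<partial>lborel)"
  define K where "K = R powr (s - m)"
  have ind_m: "(indicator (ball (0::'a) R) :: 'a \<Rightarrow> real) \<in> borel_measurable borel"
    by (rule borel_measurable_indicator) simp
  have Pi: "integrable lborel (\<lambda>\<xi>::'a. indicator (ball 0 R) \<xi> * J s \<xi>)"
  proof -
    define b where "b = max 1 ((1 + R\<^sup>2) powr s)"
    have bi': "integrable lborel (\<lambda>\<xi>::'a. b * indicator (ball 0 R) \<xi> :: real)"
      using emeasure_lborel_ball_finite[of "0::'a" R] by (intro integrable_mult_right) (simp add: integrable_real_indicator)
    show ?thesis
    proof (rule Bochner_Integration.integrable_bound[OF bi'])
      show "(\<lambda>\<xi>::'a. indicator (ball 0 R) \<xi> * J s \<xi>) \<in> borel_measurable lborel" using ind_m by measurable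
      show "AE \<xi> in lborel. norm (indicator (ball 0 R) \<xi> * J s \<xi>) \<le> norm (b * indicator (ball 0 R) \<xi>)"
      proof (rule AE_I2)
        fix \<xi> :: 'a
        have "J s \<xi> \<le> b" if "norm \<xi> < R"
        proof (cases "s \<ge> 0")
          case True
          then have "J s \<xi> \<le> (1 + R\<^sup>2) powr s"
            unfolding J_def using that by (intro powr_mono2) (auto intro: power_mono)
          then show ?thesis by (simp add: b_def)
        next
          case False
          then have "J s \<xi> \<le> (1 + (norm \<xi>)\<^sup>2) powr 0"
            unfolding J_def by (intro powr_mono) auto
          then show ?thesis unfolding b_def by (smt (verit) powr_zero_eq_one zero_le_power2)
        qed
        then show "norm (indicator (ball 0 R) \<xi> * J s \<xi>) \<le> norm (b * indicator (ball 0 R) \<xi>)"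
          by (auto simp: indicator_def J_def)
      qed
    qed
  qed
  have P_eq: "P = sphere_area DIM('a) * (LINT t:{0..R}|lebesgue. (1 + t\<^sup>2) powr s * t ^ (DIM('a) - 1))"
    unfolding P_def J_def using radial_integral[of "\<lambda>t. (1 + t\<^sup>2) powr s" R, where 'a='a] R
    by (simp add: set_lebesgue_integral_def)
  have P0: "P \<ge> 0" unfolding P_def J_def by simp
  have Pil: "integrable lebesgue (\<lambda>\<xi>::'a. indicator (ball 0 R) \<xi> * J s \<xi>)"
    and P_leb: "P = (\<integral>\<xi>. indicator (ball 0 R) \<xi> * J s \<xi> \<partial>lebesgue)"
    unfolding P_def using Pi ind_m by (auto simp: integrable_completion integral_completion)
  have bound: "(cmod (G \<xi>))\<^sup>2 \<le> E\<^sup>2 * (indicator (ball 0 R) \<xi> * J s \<xi>) + K\<^sup>2 * (cmod (sobolev_multiplier m v \<xi>))\<^sup>2"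
    if e: "\<xi> \<in> ball 0 R \<longrightarrow> cmod (fourier v \<xi> - q \<xi>) \<le> E" for \<xi>
  proof (cases "\<xi> \<in> ball 0 R")
    case True
    then have "(cmod (fourier v \<xi> - q \<xi>))\<^sup>2 \<le> E\<^sup>2" using e by (intro power_mono) auto
    then have "J s \<xi> * (cmod (fourier v \<xi> - q \<xi>))\<^sup>2 \<le> J s \<xi> * E\<^sup>2"
      by (intro mult_left_mono) (simp_all add: J_def)
    moreover have "(cmod (G \<xi>))\<^sup>2 = J s \<xi> * (cmod (fourier v \<xi> - q \<xi>))\<^sup>2"
      unfolding G_def norm_mult power_mult_distrib norm_of_real power2_abs J2 ..
    ultimately have "(cmod (G \<xi>))\<^sup>2 \<le> E\<^sup>2 * (indicator (ball 0 R) \<xi> * J s \<xi>)"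
      using True by (simp add: mult.commute)
    moreover have "0 \<le> K\<^sup>2 * (cmod (sobolev_multiplier m v \<xi>))\<^sup>2" by simp
    ultimately show ?thesis by (rule add_increasing2[rotated])
  next
    case False
    then have nR: "R \<le> norm \<xi>" by auto
    have "R\<^sup>2 \<le> 1 + (norm \<xi>)\<^sup>2" using power_mono[OF nR less_imp_le[OF R], of 2] by linarith
    then have "J (s - m) \<xi> \<le> (R\<^sup>2) powr (s - m)"
      unfolding J_def using R sm by (intro powr_mono2') auto
    also have "(R\<^sup>2) powr (s - m) = K\<^sup>2"
      unfolding K_def power2_eq_square using R by (simp add: powr_mult)
    finally have k: "J (s - m) \<xi> \<le> K\<^sup>2" .
    have "J s \<xi> = J (s - m) \<xi> * J m \<xi>"
      unfolding J_def powr_add[symmetric] by simp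
    then have "(cmod (G \<xi>))\<^sup>2 = J (s - m) \<xi> * (J m \<xi> * (cmod (fourier v \<xi>))\<^sup>2)"
      unfolding G_def norm_mult power_mult_distrib norm_of_real power2_abs J2 by (simp add: q0[OF False])
    also have "J m \<xi> * (cmod (fourier v \<xi>))\<^sup>2 = (cmod (of_real (J (m / 2) \<xi>) * fourier v \<xi>))\<^sup>2"
      unfolding norm_mult power_mult_distrib norm_of_real power2_abs J2 ..
    also have "of_real (J (m / 2) \<xi>) * fourier v \<xi> = sobolev_multiplier m v \<xi>"
      by (simp add: sobolev_multiplier_def J_def)
    also have "J (s - m) \<xi> * (cmod (sobolev_multiplier m v \<xi>))\<^sup>2 \<le> K\<^sup>2 * (cmod (sobolev_multiplier m v \<xi>))\<^sup>2"
      by (rule mult_right_mono[OF k]) simp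
    finally show ?thesis using False by simp
  qed
  have hi: "integrable lebesgue (\<lambda>\<xi>. E\<^sup>2 * (indicator (ball 0 R) \<xi> * J s \<xi>) + K\<^sup>2 * (cmod (sobolev_multiplier m v \<xi>))\<^sup>2)"
    by (intro Bochner_Integration.integrable_add integrable_mult_right Pil L2_integrable Mv)
  have bae: "AE \<xi> in lebesgue. (cmod (G \<xi>))\<^sup>2 \<le> E\<^sup>2 * (indicator (ball 0 R) \<xi> * J s \<xi>) + K\<^sup>2 * (cmod (sobolev_multiplier m v \<xi>))\<^sup>2"
    unfolding AE_lebesgue_iff using err by eventually_elim (rule bound)
  have G2: "integrable lebesgue (\<lambda>\<xi>. (cmod (G \<xi>))\<^sup>2)"
  proof (rule Bochner_Integration.integrable_bound[OF hi])
    show "(\<lambda>\<xi>. (cmod (G \<xi>))\<^sup>2) \<in> borel_measurable lebesgue" using Gm by measurable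
    show "AE \<xi> in lebesgue. norm ((cmod (G \<xi>))\<^sup>2) \<le> norm (E\<^sup>2 * (indicator (ball 0 R) \<xi> * J s \<xi>) + K\<^sup>2 * (cmod (sobolev_multiplier m v \<xi>))\<^sup>2)"
      using bae by eventually_elim (simp only: real_norm_def abs_power2 order.trans[OF _ abs_ge_self])
  qed
  have GL: "G \<in> L2" using G2 Gm by (simp add: L2_def)
  have MuL: "sobolev_multiplier s u \<in> L2" "L2_norm (sobolev_multiplier s u) = L2_norm G"
    using L2_cong_AE[OF GL Gae] by auto
  show "u \<in> sobolev_space s"
    using D(1) MuL(1) inv_fourier_isometry(1)[OF MuL(1)] by (simp add: sobolev_space_def)
  have "(L2_norm G)\<^sup>2 \<le> (\<integral>\<xi>. E\<^sup>2 * (indicator (ball 0 R) \<xi> * J s \<xi>) + K\<^sup>2 * (cmod (sobolev_multiplier m v \<xi>))\<^sup>2 \<partial>lebesgue)"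
    unfolding L2_norm_power2 by (intro integral_mono_AE G2 hi bae)
  also have "\<dots> = E\<^sup>2 * P + K\<^sup>2 * (L2_norm (sobolev_multiplier m v))\<^sup>2"
    unfolding L2_norm_power2 P_leb using Pil L2_integrable[OF Mv] by simp
  also have "\<dots> = (E * sqrt P)\<^sup>2 + (K * L2_norm (sobolev_multiplier m v))\<^sup>2"
    using P0 by (simp add: power_mult_distrib)
  also have "\<dots> \<le> (E * sqrt P + K * L2_norm (sobolev_multiplier m v))\<^sup>2"
    using E P0 L2_norm_nonneg[of "sobolev_multiplier m v"] by (simp add: power2_sum K_def)
  finally have "L2_norm G \<le> E * sqrt P + K * L2_norm (sobolev_multiplier m v)"
    by (rule power2_le_imp_le) (use E P0 L2_norm_nonneg[of "sobolev_multiplier m v"] in \<open>simp add: K_def\<close>)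
  then have "?c * L2_norm G \<le> ?c * (E * sqrt P + K * L2_norm (sobolev_multiplier m v))"
    using fourier_const(1)[where 'a='a] by (intro mult_left_mono) auto
  also have "\<dots> = ?c * E * sqrt P + K * (?c * L2_norm (sobolev_multiplier m v))"
    by (simp add: algebra_simps)
  finally have "sobolev_norm s u \<le> ?c * E * sqrt P + K * sobolev_norm m v"
    unfolding sobolev_norm_def inv_fourier_isometry(2)[OF MuL(1)] inv_fourier_isometry(2)[OF Mv] MuL(2) .
  then show "sobolev_norm s u \<le> (2 * pi) powr (real DIM('a) / 2) * E *
           sqrt (sphere_area DIM('a) * (LINT t:{0..R}|lebesgue. (1 + t\<^sup>2) powr s * t ^ (DIM('a) - 1)))
         + R powr (s - m) * sobolev_norm m v"
    unfolding fourier_const_def P_eq K_def .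
qed

theorem reconstruction_estimate:
  fixes v w :: "'a::euclidean_space \<Rightarrow> complex" and N \<sigma> r \<nu> \<delta> \<alpha> \<tau> m s \<gamma> :: real
  assumes N: "N > 0" and \<sigma>: "\<sigma> > 0" and r: "r > 0" and \<nu>: "\<nu> \<ge> 1" and \<delta>: "0 < \<delta>" "\<delta> < N"
    and \<alpha>: "0 \<le> \<alpha>" "\<alpha> \<le> 1" and \<tau>: "\<tau> = 1 - sqrt (1 - (1 - \<alpha>) / \<nu>)"
    and adm: "admissible_data N \<sigma> \<nu> r \<delta> v w" and v: "v \<in> sobolev_space m" "sobolev_norm m v \<le> \<gamma>" and sm: "s < m"
  shows "reconstruction_error N \<sigma> \<nu> r \<tau> \<delta> v w \<in> sobolev_space s"
    and "sobolev_norm s (reconstruction_error N \<sigma> \<nu> r \<tau> \<delta> v w)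
          \<le> 8 * (2 * pi) powr (real DIM('a) / 2) * N powr (1 - \<alpha>) *
              sqrt (sphere_area DIM('a) *
                (LINT t:{0..r * Lpar N \<sigma> \<nu> r \<tau> \<delta>}|lebesgue. (1 + t\<^sup>2) powr s * t ^ (DIM('a) - 1))) *
              Lpar N \<sigma> \<nu> r \<tau> \<delta> * \<delta> powr \<alpha>
            + \<gamma> * r powr (- m + s) * Lpar N \<sigma> \<nu> r \<tau> \<delta> powr (- m + s)"
proof -
  define L where "L = Lpar N \<sigma> \<nu> r \<tau> \<delta>"
  define q where "q = extrapolate_star N \<sigma> \<nu> r \<tau> \<delta> w"
  define E where "E = 8 * N powr (1 - \<alpha>) * L * \<delta> powr \<alpha>"
  have L: "L \<ge> 1" unfolding L_def by (rule Lpar_ge_1)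
  have vi: "integrable lebesgue v" using adm by (simp add: admissible_data_def)
  have R: "r * L > 0" using r L by simp
  have E: "E \<ge> 0" using L by (simp add: E_def)
  note X = extrapolate_star_error[OF N \<sigma> r \<nu> \<delta> \<alpha> \<tau> adm, folded L_def q_def, folded E_def]
  have e: "reconstruction_error N \<sigma> \<nu> r \<tau> \<delta> v w = (\<lambda>x. v x - inv_fourier q x)"
    unfolding reconstruction_error_def[abs_def] q_def ..
  note S = Sobolev_estimate[OF vi v(1) sm R E X]
  show "reconstruction_error N \<sigma> \<nu> r \<tau> \<delta> v w \<in> sobolev_space s" unfolding e by (rule S(1))
  have "(r * L) powr (s - m) * sobolev_norm m v \<le> (r * L) powr (s - m) * \<gamma>"
    by (rule mult_left_mono[OF v(2)]) simp
  also have "\<dots> = \<gamma> * r powr (- m + s) * L powr (- m + s)" using r L by (simp add: powr_mult)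
  finally have tail: "(r * L) powr (s - m) * sobolev_norm m v \<le> \<gamma> * r powr (- m + s) * L powr (- m + s)" .
  have main: "(2 * pi) powr (real DIM('a) / 2) * E * y = 8 * (2 * pi) powr (real DIM('a) / 2) * N powr (1 - \<alpha>) * y * L * \<delta> powr \<alpha>" for y
    by (simp add: E_def mult_ac)
  show "sobolev_norm s (reconstruction_error N \<sigma> \<nu> r \<tau> \<delta> v w)
          \<le> 8 * (2 * pi) powr (real DIM('a) / 2) * N powr (1 - \<alpha>) *
              sqrt (sphere_area DIM('a) *
                (LINT t:{0..r * Lpar N \<sigma> \<nu> r \<tau> \<delta>}|lebesgue. (1 + t\<^sup>2) powr s * t ^ (DIM('a) - 1))) *
              Lpar N \<sigma> \<nu> r \<tau> \<delta> * \<delta> powr \<alpha>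
            + \<gamma> * r powr (- m + s) * Lpar N \<sigma> \<nu> r \<tau> \<delta> powr (- m + s)"
    unfolding e L_def[symmetric] using S(2) tail unfolding main by linarith
qed

section \<open>The logarithmic rate\<close>

lemma powr_mult_exp_bounded:
  fixes q a :: real
  assumes a: "a > 0"
  obtains C where "C > 0" "\<And>x. x \<ge> 1 \<Longrightarrow> x powr q * exp (- (a * x)) \<le> C"
proof -
  obtain n :: nat where n: "q \<le> real n" using real_arch_simple by blast
  have "x powr q * exp (- (a * x)) \<le> fact n / a ^ n" if x: "x \<ge> 1" for x
  proof -
    have "(\<Sum>k\<in>{n}. (a * x) ^ k /\<^sub>R fact k) \<le> (\<Sum>k. (a * x) ^ k /\<^sub>R fact k)"
      using a x by (intro sum_le_suminf summable_exp_generic) auto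
    then have "(a * x) ^ n / fact n \<le> exp (a * x)" by (simp add: exp_def divide_inverse mult.commute)
    then have "x ^ n \<le> fact n / a ^ n * exp (a * x)"
      using a by (simp add: power_mult_distrib field_simps)
    moreover have "x powr q \<le> x ^ n" using x n by (simp add: powr_realpow[symmetric] powr_mono)
    ultimately have "x powr q * exp (- (a * x)) \<le> (fact n / a ^ n * exp (a * x)) * exp (- (a * x))"
      by (intro mult_right_mono) auto
    then show ?thesis by (simp add: mult.assoc mult_exp_exp)
  qed
  then show ?thesis using a by (intro that[of "fact n / a ^ n"]) auto
qed

lemma one_le_ln_3_plus:
  fixes \<delta> :: real
  assumes "\<delta> > 0"
  shows "1 \<le> ln (3 + 1 / \<delta>)"
proof -
  have "exp 1 \<le> 3 + 1 / \<delta>" using exp_le assms by (smt (verit) zero_le_divide_1_iff)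
  then show ?thesis using assms by (subst ln_ge_iff) (auto intro: add_pos_pos)
qed

text \<open>The numbers \<open>ln (N / \<delta>)\<close> and \<open>ln (3 + 1 / \<delta>)\<close> are comparable for small \<open>\<delta>\<close>.  For \<open>\<delta>\<close> near \<open>N\<close> the former tends to
  zero, and the lower bound comes from the maximum with \<open>1\<close> in the definition of \<open>Lpar\<close>.\<close>

lemma Lpar_log_bounds:
  fixes N \<sigma> r \<nu> \<tau> :: real
  assumes N: "N > 0" and \<sigma>: "\<sigma> > 0" and r: "r > 0" and \<tau>: "0 < \<tau>" "\<tau> < 1"
  obtains c C where "c > 0" "C > 0"
    "\<And>\<delta>. 0 < \<delta> \<Longrightarrow> \<delta> < N \<Longrightarrow> c * ln (3 + 1 / \<delta>) powr \<tau> \<le> Lpar N \<sigma> \<nu> r \<tau> \<delta>"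
    "\<And>\<delta>. 0 < \<delta> \<Longrightarrow> \<delta> < N \<Longrightarrow> Lpar N \<sigma> \<nu> r \<tau> \<delta> \<le> C * ln (3 + 1 / \<delta>)"
proof -
  define a where "a = (1 - \<tau>) / (\<sigma> * r powr \<nu>)"
  have a: "a > 0" using \<tau> \<sigma> r by (simp add: a_def)
  have L_eq: "Lpar N \<sigma> \<nu> r \<tau> \<delta> = max 1 (1/2 * (a * ln (N / \<delta>)) powr \<tau>)" for \<delta>
    by (simp add: Lpar_def a_def)
  define K where "K = ln (3 + 1 / N)"
  have K: "K > 0" unfolding K_def using one_le_ln_3_plus[OF N] by simp
  define c where "c = min (1 / (2 * K) powr \<tau>) (1/2 * (a / 2) powr \<tau>)"
  define C where "C = 1 + 1/2 * (a * (\<bar>ln N\<bar> + 1)) powr \<tau>"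
  have c: "c > 0" using a K by (simp add: c_def)
  have C: "C > 0" unfolding C_def by (simp add: add_pos_nonneg)
  have low: "c * ln (3 + 1 / \<delta>) powr \<tau> \<le> Lpar N \<sigma> \<nu> r \<tau> \<delta>"
    and up: "Lpar N \<sigma> \<nu> r \<tau> \<delta> \<le> C * ln (3 + 1 / \<delta>)" if \<delta>: "0 < \<delta>" "\<delta> < N" for \<delta>
  proof -
    define X where "X = ln (3 + 1 / \<delta>)"
    define Y where "Y = ln (N / \<delta>)"
    have X: "X \<ge> 1" unfolding X_def by (rule one_le_ln_3_plus[OF \<delta>(1)])
    have Y: "Y > 0" unfolding Y_def using \<delta> by (intro ln_gt_zero) simp
    have "3 + 1 / \<delta> \<le> (3 + 1 / N) * (N / \<delta>)"
      using \<delta> N by (simp add: field_simps)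
    then have "X \<le> ln ((3 + 1 / N) * (N / \<delta>))"
      unfolding X_def using \<delta> by (intro ln_mono) (auto intro: add_pos_pos)
    also have "\<dots> = K + Y" unfolding K_def Y_def using N \<delta> by (intro ln_mult_pos) (auto intro: add_pos_pos)
    finally have XY: "X \<le> K + Y" .
    have "1 / \<delta> \<le> 3 + 1 / \<delta>" by simp
    then have "ln (1 / \<delta>) \<le> X" unfolding X_def using \<delta> by (intro ln_mono) auto
    moreover have "Y = ln N + ln (1 / \<delta>)" unfolding Y_def using N \<delta> by (simp add: ln_div)
    ultimately have "Y \<le> \<bar>ln N\<bar> + X" by simp
    also have "\<dots> \<le> (\<bar>ln N\<bar> + 1) * X" using X mult_left_mono[OF X, of "\<bar>ln N\<bar>"] by (simp add: distrib_right)
    finally have YX: "Y \<le> (\<bar>ln N\<bar> + 1) * X" .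
    show "c * ln (3 + 1 / \<delta>) powr \<tau> \<le> Lpar N \<sigma> \<nu> r \<tau> \<delta>"
      unfolding X_def[symmetric] L_eq Y_def[symmetric]
    proof (cases "Y \<le> K")
      case True
      then have "X powr \<tau> \<le> (2 * K) powr \<tau>" using XY X \<tau> by (intro powr_mono2) auto
      then have "1 / (2 * K) powr \<tau> * X powr \<tau> \<le> 1" using K by (simp add: field_simps)
      moreover have "c * X powr \<tau> \<le> 1 / (2 * K) powr \<tau> * X powr \<tau>"
        by (intro mult_right_mono) (simp_all add: c_def)
      ultimately show "c * X powr \<tau> \<le> max 1 (1/2 * (a * Y) powr \<tau>)" by linarith
    next
      case False
      then have "X / 2 \<le> Y" using XY by simp
      then have "(a / 2 * X) powr \<tau> \<le> (a * Y) powr \<tau>" using a X \<tau> by (intro powr_mono2) auto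
      moreover have "(a / 2 * X) powr \<tau> = (a / 2) powr \<tau> * X powr \<tau>"
        by (subst powr_mult) (use a X in auto)
      ultimately have "1/2 * (a / 2) powr \<tau> * X powr \<tau> \<le> 1/2 * (a * Y) powr \<tau>" by simp
      moreover have "c * X powr \<tau> \<le> 1/2 * (a / 2) powr \<tau> * X powr \<tau>"
        by (intro mult_right_mono) (simp_all add: c_def)
      ultimately show "c * X powr \<tau> \<le> max 1 (1/2 * (a * Y) powr \<tau>)" by linarith
    qed
    have "(a * Y) powr \<tau> \<le> (a * (\<bar>ln N\<bar> + 1) * X) powr \<tau>"
      using a Y YX \<tau> by (intro powr_mono2) (auto simp: mult.assoc)
    also have "\<dots> = (a * (\<bar>ln N\<bar> + 1)) powr \<tau> * X powr \<tau>" using a X by (simp add: powr_mult)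
    also have "\<dots> \<le> (a * (\<bar>ln N\<bar> + 1)) powr \<tau> * X powr 1"
      using X \<tau> by (intro mult_left_mono powr_mono) auto
    finally have "1/2 * (a * Y) powr \<tau> \<le> 1/2 * (a * (\<bar>ln N\<bar> + 1)) powr \<tau> * X" using X by simp
    moreover have "C * X = X + 1/2 * (a * (\<bar>ln N\<bar> + 1)) powr \<tau> * X" by (simp add: C_def distrib_right)
    moreover have "0 \<le> 1/2 * (a * (\<bar>ln N\<bar> + 1)) powr \<tau> * X" using X by simp
    ultimately show "Lpar N \<sigma> \<nu> r \<tau> \<delta> \<le> C * ln (3 + 1 / \<delta>)"
      unfolding X_def[symmetric] L_eq Y_def[symmetric] using X by (intro max.boundedI) linarith+
  qed
  show ?thesis by (rule that[OF c C low up])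
qed

lemma radial_weight_integral_le:
  fixes s R :: real
  assumes R: "R \<ge> 0" and d: "d \<ge> 1"
  shows "(LINT t:{0..R}|lebesgue. (1 + t\<^sup>2) powr s * t ^ (d - 1)) \<le> (1 + R\<^sup>2) powr \<bar>s\<bar> * R ^ d"
proof -
  have "(LINT t:{0..R}|lebesgue. (1 + t\<^sup>2) powr s * t ^ (d - 1)) \<le> (\<integral>t. (1 + R\<^sup>2) powr \<bar>s\<bar> * R ^ (d - 1) * indicator {0..R} t \<partial>lebesgue)"
    unfolding set_lebesgue_integral_def
  proof (rule integral_mono')
    show "integrable lebesgue (\<lambda>t. (1 + R\<^sup>2) powr \<bar>s\<bar> * R ^ (d - 1) * indicator {0..R} t)"
      by (intro integrable_mult_right) (simp add: integrable_real_indicator R)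
    fix t
    show "0 \<le> (1 + R\<^sup>2) powr \<bar>s\<bar> * R ^ (d - 1) * indicator {0..R} t" using R by simp
    show "indicator {0..R} t *\<^sub>R ((1 + t\<^sup>2) powr s * t ^ (d - 1)) \<le> (1 + R\<^sup>2) powr \<bar>s\<bar> * R ^ (d - 1) * indicator {0..R} t"
    proof (cases "t \<in> {0..R}")
      case True
      have "(1 + t\<^sup>2) powr s \<le> (1 + t\<^sup>2) powr \<bar>s\<bar>" by (intro powr_mono) auto
      also have "\<dots> \<le> (1 + R\<^sup>2) powr \<bar>s\<bar>" using True by (intro powr_mono2) (auto intro: power_mono)
      finally show ?thesis using True by (auto intro!: mult_mono power_mono)
    qed simp
  qed
  also have "\<dots> = (1 + R\<^sup>2) powr \<bar>s\<bar> * (R ^ (d - 1) * R)" using R by simp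
  also have "R ^ (d - 1) * R = R ^ d" using d by (metis One_nat_def Suc_pred less_eq_Suc_le power_Suc2)
  finally show ?thesis .
qed

text \<open>With \<open>X = ln (3 + 1 / \<delta>)\<close> the first term is at most a power of \<open>X\<close> times \<open>exp (- (\<alpha> * X))\<close>, because \<open>\<delta>\<close> is at most
  \<open>(3 * N + 1) * exp (- X)\<close>.  The second term is a negative power of \<open>Lpar\<close>, which is at least a multiple of \<open>X powr \<tau>\<close>.\<close>

lemma reconstruction_bound_log_rate:
  fixes N \<sigma> r \<nu> \<tau> \<alpha> m s \<gamma> A S :: real
  assumes N: "N > 0" and \<sigma>: "\<sigma> > 0" and r: "r > 0" and \<tau>: "0 < \<tau>" "\<tau> < 1" and \<alpha>: "\<alpha> > 0"
    and sm: "s < m" and A: "A \<ge> 0" and S: "S \<ge> 0" and d: "d \<ge> 1"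
  obtains c2 where "c2 > 0"
    "\<And>\<delta>. 0 < \<delta> \<Longrightarrow> \<delta> < N \<Longrightarrow>
       A * sqrt (S * (LINT t:{0..r * Lpar N \<sigma> \<nu> r \<tau> \<delta>}|lebesgue. (1 + t\<^sup>2) powr s * t ^ (d - 1))) * Lpar N \<sigma> \<nu> r \<tau> \<delta> * \<delta> powr \<alpha>
       + \<gamma> * r powr (- m + s) * Lpar N \<sigma> \<nu> r \<tau> \<delta> powr (- m + s)
       \<le> c2 * ln (3 + 1 / \<delta>) powr (- (\<tau> * (m - s)))"
proof -
  obtain c C where c: "c > 0" and C: "C > 0"
    and low: "\<And>\<delta>. 0 < \<delta> \<Longrightarrow> \<delta> < N \<Longrightarrow> c * ln (3 + 1 / \<delta>) powr \<tau> \<le> Lpar N \<sigma> \<nu> r \<tau> \<delta>"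
    and up: "\<And>\<delta>. 0 < \<delta> \<Longrightarrow> \<delta> < N \<Longrightarrow> Lpar N \<sigma> \<nu> r \<tau> \<delta> \<le> C * ln (3 + 1 / \<delta>)"
    using Lpar_log_bounds[OF N \<sigma> r \<tau>] by metis
  define \<beta> where "\<beta> = \<tau> * (m - s)"
  define K where "K = r * C"
  have K: "K > 0" using r C by (simp add: K_def)
  \<comment> \<open>The square root of the integral grows at most like this power of the logarithm.\<close>
  define p where "p = (2 * \<bar>s\<bar> + real d) / 2"
  define B where "B = S * ((1 + K\<^sup>2) powr \<bar>s\<bar> * K ^ d)"
  have B: "B \<ge> 0" using S K by (simp add: B_def)
  obtain M where M: "M > 0" "\<And>x. x \<ge> 1 \<Longrightarrow> x powr (p + 1 + \<beta>) * exp (- (\<alpha> * x)) \<le> M"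
    using powr_mult_exp_bounded[OF \<alpha>] by metis
  define c1 where "c1 = A * sqrt B * C * (3 * N + 1) powr \<alpha> * M"
  define c2 where "c2 = \<bar>\<gamma>\<bar> * r powr (- m + s) * c powr (- m + s)"
  have c1: "c1 \<ge> 0" using A B C M by (simp add: c1_def)
  have c2: "c2 \<ge> 0" by (simp add: c2_def)
  have bound: "A * sqrt (S * (LINT t:{0..r * Lpar N \<sigma> \<nu> r \<tau> \<delta>}|lebesgue. (1 + t\<^sup>2) powr s * t ^ (d - 1))) * Lpar N \<sigma> \<nu> r \<tau> \<delta> * \<delta> powr \<alpha>
       + \<gamma> * r powr (- m + s) * Lpar N \<sigma> \<nu> r \<tau> \<delta> powr (- m + s)
       \<le> (c1 + c2 + 1) * ln (3 + 1 / \<delta>) powr (- (\<tau> * (m - s)))" if \<delta>: "0 < \<delta>" "\<delta> < N" for \<delta>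
  proof -
    define X where "X = ln (3 + 1 / \<delta>)"
    define L where "L = Lpar N \<sigma> \<nu> r \<tau> \<delta>"
    have X: "X \<ge> 1" unfolding X_def by (rule one_le_ln_3_plus[OF \<delta>(1)])
    have L1: "L \<ge> 1" unfolding L_def by (rule Lpar_ge_1)
    have Ll: "c * X powr \<tau> \<le> L" and Lu: "L \<le> C * X" unfolding X_def L_def using low up \<delta> by auto
    have RX: "r * L \<le> K * X" using Lu r by (simp add: K_def mult.assoc)
    have "(LINT t:{0..r * L}|lebesgue. (1 + t\<^sup>2) powr s * t ^ (d - 1)) \<le> (1 + (r * L)\<^sup>2) powr \<bar>s\<bar> * (r * L) ^ d"
      using r L1 d by (intro radial_weight_integral_le) auto
    also have "\<dots> \<le> ((1 + K\<^sup>2) * X\<^sup>2) powr \<bar>s\<bar> * (K * X) ^ d"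
    proof (rule mult_mono)
      have "(r * L)\<^sup>2 \<le> (K * X)\<^sup>2" using RX r L1 by (intro power_mono) auto
      moreover have "1 \<le> X\<^sup>2" using X by (simp add: one_le_power)
      ultimately have "1 + (r * L)\<^sup>2 \<le> (1 + K\<^sup>2) * X\<^sup>2" by (simp add: power_mult_distrib distrib_right)
      then show "(1 + (r * L)\<^sup>2) powr \<bar>s\<bar> \<le> ((1 + K\<^sup>2) * X\<^sup>2) powr \<bar>s\<bar>" by (intro powr_mono2) auto
      show "(r * L) ^ d \<le> (K * X) ^ d" using RX r L1 by (intro power_mono) auto
    qed (use r L1 in auto)
    also have "\<dots> = ((1 + K\<^sup>2) powr \<bar>s\<bar> * K ^ d) * X powr (2 * p)"
    proof -
      have "((1 + K\<^sup>2) * X\<^sup>2) powr \<bar>s\<bar> = (1 + K\<^sup>2) powr \<bar>s\<bar> * (X powr 2) powr \<bar>s\<bar>"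
        using X by (simp add: powr_mult)
      also have "(X powr 2) powr \<bar>s\<bar> = X powr (2 * \<bar>s\<bar>)" by (simp add: powr_powr)
      finally have "((1 + K\<^sup>2) * X\<^sup>2) powr \<bar>s\<bar> * (K * X) ^ d = ((1 + K\<^sup>2) powr \<bar>s\<bar> * K ^ d) * (X powr (2 * \<bar>s\<bar>) * X powr real d)"
        using X by (simp add: power_mult_distrib powr_realpow)
      moreover have "2 * p = 2 * \<bar>s\<bar> + real d" by (simp add: p_def)
      ultimately show ?thesis by (simp only: powr_add)
    qed
    finally have "S * (LINT t:{0..r * L}|lebesgue. (1 + t\<^sup>2) powr s * t ^ (d - 1)) \<le> B * X powr (2 * p)"
      using mult_left_mono[OF _ S] by (simp add: B_def mult.assoc)
    then have "sqrt (S * (LINT t:{0..r * L}|lebesgue. (1 + t\<^sup>2) powr s * t ^ (d - 1))) \<le> sqrt (B * X powr (2 * p))"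
      by simp
    also have "\<dots> = sqrt B * X powr p"
    proof -
      have "X powr (2 * p) = (X powr p)\<^sup>2" unfolding power2_eq_square powr_add[symmetric] by simp
      then show ?thesis by (simp add: real_sqrt_mult)
    qed
    finally have I: "sqrt (S * (LINT t:{0..r * L}|lebesgue. (1 + t\<^sup>2) powr s * t ^ (d - 1))) \<le> sqrt B * X powr p" .
    have S0: "0 \<le> S * (LINT t:{0..r * L}|lebesgue. (1 + t\<^sup>2) powr s * t ^ (d - 1))"
      unfolding set_lebesgue_integral_def
      by (intro mult_nonneg_nonneg S Bochner_Integration.integral_nonneg) (auto simp: indicator_def)
    have D: "\<delta> powr \<alpha> \<le> (3 * N + 1) powr \<alpha> * exp (- (\<alpha> * X))"
    proof -
      have "exp X = 3 + 1 / \<delta>" unfolding X_def using \<delta> by (intro exp_ln) (auto intro: add_pos_pos)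
      then have "\<delta> * exp X = 3 * \<delta> + 1" using \<delta> by (simp add: field_simps)
      then have "\<delta> * exp X \<le> 3 * N + 1" using \<delta> by simp
      then have "\<delta> \<le> (3 * N + 1) * exp (- X)" by (simp add: exp_minus field_simps)
      then have "\<delta> powr \<alpha> \<le> ((3 * N + 1) * exp (- X)) powr \<alpha>" using \<delta> \<alpha> by (intro powr_mono2) auto
      also have "\<dots> = (3 * N + 1) powr \<alpha> * exp (- X) powr \<alpha>" using N by (simp add: powr_mult)
      also have "exp (- X) powr \<alpha> = exp (- (\<alpha> * X))" by (simp add: powr_def)
      finally show ?thesis .
    qed
    have "A * sqrt (S * (LINT t:{0..r * L}|lebesgue. (1 + t\<^sup>2) powr s * t ^ (d - 1))) * L * \<delta> powr \<alpha>
       \<le> A * (sqrt B * X powr p) * (C * X) * ((3 * N + 1) powr \<alpha> * exp (- (\<alpha> * X)))"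
      using A B C X L1 S0 by (intro mult_mono mult_nonneg_nonneg I Lu D order_refl) auto
    also have "\<dots> = A * sqrt B * C * (3 * N + 1) powr \<alpha> * (X powr (p + 1 + \<beta>) * exp (- (\<alpha> * X))) * X powr (- \<beta>)"
    proof -
      have "X powr p * X = X powr (p + 1 + \<beta>) * X powr (- \<beta>)"
        unfolding powr_add[symmetric] using X by (simp add: powr_add)
      then show ?thesis by (simp add: mult_ac)
    qed
    also have "\<dots> \<le> A * sqrt B * C * (3 * N + 1) powr \<alpha> * M * X powr (- \<beta>)"
      using M(2)[OF X] A B C by (intro mult_right_mono mult_left_mono) auto
    finally have T1: "A * sqrt (S * (LINT t:{0..r * L}|lebesgue. (1 + t\<^sup>2) powr s * t ^ (d - 1))) * L * \<delta> powr \<alpha> \<le> c1 * X powr (- \<beta>)"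
      by (simp add: c1_def)
    have "L powr (- m + s) \<le> (c * X powr \<tau>) powr (- m + s)"
      using Ll c X sm by (intro powr_mono2') auto
    also have "\<dots> = c powr (- m + s) * X powr (- \<beta>)"
    proof -
      have "\<tau> * (- m + s) = - \<beta>" by (simp add: \<beta>_def algebra_simps)
      then show ?thesis using c X by (simp add: powr_mult powr_powr)
    qed
    finally have Lp: "L powr (- m + s) \<le> c powr (- m + s) * X powr (- \<beta>)" .
    have "\<gamma> * r powr (- m + s) * L powr (- m + s) \<le> \<bar>\<gamma>\<bar> * r powr (- m + s) * (c powr (- m + s) * X powr (- \<beta>))"
      by (intro mult_mono Lp) auto
    then have T2: "\<gamma> * r powr (- m + s) * L powr (- m + s) \<le> c2 * X powr (- \<beta>)"
      by (simp add: c2_def mult.assoc)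
    have "0 \<le> X powr (- \<beta>)" by simp
    then show ?thesis unfolding X_def[symmetric] L_def[symmetric] \<beta>_def[symmetric]
      unfolding distrib_right mult_1_left using T1 T2 by linarith
  qed
  show ?thesis by (rule that[OF _ bound]) (use c1 c2 in auto)
qed

theorem theorem3p2:
  fixes N \<sigma> r \<nu> m s \<gamma>2 :: real
  assumes "N > 0" and "\<sigma> > 0" and "r > 0" and "\<nu> \<ge> 1"
    and "m \<ge> - (real DIM('a::euclidean_space) / 2)" and "s < m"
  shows
    "(\<forall>\<delta> (v :: 'a \<Rightarrow> complex) w \<alpha> \<tau>.
        0 < \<delta> \<and> \<delta> < N \<and> admissible_data N \<sigma> \<nu> r \<delta> v w \<and>
        v \<in> sobolev_space m \<and> sobolev_norm m v \<le> \<gamma>2 \<and>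
        0 \<le> \<alpha> \<and> \<alpha> \<le> 1 \<and> \<tau> = 1 - sqrt (1 - (1 - \<alpha>) / \<nu>) \<longrightarrow>
        reconstruction_error N \<sigma> \<nu> r \<tau> \<delta> v w \<in> sobolev_space s \<and>
        sobolev_norm s (reconstruction_error N \<sigma> \<nu> r \<tau> \<delta> v w)
          \<le> 8 * (2 * pi) powr (real DIM('a) / 2) * N powr (1 - \<alpha>) *
              sqrt (sphere_area DIM('a) *
                (LINT t:{0..r * Lpar N \<sigma> \<nu> r \<tau> \<delta>}|lebesgue. (1 + t\<^sup>2) powr s * t ^ (DIM('a) - 1))) *
              Lpar N \<sigma> \<nu> r \<tau> \<delta> * \<delta> powr \<alpha>
            + \<gamma>2 * r powr (- m + s) * Lpar N \<sigma> \<nu> r \<tau> \<delta> powr (- m + s)) \<and>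
     (\<forall>\<beta>2. 0 < \<beta>2 / (m - s) \<and> \<beta>2 / (m - s) < 1 - sqrt (1 - 1 / \<nu>) \<longrightarrow>
        (\<exists>c2>0. \<forall>\<delta> (v :: 'a \<Rightarrow> complex) w \<tau>.
           0 < \<delta> \<and> \<delta> < N \<and> admissible_data N \<sigma> \<nu> r \<delta> v w \<and>
           v \<in> sobolev_space m \<and> sobolev_norm m v \<le> \<gamma>2 \<and>
           \<tau> = \<beta>2 / (m - s) \<longrightarrow>
           reconstruction_error N \<sigma> \<nu> r \<tau> \<delta> v w \<in> sobolev_space s \<and>
           sobolev_norm s (reconstruction_error N \<sigma> \<nu> r \<tau> \<delta> v w)
             \<le> c2 * ln (3 + 1 / \<delta>) powr (- \<beta>2)))"
proof (rule conjI; intro allI impI; elim conjE)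
  fix \<delta> :: real and v w :: "'a \<Rightarrow> complex" and \<alpha> \<tau> :: real
  assume \<delta>: "0 < \<delta>" "\<delta> < N" and adm: "admissible_data N \<sigma> \<nu> r \<delta> v w"
    and v: "v \<in> sobolev_space m" "sobolev_norm m v \<le> \<gamma>2"
    and \<alpha>: "0 \<le> \<alpha>" "\<alpha> \<le> 1" and \<tau>: "\<tau> = 1 - sqrt (1 - (1 - \<alpha>) / \<nu>)"
  note est = reconstruction_estimate[OF assms(1-4) \<delta> \<alpha> \<tau> adm v assms(6)]
  show "reconstruction_error N \<sigma> \<nu> r \<tau> \<delta> v w \<in> sobolev_space s \<and>
        sobolev_norm s (reconstruction_error N \<sigma> \<nu> r \<tau> \<delta> v w)
          \<le> 8 * (2 * pi) powr (real DIM('a) / 2) * N powr (1 - \<alpha>) *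
              sqrt (sphere_area DIM('a) *
                (LINT t:{0..r * Lpar N \<sigma> \<nu> r \<tau> \<delta>}|lebesgue. (1 + t\<^sup>2) powr s * t ^ (DIM('a) - 1))) *
              Lpar N \<sigma> \<nu> r \<tau> \<delta> * \<delta> powr \<alpha>
            + \<gamma>2 * r powr (- m + s) * Lpar N \<sigma> \<nu> r \<tau> \<delta> powr (- m + s)"
    by (rule conjI[OF est])
next
  fix \<beta>2 :: real
  assume \<beta>2: "0 < \<beta>2 / (m - s)" "\<beta>2 / (m - s) < 1 - sqrt (1 - 1 / \<nu>)"
  define \<tau> where "\<tau> = \<beta>2 / (m - s)"
  \<comment> \<open>The exponent for which the first part of the theorem prescribes the given \<open>\<tau>\<close>.\<close>
  define \<alpha> where "\<alpha> = 1 - \<nu> * (1 - (1 - \<tau>)\<^sup>2)"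
  have \<tau>0: "0 < \<tau>" and \<tau>u: "sqrt (1 - 1 / \<nu>) < 1 - \<tau>" using \<beta>2 by (auto simp: \<tau>_def)
  have s0: "0 \<le> 1 - 1 / \<nu>" using assms(4) by simp
  have "0 \<le> sqrt (1 - 1 / \<nu>)" using s0 by simp
  then have \<tau>1: "\<tau> < 1" using \<tau>u by linarith
  have "(sqrt (1 - 1 / \<nu>))\<^sup>2 < (1 - \<tau>)\<^sup>2" using \<tau>u s0 by (intro power_strict_mono) auto
  then have "1 - (1 - \<tau>)\<^sup>2 < 1 / \<nu>" using s0 by simp
  then have \<alpha>0: "\<alpha> > 0" unfolding \<alpha>_def using assms(4) by (simp add: field_simps)
  have "(1 - \<tau>)\<^sup>2 \<le> 1" using \<tau>0 \<tau>1 by (intro power_le_one) auto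
  then have \<alpha>1: "\<alpha> \<le> 1" unfolding \<alpha>_def using assms(4) by simp
  have "(1 - \<alpha>) / \<nu> = 1 - (1 - \<tau>)\<^sup>2" unfolding \<alpha>_def using assms(4) by simp
  then have \<tau>\<alpha>: "\<tau> = 1 - sqrt (1 - (1 - \<alpha>) / \<nu>)" using \<tau>1 by simp
  have \<tau>\<beta>: "\<tau> * (m - s) = \<beta>2" unfolding \<tau>_def using assms(6) by simp
  have A: "0 \<le> 8 * (2 * pi) powr (real DIM('a) / 2) * N powr (1 - \<alpha>)" by simp
  have S: "0 \<le> sphere_area DIM('a)" unfolding sphere_area_eq by (simp add: unit_ball_vol_nonneg)
  have d: "1 \<le> DIM('a)" by (simp add: Suc_leI)
  obtain c2 where c2: "c2 > 0" and bound: "\<And>\<delta>. 0 < \<delta> \<Longrightarrow> \<delta> < N \<Longrightarrow>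
       8 * (2 * pi) powr (real DIM('a) / 2) * N powr (1 - \<alpha>) * sqrt (sphere_area DIM('a) * (LINT t:{0..r * Lpar N \<sigma> \<nu> r \<tau> \<delta>}|lebesgue. (1 + t\<^sup>2) powr s * t ^ (DIM('a) - 1))) * Lpar N \<sigma> \<nu> r \<tau> \<delta> * \<delta> powr \<alpha>
       + \<gamma>2 * r powr (- m + s) * Lpar N \<sigma> \<nu> r \<tau> \<delta> powr (- m + s)
       \<le> c2 * ln (3 + 1 / \<delta>) powr (- (\<tau> * (m - s)))"
    using reconstruction_bound_log_rate[OF assms(1-3) \<tau>0 \<tau>1 \<alpha>0 assms(6) A S d, of \<nu> \<gamma>2] by blast
  show "\<exists>c2>0. \<forall>\<delta> (v :: 'a \<Rightarrow> complex) w \<tau>.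
           0 < \<delta> \<and> \<delta> < N \<and> admissible_data N \<sigma> \<nu> r \<delta> v w \<and>
           v \<in> sobolev_space m \<and> sobolev_norm m v \<le> \<gamma>2 \<and>
           \<tau> = \<beta>2 / (m - s) \<longrightarrow>
           reconstruction_error N \<sigma> \<nu> r \<tau> \<delta> v w \<in> sobolev_space s \<and>
           sobolev_norm s (reconstruction_error N \<sigma> \<nu> r \<tau> \<delta> v w)
             \<le> c2 * ln (3 + 1 / \<delta>) powr (- \<beta>2)"
  proof (intro exI[of _ c2] conjI c2 allI impI; elim conjE)
    fix \<delta> :: real and v w :: "'a \<Rightarrow> complex" and \<tau>'
    assume \<delta>: "0 < \<delta>" "\<delta> < N" and adm: "admissible_data N \<sigma> \<nu> r \<delta> v w"
      and v: "v \<in> sobolev_space m" "sobolev_norm m v \<le> \<gamma>2" and \<tau>': "\<tau>' = \<beta>2 / (m - s)"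
    have e: "\<tau>' = \<tau>" by (simp add: \<tau>' \<tau>_def)
    note est = reconstruction_estimate[OF assms(1-4) \<delta> less_imp_le[OF \<alpha>0] \<alpha>1 \<tau>\<alpha> adm v assms(6)]
    show "reconstruction_error N \<sigma> \<nu> r \<tau>' \<delta> v w \<in> sobolev_space s" unfolding e by (rule est(1))
    show "sobolev_norm s (reconstruction_error N \<sigma> \<nu> r \<tau>' \<delta> v w) \<le> c2 * ln (3 + 1 / \<delta>) powr (- \<beta>2)"
      unfolding e using order.trans[OF est(2) bound[OF \<delta>]] unfolding \<tau>\<beta> .
  qed
qed

end
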